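(* Let $k\ge2$ and $\boldsymbol\alpha\in\Delta$. Then: (a) $\Phi^{-1}(\Phi(\boldsymbol\alpha))\subset\Delta$ is a $d$-dimensional simplex for some $d$ with $0\le d\le k-2$. (b) $\mathcal{I}(\boldsymbol\alpha)$ is the minimum of $\mathcal{M}(\boldsymbol\alpha)$ (i.e. $\mathcal{I}(\boldsymbol\alpha)\in\mathcal{M}(\boldsymbol\alpha)$) if and only if $\Phi^{-1}(\Phi(\boldsymbol\alpha))$ is a single point.
   Context: Fix an integer $k\ge 2$; $\mathbb{N}=\{0,1,2,\ldots\}$. Let $\mathcal{A}=\{1,\ldots,k\}$, and let $\Sigma=\mathcal{A}^{\mathbb{N}}$ be the space of sequences $w=(w_r)_{r\ge0}$, ordered lexicographically. For a non-empty finite word $W$ over $\mathcal{A}$, $|W|$ is its length and $|W|_i$ the number of occurrences of the letter $i$ in $W$. For $w\in\Sigma$, $w^{(r)}=w_0\ldots w_{r-1}$. The shift $\sigma:\Sigma\to\Sigma$ is $\sigma(w)_r=w_{r+1}$. A sequence $w\in\Sigma$ is maximal if $\sigma^r(w)\le w$ for all $r\ge0$; $\mathcal{M}\subset\Sigma$ is the set of maximal sequences. Let $\Delta=\{\boldsymbol\alpha\in\mathbb{R}_{\ge0}^k:\alpha_k>0,\ \sum_i\alpha_i=1\}$. For a finite word $W$, $\boldsymbol\rho(W)\in\mathbb{Q}^k$ has $i$th entry $|W|_i/|W|$. For $\boldsymbol\alpha\in\Delta$ let $\mathcal{R}(\boldsymbol\alpha)=\{w\in\Sigma:\boldsymbol\rho(w^{(r)})\to\boldsymbol\alpha\text{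 as }r\to\infty\}$, $\mathcal{M}(\boldsymbol\alpha)=\mathcal{M}\cap\mathcal{R}(\boldsymbol\alpha)$ (which is non-empty), and $\mathcal{I}(\boldsymbol\alpha)=\inf\mathcal{M}(\boldsymbol\alpha)$ (infimum in $\Sigma$; every non-empty subset of $\Sigma$ has an infimum). Let $J(\boldsymbol\alpha)=\lfloor\alpha_1/\alpha_k\rfloor$ and $\Delta_n=\{\boldsymbol\alpha\in\Delta:J(\boldsymbol\alpha)=n\}$ for $n\in\mathbb{N}$. Define $K_n:\Delta_n\to\Delta$ by $$K_n(\boldsymbol\alpha)=\frac{1}{1-\alpha_1}\bigl(\alpha_2,\alpha_3,\ldots,\alpha_{k-1},\ \alpha_1-n\alpha_k,\ (n+1)\alpha_k-\alpha_1\bigr),$$ $K:\Delta\to\Delta$ by $K(\boldsymbol\alpha)=K_{J(\boldsymbol\alpha)}(\boldsymbol\alpha)$, and the itinerary map $\Phi:\Delta\to\mathbb{N}^{\mathbb{N}}$ by $\Phi(\boldsymbol\alpha)_r=J(K^r(\boldsymbol\alpha))$. A $d$-dimensional simplex is the convex hull of $d+1$ affinely independent points (a $0$-dimensional simplex is a point). *)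

theory Defs
  imports "HOL-Analysis.Analysis" "HOL-Library.Fun_Lexorder"
begin

text \<open>
  The alphabet \<open>{1 < 2 < \<dots> < k}\<close> is a finite linearly ordered type \<open>'k\<close> with \<open>CARD('k) = k\<close>;
  its elements also index the coordinates of \<open>real ^ 'k\<close>. Such a type is order isomorphic to
  \<open>{1, \<dots>, k}\<close> in exactly one way, and there is one of every positive finite cardinality
  (the numeral types).
\<close>

definition first_letter :: "'k::{finite,linorder}"
  where "first_letter = Min UNIV"

definition last_letter :: "'k::{finite,linorder}"
  where "last_letter = Max UNIV"

text \<open>The letter \<open>i + 1\<close>; only meaningful for \<open>i \<noteq> last_letter\<close>.\<close>

definition next_letter :: "'k::{finite,linorder} \<Rightarrow> 'k"
  where "next_letter i = Min {j. i < j}"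

text \<open>Lexicographic order on sequences; the \<open>\<le>\<close> of the function type is the pointwise order.\<close>

definition lex_le :: "(nat \<Rightarrow> 'k::linorder) \<Rightarrow> (nat \<Rightarrow> 'k) \<Rightarrow> bool"
  where "lex_le v w \<longleftrightarrow> less_fun v w \<or> v = w"

definition lex_inf :: "(nat \<Rightarrow> 'k::linorder) set \<Rightarrow> (nat \<Rightarrow> 'k)"
  where "lex_inf S = (THE u. (\<forall>w\<in>S. lex_le u w) \<and> (\<forall>v. (\<forall>w\<in>S. lex_le v w) \<longrightarrow> lex_le v u))"

definition shift :: "(nat \<Rightarrow> 'k) \<Rightarrow> (nat \<Rightarrow> 'k)"
  where "shift w = (\<lambda>r. w (Suc r))"

definition maximal_seqs :: "(nat \<Rightarrow> 'k::linorder) set"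
  where "maximal_seqs = {w. \<forall>r. lex_le ((shift ^^ r) w) w}"

definition \<Delta> :: "(real ^ 'k::{finite,linorder}) set"
  where "\<Delta> = {\<alpha>. (\<forall>i. \<alpha> $ i \<ge> 0) \<and> \<alpha> $ last_letter > 0 \<and> (\<Sum>i\<in>UNIV. \<alpha> $ i) = 1}"

definition digit_freq :: "'k::finite list \<Rightarrow> real ^ 'k"
  where "digit_freq W = (\<chi> i. real (count_list W i) / real (length W))"

definition freq_seqs :: "real ^ 'k::finite \<Rightarrow> (nat \<Rightarrow> 'k) set"
  where "freq_seqs \<alpha> = {w. (\<lambda>r. digit_freq (map w [0..<r])) \<longlonglongrightarrow> \<alpha>}"

definition maximal_freq_seqs :: "real ^ 'k::{finite,linorder} \<Rightarrow> (nat \<Rightarrow> 'k) set"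
  where "maximal_freq_seqs \<alpha> = maximal_seqs \<inter> freq_seqs \<alpha>"

definition infimax :: "real ^ 'k::{finite,linorder} \<Rightarrow> (nat \<Rightarrow> 'k)"
  where "infimax \<alpha> = lex_inf (maximal_freq_seqs \<alpha>)"

definition J :: "real ^ 'k::{finite,linorder} \<Rightarrow> nat"
  where "J \<alpha> = nat \<lfloor>\<alpha> $ first_letter / \<alpha> $ last_letter\<rfloor>"

text \<open>
  For \<open>k = 2\<close> the first letter is already the penultimate one, so the block
  \<open>\<alpha>\<^sub>2, \<dots>, \<alpha>\<^bsub>k-1\<^esub>\<close> of shifted coordinates is empty.
\<close>

definition Kn :: "nat \<Rightarrow> real ^ 'k::{finite,linorder} \<Rightarrow> real ^ 'k::{finite,linorder}"
  where "Kn n \<alpha> = (1 / (1 - \<alpha> $ first_letter)) *\<^sub>R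
    (\<chi> i. if i = last_letter then (real n + 1) * \<alpha> $ last_letter - \<alpha> $ first_letter
          else if next_letter i = last_letter then \<alpha> $ first_letter - real n * \<alpha> $ last_letter
          else \<alpha> $ next_letter i)"

definition K :: "real ^ 'k::{finite,linorder} \<Rightarrow> real ^ 'k::{finite,linorder}"
  where "K \<alpha> = Kn (J \<alpha>) \<alpha>"

definition \<Phi> :: "real ^ 'k::{finite,linorder} \<Rightarrow> (nat \<Rightarrow> nat)"
  where "\<Phi> \<alpha> = (\<lambda>r. J ((K ^^ r) \<alpha>))"

text \<open>The set \<open>\<Phi>\<^sup>-\<^sup>1(\<Phi>(\<alpha>))\<close>, where \<open>\<Phi>\<close> is regarded as a map with domain \<open>\<Delta>\<close>.\<close>

definition \<Phi>_fibre :: "real ^ 'k::{finite,linorder} \<Rightarrow> (real ^ 'k::{finite,linorder}) set"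
  where "\<Phi>_fibre \<alpha> = {\<beta> \<in> \<Delta>. \<Phi> \<beta> = \<Phi> \<alpha>}"

end

theory Submission
  imports Defs
begin

text \<open>
  Let \<open>unKn n\<close> be \<open>Kn n\<close> without the normalising factor. It is linear and integral, and its inverse is the
  nonnegative matrix of letter counts of the substitution \<open>subst_letter n\<close> that maps \<open>k\<close> to \<open>k 1\<^sup>n\<close>,
  \<open>k - 1\<close> to \<open>k 1\<^bsup>n+1\<^esup>\<close> and every other \<open>i\<close> to \<open>i + 1\<close>. So the fibre of \<open>\<alpha>\<close> is the intersection of a
  decreasing sequence of simplices, cut out by nested simplicial cones.

  (a) If the extreme points of the intersection were affinely dependent, some convex combination of
  some of them would equal one of others. The Riesz decomposition property of the simplicial cones
  passes to the limit by compactness and gives a common lower bound, in the limit cone, of two distinct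
  extreme rays, which must be 0. The dimension is not \<open>k - 1\<close> since the first coordinates of the iterates
  tend to 0 on the fibre, whereas integral linear forms tending to 0 everywhere vanish eventually.

  (b) Iterated substitutions of \<open>k\<^sup>N\<close> are prefixes of \<open>\<I>(\<alpha>)\<close>. The upper bound needs that the
  substitutions preserve maximality and that maximal sequences of every frequency exist. For the lower bound,
  a sequence of frequency \<open>\<alpha>\<close> is compared with one in the image of the substitution by moving superfluous
  ones to the left, last-in-first-out, into blocks that can take them: this does not change the
  frequency and only decreases those shifts that matter. Finally the iterated substitutions of letters
  have frequencies at the vertices of the nested simplices, so \<open>\<I>(\<alpha>)\<close> has a frequency if and only
  if these shrink to a point.
\<close>

section \<open>Letters, the substitution and the unnormalised map\<close>

text \<open>Three obstacles shape the argument. The set \<open>\<Delta>\<close> demands a positive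
  last coordinate, an open condition, while the limit arguments need compact cells; the cells
  therefore use closed conditions only, and positivity turns out to be automatic for nonzero points
  that satisfy all of them. Removing one level of the substitution from a maximal sequence need not
  leave a maximal one. So the lower bound is proved for every sequence of the given frequency and
  claims only that some shift of it is large; this form survives iteration, and maximality is used
  once, at the very end. Powers of k are needed because a digit 0 does not lengthen the image of k.
  If the digits are eventually 0, the iterates of \<alpha> reach the vertex of frequency 1 for k,
  where arbitrarily long runs of k must occur; otherwise the power 1 suffices. Frequencies are
  handled through weights orthogonal to \<alpha>, whose partial sums must be of order o(m); a
  substitution acts on such weights by transposition.\<close>

definition prev_letter :: "'k::{finite,linorder} \<Rightarrow> 'k"
  where "prev_letter i = Max {j. j < i}"

lemma first_letter_le [simp]: "first_letter \<le> i"
  unfolding first_letter_def by simp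

lemma le_last_letter [simp]: "i \<le> last_letter"
  unfolding last_letter_def by simp

lemma not_less_first_letter [simp]: "\<not> i < first_letter"
  by (simp add: not_less)

lemma not_last_letter_less [simp]: "\<not> last_letter < i"
  by (simp add: not_less)

lemma first_letter_less: "i \<noteq> first_letter \<Longrightarrow> first_letter < i"
  using first_letter_le[of i] by order

lemma less_last_letter: "i \<noteq> last_letter \<Longrightarrow> i < last_letter"
  using le_last_letter[of i] by order

lemma next_letter_gt: "i \<noteq> last_letter \<Longrightarrow> i < next_letter i"
proof -
  assume "i \<noteq> last_letter"
  then have "last_letter \<in> {j. i < j}" using less_last_letter by auto
  then have "Min {j. i < j} \<in> {j. i < j}" by (intro Min_in) auto
  then show ?thesis unfolding next_letter_def by simp
qed

lemma next_letter_le: "i < j \<Longrightarrow> next_letter i \<le> j"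
  unfolding next_letter_def by (intro Min_le) auto

lemma prev_letter_less: "i \<noteq> first_letter \<Longrightarrow> prev_letter i < i"
proof -
  assume "i \<noteq> first_letter"
  then have "first_letter \<in> {j. j < i}" using first_letter_less by auto
  then have "Max {j. j < i} \<in> {j. j < i}" by (intro Max_in) auto
  then show ?thesis unfolding prev_letter_def by simp
qed

lemma le_prev_letter: "j < i \<Longrightarrow> j \<le> prev_letter i"
  unfolding prev_letter_def by (intro Max_ge) auto

lemma next_prev_letter: "i \<noteq> first_letter \<Longrightarrow> next_letter (prev_letter i) = i"
proof (rule antisym)
  assume i: "i \<noteq> first_letter"
  show "next_letter (prev_letter i) \<le> i" by (rule next_letter_le[OF prev_letter_less[OF i]])
  have "prev_letter i \<noteq> last_letter" using prev_letter_less[OF i] le_last_letter[of i] by auto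
  then have "prev_letter i < next_letter (prev_letter i)" by (rule next_letter_gt)
  then show "i \<le> next_letter (prev_letter i)"
    using le_prev_letter[of "next_letter (prev_letter i)" i] by (meson leD leI)
qed

lemma prev_next_letter: "i \<noteq> last_letter \<Longrightarrow> prev_letter (next_letter i) = i"
proof (rule antisym)
  assume i: "i \<noteq> last_letter"
  show "i \<le> prev_letter (next_letter i)" by (rule le_prev_letter[OF next_letter_gt[OF i]])
  have "next_letter i \<noteq> first_letter" using next_letter_gt[OF i] first_letter_le[of i] by auto
  then have "prev_letter (next_letter i) < next_letter i" by (rule prev_letter_less)
  then show "prev_letter (next_letter i) \<le> i"
    using next_letter_le[of i "prev_letter (next_letter i)"] by (meson leD leI)
qed

lemma next_letter_neq_first: "i \<noteq> last_letter \<Longrightarrow> next_letter i \<noteq> first_letter"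
  using next_letter_gt[of i] first_letter_le[of i] by auto

lemma prev_letter_neq_last: "i \<noteq> first_letter \<Longrightarrow> prev_letter i \<noteq> last_letter"
  using prev_letter_less[of i] le_last_letter[of i] by auto

lemma next_letter_eq_last:
  assumes "i \<noteq> last_letter"
  shows "next_letter i = last_letter \<longleftrightarrow> i = prev_letter last_letter"
proof
  assume "next_letter i = last_letter"
  then show "i = prev_letter last_letter" using prev_next_letter[OF assms] by simp
next
  assume i: "i = prev_letter last_letter"
  have "last_letter \<noteq> (first_letter :: 'a)"
    using next_letter_neq_first[OF assms] le_last_letter[of "next_letter i"] first_letter_less
      next_letter_gt[OF assms] by (metis not_last_letter_less)
  then show "next_letter i = last_letter" using i next_prev_letter by blast
qed

lemma first_neq_last:
  assumes "2 \<le> CARD('k::{finite,linorder})"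
  shows "first_letter \<noteq> (last_letter :: 'k)"
proof
  assume eq: "first_letter = (last_letter :: 'k)"
  have "i = last_letter" for i :: 'k
    using first_letter_le[of i] le_last_letter[of i] eq by auto
  then have "(UNIV :: 'k set) = {last_letter}" by auto
  then have "CARD('k) = 1" by (metis card_1_singleton_iff One_nat_def)
  then show False using assms by simp
qed

lemma letter_induct [case_names first_letter next_letter]:
  fixes i :: "'k::{finite,linorder}"
  assumes "P first_letter" and "\<And>i. i \<noteq> last_letter \<Longrightarrow> P i \<Longrightarrow> P (next_letter i)"
  shows "P i"
proof (induction "card {j. j < i}" arbitrary: i rule: less_induct)
  case less
  show ?case
  proof (cases "i = first_letter")
    case False
    then have "{j. j < prev_letter i} \<subset> {j. j < i}" using prev_letter_less[OF False] by auto
    then have "P (prev_letter i)" using less by (simp add: psubset_card_mono)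
    then show ?thesis using assms(2)[of "prev_letter i"] False next_prev_letter prev_letter_neq_last by metis
  qed (use assms in auto)
qed

text \<open>Reindexes the coordinates that \<open>Kn\<close> merely moves down. For k = 2 both index
  sets are empty, so this case needs no separate treatment.\<close>

lemma sum_next_letter:
  fixes g :: "'k::{finite,linorder} \<Rightarrow> real"
  assumes fl: "first_letter \<noteq> (last_letter::'k)"
  shows "(\<Sum>i\<in>UNIV - {last_letter, prev_letter last_letter}. g (next_letter i)) =
    (\<Sum>i\<in>UNIV - {first_letter, last_letter}. g i)"
proof (rule sum.reindex_bij_witness[of _ prev_letter next_letter])
  fix i :: 'k assume "i \<in> UNIV - {last_letter, prev_letter last_letter}"
  then show "next_letter i \<in> UNIV - {first_letter, last_letter}" "prev_letter (next_letter i) = i"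
    using next_letter_neq_first next_letter_eq_last prev_next_letter by auto
next
  fix i :: 'k assume i: "i \<in> UNIV - {first_letter, last_letter}"
  then show "next_letter (prev_letter i) = i" using next_prev_letter by auto
  show "prev_letter i \<in> UNIV - {last_letter, prev_letter last_letter}"
    using i fl next_prev_letter prev_letter_neq_last by (metis DiffE DiffI UNIV_I insert_iff singletonD)
qed auto

lemma sum_split_first_last:
  fixes g :: "'k::{finite,linorder} \<Rightarrow> real"
  assumes fl: "first_letter \<noteq> (last_letter::'k)"
  shows "(\<Sum>i\<in>UNIV. g i) = g first_letter + g last_letter + (\<Sum>i\<in>UNIV - {first_letter, last_letter}. g i)"
  by (subst sum.subset_diff[of "{first_letter, last_letter}"]) (use fl in auto)

lemma sum_split_last_prev:
  fixes g :: "'k::{finite,linorder} \<Rightarrow> real"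
  assumes fl: "first_letter \<noteq> (last_letter::'k)"
  shows "(\<Sum>i\<in>UNIV. g i) = g last_letter + g (prev_letter last_letter) +
    (\<Sum>i\<in>UNIV - {last_letter, prev_letter last_letter}. g i)"
  by (subst sum.subset_diff[of "{last_letter, prev_letter last_letter}"])
     (use fl prev_letter_neq_last[OF fl[symmetric]] in auto)

text \<open>The matrix of letter counts of this substitution is the inverse of \<open>unKn n\<close> below.\<close>

definition subst_letter :: "nat \<Rightarrow> 'k::{finite,linorder} \<Rightarrow> 'k list"
  where "subst_letter n i =
    (if i = last_letter then last_letter # replicate n first_letter
     else if next_letter i = last_letter then last_letter # replicate (Suc n) first_letter
     else [next_letter i])"

definition unKn :: "nat \<Rightarrow> real ^ 'k::{finite,linorder} \<Rightarrow> real ^ 'k::{finite,linorder}"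
  where "unKn n \<alpha> =
    (\<chi> i. if i = last_letter then (real n + 1) * \<alpha> $ last_letter - \<alpha> $ first_letter
          else if next_letter i = last_letter then \<alpha> $ first_letter - real n * \<alpha> $ last_letter
          else \<alpha> $ next_letter i)"

lemma Kn_eq: "Kn n \<alpha> = (1 / (1 - \<alpha> $ first_letter)) *\<^sub>R unKn n \<alpha>"
  unfolding Kn_def unKn_def ..

text \<open>Pairs the letter counts of \<open>W\<close> with the linear form \<open>\<phi>\<close>.
  Testing against all \<open>\<phi>\<close> avoids count matrices and their inverses.\<close>

definition wsum :: "('k \<Rightarrow> real) \<Rightarrow> 'k list \<Rightarrow> real"
  where "wsum \<phi> W = sum_list (map \<phi> W)"

lemma wsum_simps [simp]: "wsum \<phi> [] = 0" "wsum \<phi> (a # W) = \<phi> a + wsum \<phi> W"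
  "wsum \<phi> (V @ W) = wsum \<phi> V + wsum \<phi> W" "wsum \<phi> (replicate n a) = real n * \<phi> a"
  unfolding wsum_def by (simp_all add: sum_list_replicate)

lemma wsum_concat: "wsum \<phi> (concat (map f W)) = wsum (\<lambda>a. wsum \<phi> (f a)) W"
  by (induction W) auto

lemma wsum_one: "wsum (\<lambda>_. 1) W = real (length W)"
  by (induction W) auto

context
  assumes fl: "first_letter \<noteq> (last_letter :: 'k::{finite,linorder})"
begin

lemma unKn_last: "unKn n (\<beta> :: (real, 'k) vec) $ last_letter = (real n + 1) * \<beta> $ last_letter - \<beta> $ first_letter"
  by (simp add: unKn_def)

lemma unKn_prev_last:
  "unKn n (\<beta> :: (real, 'k) vec) $ prev_letter last_letter = \<beta> $ first_letter - real n * \<beta> $ last_letter"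
  using fl by (simp add: unKn_def prev_letter_neq_last next_prev_letter)

lemma unKn_next:
  "i \<noteq> last_letter \<Longrightarrow> next_letter i \<noteq> last_letter \<Longrightarrow> unKn n (\<beta> :: (real, 'k) vec) $ i = \<beta> $ next_letter i"
  by (simp add: unKn_def)

text \<open>The transposed statement that the letter counts of \<open>subst_letter n\<close> invert
  \<open>unKn n\<close>. Only the images of k - 1 and k contain ones, and with x =
  \<open>unKn n \<beta>\<close> the number n x_k + (n + 1) x_(k-1) of ones is the first coordinate
  of \<open>\<beta>\<close>.\<close>

lemma unKn_duality:
  "(\<Sum>i\<in>UNIV. unKn n (\<beta> :: (real, 'k) vec) $ i * wsum \<phi> (subst_letter n i)) = (\<Sum>i\<in>UNIV. \<beta> $ i * \<phi> i)"
proof -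
  have "(\<Sum>i\<in>UNIV - {last_letter, prev_letter last_letter}. unKn n \<beta> $ i * wsum \<phi> (subst_letter n i))
     = (\<Sum>i\<in>UNIV - {last_letter, prev_letter last_letter}. \<beta> $ next_letter i * \<phi> (next_letter i))"
    by (intro sum.cong) (auto simp: next_letter_eq_last subst_letter_def unKn_next)
  also have "\<dots> = (\<Sum>i\<in>UNIV - {first_letter, last_letter}. \<beta> $ i * \<phi> i)"
    using sum_next_letter[OF fl, of "\<lambda>i. \<beta> $ i * \<phi> i"] by simp
  finally show ?thesis
    unfolding sum_split_last_prev[OF fl, of "\<lambda>i. unKn n \<beta> $ i * wsum \<phi> (subst_letter n i)"]
      sum_split_first_last[OF fl, of "\<lambda>i. \<beta> $ i * \<phi> i"] unKn_last unKn_prev_last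
    using fl prev_letter_neq_last[OF fl[symmetric]]
    by (simp add: subst_letter_def next_prev_letter algebra_simps)
qed

lemma linear_unKn: "linear (unKn n :: (real, 'k) vec \<Rightarrow> _)"
  by (rule linearI) (auto simp: unKn_def vec_eq_iff algebra_simps)

lemma sum_unKn: "(\<Sum>i\<in>UNIV. unKn n (\<beta> :: (real, 'k) vec) $ i) = (\<Sum>i\<in>UNIV. \<beta> $ i) - \<beta> $ first_letter"
proof -
  have "(\<Sum>i\<in>UNIV - {last_letter, prev_letter last_letter}. unKn n \<beta> $ i)
     = (\<Sum>i\<in>UNIV - {last_letter, prev_letter last_letter}. \<beta> $ next_letter i)"
    by (intro sum.cong) (auto simp: next_letter_eq_last unKn_next)
  then show ?thesis
    unfolding sum_split_last_prev[OF fl, of "\<lambda>i. unKn n \<beta> $ i"]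
      sum_split_first_last[OF fl, of "\<lambda>i. \<beta> $ i"] unKn_last unKn_prev_last
    using sum_next_letter[OF fl, of "\<lambda>i. \<beta> $ i"] by (simp add: algebra_simps)
qed

text \<open>This and the next two lemmas solve for \<open>\<beta>\<close> with nonnegative
  coefficients, which makes the cones below nested and \<open>unKn n\<close> injective.\<close>

lemma last_eq_unKn:
  "(\<beta> :: (real, 'k) vec) $ last_letter = unKn n \<beta> $ last_letter + unKn n \<beta> $ prev_letter last_letter"
  by (simp add: unKn_last unKn_prev_last algebra_simps)

lemma first_eq_unKn:
  "(\<beta> :: (real, 'k) vec) $ first_letter = real n * \<beta> $ last_letter + unKn n \<beta> $ prev_letter last_letter"
  by (simp add: unKn_prev_last)

lemma middle_eq_unKn:
  "i \<noteq> first_letter \<Longrightarrow> i \<noteq> last_letter \<Longrightarrow> (\<beta> :: (real, 'k) vec) $ i = unKn n \<beta> $ prev_letter i"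
  using unKn_next[of "prev_letter i" n \<beta>] by (simp add: prev_letter_neq_last next_prev_letter)

lemma unKn_nonneg_imp:
  assumes "\<forall>i. 0 \<le> unKn n (\<beta> :: (real, 'k) vec) $ i" shows "\<forall>i. 0 \<le> \<beta> $ i"
proof -
  have l: "0 \<le> \<beta> $ last_letter" using assms last_eq_unKn[of \<beta> n] by simp
  then have f: "0 \<le> \<beta> $ first_letter" using assms first_eq_unKn[of \<beta> n] by simp
  show ?thesis using l f middle_eq_unKn[of _ \<beta> n] assms by metis
qed

lemma inj_unKn: "inj (unKn n :: (real, 'k) vec \<Rightarrow> _)"
proof (subst linear_injective_0[OF linear_unKn], intro allI impI)
  fix \<beta> :: "(real, 'k) vec" assume *: "unKn n \<beta> = 0"
  have l: "\<beta> $ last_letter = 0" using * last_eq_unKn[of \<beta> n] by simp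
  then have f: "\<beta> $ first_letter = 0" using * first_eq_unKn[of \<beta> n] by simp
  show "\<beta> = 0" using l f middle_eq_unKn[of _ \<beta> n] * by (metis vec_eq_iff zero_index)
qed

end

section \<open>Nested cells and their intersection\<close>

primrec unK :: "(nat \<Rightarrow> nat) \<Rightarrow> nat \<Rightarrow> real ^ 'k::{finite,linorder} \<Rightarrow> real ^ 'k::{finite,linorder}"
  where "unK n 0 \<beta> = \<beta>" | "unK n (Suc r) \<beta> = unKn (n r) (unK n r \<beta>)"

lemma unK_Suc2: "unK n (Suc r) \<beta> = unK (\<lambda>j. n (Suc j)) r (unKn (n 0) \<beta>)"
  by (induction r) auto

primrec subst_iter :: "(nat \<Rightarrow> nat) \<Rightarrow> nat \<Rightarrow> 'k::{finite,linorder} \<Rightarrow> 'k list"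
  where "subst_iter n 0 i = [i]"
  | "subst_iter n (Suc r) i = concat (map (subst_iter n r) (subst_letter (n r) i))"

text \<open>As \<open>unK n r\<close> is bijective, this is the simplicial cone spanned by the
  letter counts of the words \<open>subst_iter n r i\<close>.\<close>

definition cone_upto :: "(nat \<Rightarrow> nat) \<Rightarrow> nat \<Rightarrow> (real ^ 'k::{finite,linorder}) set"
  where "cone_upto n r = {\<beta>. \<forall>i. 0 \<le> unK n r \<beta> $ i}"

definition itin_cone :: "(nat \<Rightarrow> nat) \<Rightarrow> (real ^ 'k::{finite,linorder}) set"
  where "itin_cone n = (\<Inter>r. cone_upto n r)"

text \<open>Closed conditions only, for compactness; \<open>itin_cone_last_pos\<close> recovers the
  positive last coordinate.\<close>

definition itin_cell :: "(nat \<Rightarrow> nat) \<Rightarrow> (real ^ 'k::{finite,linorder}) set"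
  where "itin_cell n = {\<beta> \<in> itin_cone n. (\<Sum>i\<in>UNIV. \<beta> $ i) = 1}"

context
  assumes fl: "first_letter \<noteq> (last_letter :: 'k::{finite,linorder})"
begin

lemma linear_unK: "linear (unK n r :: (real, 'k) vec \<Rightarrow> _)"
proof (induction r)
  case (Suc r)
  then show ?case using linear_compose[OF Suc linear_unKn[OF fl, of "n r"]] by (simp add: o_def)
qed (simp add: linear_iff)

lemma inj_unK: "inj (unK n r :: (real, 'k) vec \<Rightarrow> _)"
proof (induction r)
  case (Suc r)
  then show ?case using inj_compose[OF inj_unKn[OF fl, of "n r"] Suc] by (simp add: comp_def)
qed (simp add: inj_def)

lemma surj_unK: "surj (unK n r :: (real, 'k) vec \<Rightarrow> _)"
  using linear_injective_imp_surjective[OF linear_unK inj_unK] by blast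

lemma continuous_on_unK: "continuous_on S (unK n r :: (real, 'k) vec \<Rightarrow> _)"
  by (rule linear_continuous_on) (simp add: linear_unK linear_conv_bounded_linear[symmetric])

lemma unK_duality:
  "(\<Sum>i\<in>UNIV. unK n r (\<beta> :: (real, 'k) vec) $ i * wsum \<phi> (subst_iter n r i)) = (\<Sum>i\<in>UNIV. \<beta> $ i * \<phi> i)"
  by (induction r) (simp_all add: wsum_concat unKn_duality[OF fl])

lemma sum_unK_Suc:
  "(\<Sum>i\<in>UNIV. unK n (Suc r) (\<beta> :: (real, 'k) vec) $ i) = (\<Sum>i\<in>UNIV. unK n r \<beta> $ i) - unK n r \<beta> $ first_letter"
  by (simp add: sum_unKn[OF fl])

lemma cone_upto_antimono: "r \<le> s \<Longrightarrow> (cone_upto n s :: (real, 'k) vec set) \<subseteq> cone_upto n r"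
  by (rule lift_Suc_antimono_le[of "\<lambda>r. cone_upto n r"])
     (use unKn_nonneg_imp[OF fl] in \<open>auto simp: cone_upto_def\<close>)

lemma cone_upto_nonneg: "(\<beta> :: (real, 'k) vec) \<in> cone_upto n r \<Longrightarrow> 0 \<le> \<beta> $ i"
  using cone_upto_antimono[of 0 r n] by (auto simp: cone_upto_def)

lemma itin_cone_nonneg: "(\<beta> :: (real, 'k) vec) \<in> itin_cone n \<Longrightarrow> 0 \<le> unK n r \<beta> $ i"
  by (auto simp: itin_cone_def cone_upto_def)

lemma unKn_itin_cone:
  "(\<beta> :: (real, 'k) vec) \<in> itin_cone n \<Longrightarrow> unKn (n 0) \<beta> \<in> itin_cone (\<lambda>j. n (Suc j))"
  using itin_cone_nonneg[of \<beta> n "Suc _"] by (auto simp: itin_cone_def cone_upto_def unK_Suc2 simp del: unK.simps)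

lemma closed_cone_upto: "closed (cone_upto n r :: (real, 'k) vec set)"
  unfolding cone_upto_def by (intro closed_Collect_all closed_Collect_le continuous_intros continuous_on_unK)

lemma convex_cone_upto: "convex (cone_upto n r :: (real, 'k) vec set)"
  unfolding convex_def cone_upto_def
  by (auto simp: linear_add[OF linear_unK] linear_scale[OF linear_unK])

lemma cone_upto_cone: 
  assumes "(\<beta> :: (real, 'k) vec) \<in> cone_upto n r" "0 \<le> c" shows "c *\<^sub>R \<beta> \<in> cone_upto n r"
  using assms by (auto simp: cone_upto_def linear_scale[OF linear_unK])

lemma itin_cone_scaleR: 
  assumes "(\<beta> :: (real, 'k) vec) \<in> itin_cone n" "0 \<le> c" shows "c *\<^sub>R \<beta> \<in> itin_cone n"
  using assms cone_upto_cone unfolding itin_cone_def by blast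

lemma bounded_nonneg_sum_le:
  "bounded {\<beta> :: (real, 'k) vec. (\<forall>i. 0 \<le> \<beta> $ i) \<and> (\<Sum>i\<in>UNIV. \<beta> $ i) \<le> c}"
proof (rule boundedI)
  fix \<beta> :: "(real, 'k) vec" assume *: "\<beta> \<in> {\<beta>. (\<forall>i. 0 \<le> \<beta> $ i) \<and> (\<Sum>i\<in>UNIV. \<beta> $ i) \<le> c}"
  have "norm \<beta> \<le> (\<Sum>i\<in>UNIV. \<bar>\<beta> $ i\<bar>)" by (rule norm_le_l1_cart)
  then show "norm \<beta> \<le> c" using * by simp
qed

lemma compact_cone_upto:
  "compact (cone_upto n r \<inter> {\<beta> :: (real, 'k) vec. (\<Sum>i\<in>UNIV. \<beta> $ i) \<le> c})"
  unfolding compact_eq_bounded_closed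
proof
  show "bounded (cone_upto n r \<inter> {\<beta> :: (real, 'k) vec. (\<Sum>i\<in>UNIV. \<beta> $ i) \<le> c})"
    by (rule bounded_subset[OF bounded_nonneg_sum_le[of c]]) (auto simp: cone_upto_nonneg)
  show "closed (cone_upto n r \<inter> {\<beta> :: (real, 'k) vec. (\<Sum>i\<in>UNIV. \<beta> $ i) \<le> c})"
    by (intro closed_Int closed_cone_upto closed_Collect_le continuous_intros)
qed

lemma compact_itin_cell: "compact (itin_cell n :: (real, 'k) vec set)"
proof -
  have "itin_cell n = (cone_upto n 0 \<inter> {\<beta> :: (real, 'k) vec. (\<Sum>i\<in>UNIV. \<beta> $ i) \<le> 1}) \<inter>
    ((\<Inter>r. cone_upto n r) \<inter> {\<beta>. (\<Sum>i\<in>UNIV. \<beta> $ i) = 1})"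
    by (auto simp: itin_cell_def itin_cone_def)
  also have "compact \<dots>"
    by (intro compact_Int_closed compact_cone_upto closed_Int closed_INT ballI closed_cone_upto
        closed_Collect_eq continuous_intros)
  finally show ?thesis .
qed

lemma convex_itin_cell: "convex (itin_cell n :: (real, 'k) vec set)"
proof -
  have "convex {\<beta> :: (real, 'k) vec. (\<Sum>i\<in>UNIV. \<beta> $ i) = 1}"
    by (auto simp: convex_def sum.distrib simp flip: sum_distrib_left)
  moreover have "convex (itin_cone n :: (real, 'k) vec set)"
    unfolding itin_cone_def by (intro convex_INT convex_cone_upto)
  ultimately show ?thesis
    unfolding itin_cell_def Collect_conj_eq Collect_mem_eq by (rule convex_Int[rotated])
qed

text \<open>Riesz decomposition in the simplicial cones \<^term>\<open>cone_upto n r\<close> passes to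
  the limit by compactness.\<close>

lemma below_two_points:
  fixes v w :: "(real, 'k) vec"
  assumes v: "v extreme_point_of itin_cell n" and w: "w extreme_point_of itin_cell n" and "v \<noteq> w"
    and c: "c \<in> itin_cone n" "a *\<^sub>R v - c \<in> itin_cone n" "b *\<^sub>R w - c \<in> itin_cone n"
  shows "c = 0"
proof -
  let ?s = "\<lambda>\<beta> :: (real, 'k) vec. \<Sum>i\<in>UNIV. \<beta> $ i"
  have zero: "\<beta> = 0" if "\<beta> \<in> itin_cone n" "?s \<beta> = 0" for \<beta>
    using that itin_cone_nonneg[OF that(1), of 0] by (simp add: sum_nonneg_eq_0_iff vec_eq_iff)
  \<comment> \<open>An extreme point spans an extreme ray: whatever lies between 0 and
    \<open>a *\<^sub>R v\<close> is a multiple of \<open>v\<close>. Applied to both points this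
    gives \<open>?s c *\<^sub>R v = ?s c *\<^sub>R w\<close>, so the mass \<open>?s c\<close> is
    0.\<close>
  have ray: "c = ?s c *\<^sub>R v" if v: "v extreme_point_of itin_cell n" and d: "a *\<^sub>R v - c \<in> itin_cone n" for v a
  proof -
    have sv: "?s v = 1" using v by (auto simp: extreme_point_of_def itin_cell_def)
    define d where "d = a *\<^sub>R v - c"
    have dc: "d \<in> itin_cone n" using d d_def by simp
    have s: "?s c \<ge> 0" "?s d \<ge> 0"
      using itin_cone_nonneg[OF c(1), of 0] itin_cone_nonneg[OF dc, of 0] by (auto intro: sum_nonneg)
    have a: "a = ?s c + ?s d" using sv by (simp add: d_def sum_subtractf flip: sum_distrib_left)
    consider "?s c = 0" | "?s d = 0" | "?s c > 0" "?s d > 0" using s by linarith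
    then show ?thesis
    proof cases
      case 1 then show ?thesis using zero[OF c(1)] by simp
    next
      case 2
      then have "c = a *\<^sub>R v" using zero[OF dc] by (simp add: d_def)
      moreover have "a = ?s c" using a 2 by simp
      ultimately show ?thesis by metis
    next
      case 3
      \<comment> \<open>Here \<open>v\<close> is a proper convex combination of the normalised parts
        \<open>?x\<close> and \<open>?y\<close>, so extremality makes them equal.\<close>
      let ?x = "(1 / ?s c) *\<^sub>R c" and ?y = "(1 / ?s d) *\<^sub>R d"
      have x: "?x \<in> itin_cell n" using 3 c(1)
        by (auto simp: itin_cell_def itin_cone_scaleR simp flip: sum_divide_distrib)
      have y: "?y \<in> itin_cell n" using 3 dc
        by (auto simp: itin_cell_def itin_cone_scaleR simp flip: sum_divide_distrib)
      have "v \<notin> open_segment ?x ?y" using v x y by (auto simp: extreme_point_of_def)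
      moreover have "v = (1 - ?s d / a) *\<^sub>R ?x + (?s d / a) *\<^sub>R ?y"
      proof -
        have "1 - ?s d / a = ?s c / a" using 3 a by (simp add: diff_divide_eq_iff)
        then have "(1 - ?s d / a) *\<^sub>R ?x + (?s d / a) *\<^sub>R ?y =
            (?s c / a * (1 / ?s c)) *\<^sub>R c + (?s d / a * (1 / ?s d)) *\<^sub>R d" by simp
        also have "?s c / a * (1 / ?s c) = 1 / a" using 3 by simp
        also have "?s d / a * (1 / ?s d) = 1 / a" using 3 by simp
        also have "(1 / a) *\<^sub>R c + (1 / a) *\<^sub>R d = (1 / a) *\<^sub>R (a *\<^sub>R v)"
          by (simp add: d_def flip: scaleR_add_right)
        also have "\<dots> = v" using 3 a by simp
        finally show ?thesis by simp
      qed
      moreover have "0 < ?s d / a" "?s d / a < 1" using 3 a by simp_all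
      ultimately have "?x = ?y" unfolding in_segment by blast
      then have "v = ?x" using \<open>v = (1 - ?s d / a) *\<^sub>R ?x + (?s d / a) *\<^sub>R ?y\<close>
        by (metis scaleR_collapse)
      then show ?thesis using 3 by simp
    qed
  qed
  have "?s c *\<^sub>R (v - w) = 0" using ray[OF v c(2)] ray[OF w c(3)] by (metis scaleR_diff_right right_minus_eq)
  then have "?s c = 0" using \<open>v \<noteq> w\<close> by simp
  then show "c = 0" using zero c(1) by simp
qed

text \<open>Common lower bounds of mass at least \<open>\<epsilon>\<close> form decreasing compact
  sets \<open>F r\<close>. If none of these were empty, a common point would contradict
  \<open>below_two_points\<close>.\<close>

lemma below_two_points_eventually:
  fixes v w :: "(real, 'k) vec"
  assumes v: "v extreme_point_of itin_cell n" and w: "w extreme_point_of itin_cell n" and "v \<noteq> w"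
    and \<epsilon>: "\<epsilon> > 0"
  shows "\<exists>R. \<forall>r\<ge>R. \<forall>c. c \<in> cone_upto n r \<longrightarrow> a *\<^sub>R v - c \<in> cone_upto n r \<longrightarrow> b *\<^sub>R w - c \<in> cone_upto n r \<longrightarrow>
     (\<Sum>i\<in>UNIV. c $ i) < \<epsilon>"
proof (rule ccontr)
  define F where "F r = {c. c \<in> cone_upto n r \<and> a *\<^sub>R v - c \<in> cone_upto n r \<and> b *\<^sub>R w - c \<in> cone_upto n r
      \<and> \<epsilon> \<le> (\<Sum>i\<in>UNIV. c $ i)}" for r
  have mono: "F s \<subseteq> F r" if "r \<le> s" for r s
    using cone_upto_antimono[OF that, of n] by (auto simp: F_def)
  assume "\<not> ?thesis"
  then have "\<exists>s\<ge>r. F s \<noteq> {}" for r by (fastforce simp: F_def not_less)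
  then have ne: "F r \<noteq> {}" for r using mono by blast
  have "compact (F r)" for r
  proof -
    have "F r = (cone_upto n r \<inter> {c. (\<Sum>i\<in>UNIV. c $ i) \<le> (\<Sum>i\<in>UNIV. (a *\<^sub>R v) $ i)}) \<inter>
      ((\<lambda>c. a *\<^sub>R v - c) -` cone_upto n r \<inter> ((\<lambda>c. b *\<^sub>R w - c) -` cone_upto n r \<inter>
      {c. \<epsilon> \<le> (\<Sum>i\<in>UNIV. c $ i)}))" (is "_ = ?G")
    proof -
      have "(\<Sum>i\<in>UNIV. c $ i) \<le> (\<Sum>i\<in>UNIV. (a *\<^sub>R v) $ i)" if "a *\<^sub>R v - c \<in> cone_upto n r" for c
        using cone_upto_nonneg[OF that] by (intro sum_mono) simp
      then show ?thesis by (auto simp: F_def)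
    qed
    moreover have "compact ?G"
      by (intro compact_Int_closed compact_cone_upto closed_Int closed_vimage closed_cone_upto
          closed_Collect_le continuous_intros)
    ultimately show ?thesis by simp
  qed
  then have "\<Inter>(range F) \<noteq> {}" using ne mono by (intro compact_nest) auto
  then obtain c where c: "\<And>r. c \<in> F r" by auto
  then have "c = 0"
    using below_two_points[OF v w \<open>v \<noteq> w\<close>, of c a b] by (auto simp: F_def itin_cone_def)
  then show False using c[of 0] \<epsilon> by (simp add: F_def)
qed

text \<open>An affine relation equates a positive combination over \<open>P\<close> with one over
  \<open>N\<close>. In the coordinates \<open>unK n r\<close> the cone is the orthant, where one
  term of \<open>P\<close> can be distributed over \<open>N\<close> proportionally: the part for
  \<open>w\<close> takes the share \<open>b w / t\<close> of \<open>a v\<close> in each coordinate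
  and lies below both \<open>a v\<close> and \<open>b w\<close>. For large \<open>r\<close> all
  parts have tiny mass, yet they add up to the mass \<open>u v\<close>.\<close>

lemma affine_independent_extreme_points:
  "\<not> affine_dependent {v :: (real, 'k) vec. v extreme_point_of itin_cell n}"
proof
  assume "affine_dependent {v :: (real, 'k) vec. v extreme_point_of itin_cell n}"
  then obtain S u where S: "finite S" "S \<subseteq> {v :: (real, 'k) vec. v extreme_point_of itin_cell n}"
    and u: "sum u S = 0" "\<exists>v\<in>S. u v \<noteq> 0" "(\<Sum>v\<in>S. u v *\<^sub>R v) = 0"
    unfolding affine_dependent_explicit by blast
  define P where "P = {v\<in>S. 0 < u v}"
  define N where "N = {v\<in>S. u v < 0}"
  have fin: "finite P" "finite N" using S(1) by (simp_all add: P_def N_def)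
  have split: "(\<Sum>v\<in>S. f v) = (\<Sum>v\<in>P. f v) + (\<Sum>v\<in>N. f v)"
    if "\<And>v. u v = 0 \<Longrightarrow> f v = 0" for f :: "_ \<Rightarrow> 'b::ab_group_add"
  proof -
    have "(\<Sum>v\<in>S. f v) = (\<Sum>v\<in>P \<union> N. f v)"
      using S that by (intro sum.mono_neutral_right) (auto simp: P_def N_def not_less order.antisym)
    also have "\<dots> = (\<Sum>v\<in>P. f v) + (\<Sum>v\<in>N. f v)"
      using fin by (rule sum.union_disjoint) (auto simp: P_def N_def)
    finally show ?thesis .
  qed
  have "P \<noteq> {}"
  proof
    assume "P = {}"
    then have "sum (\<lambda>v. - u v) S = 0" "\<And>v. v \<in> S \<Longrightarrow> 0 \<le> - u v"
      using u(1) by (auto simp: P_def sum_negf not_less)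
    then show False using u(2) S(1) by (simp add: sum_nonneg_eq_0_iff)
  qed
  then obtain v where v: "v \<in> P" by auto
  then have uv: "u v > 0" and ve: "v extreme_point_of itin_cell n" using S by (auto simp: P_def)
  have cell: "x \<in> itin_cell n" if "x \<in> S" for x using that S(2) by (auto simp: extreme_point_of_def)
  \<comment> \<open>Chosen so that \<open>card N\<close> parts of mass below
    \<open>\<epsilon>\<close> cannot add up to \<open>u v\<close>; the summand 1 makes this
    strict.\<close>
  define \<epsilon> where "\<epsilon> = u v / (real (card N) + 1)"
  have \<epsilon>: "\<epsilon> > 0" using uv by (simp add: \<epsilon>_def)
  have "\<exists>R. \<forall>r\<ge>R. \<forall>c. c \<in> cone_upto n r \<longrightarrow> u v *\<^sub>R v - c \<in> cone_upto n r \<longrightarrow>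
     (- u w) *\<^sub>R w - c \<in> cone_upto n r \<longrightarrow> (\<Sum>i\<in>UNIV. c $ i) < \<epsilon>" if "w \<in> N" for w
    using that v S by (intro below_two_points_eventually[OF ve _ _ \<epsilon>]) (auto simp: P_def N_def)
  then obtain R where R: "\<And>w r c. w \<in> N \<Longrightarrow> R w \<le> r \<Longrightarrow> c \<in> cone_upto n r \<Longrightarrow>
      u v *\<^sub>R v - c \<in> cone_upto n r \<Longrightarrow> (- u w) *\<^sub>R w - c \<in> cone_upto n r \<Longrightarrow> (\<Sum>i\<in>UNIV. c $ i) < \<epsilon>"
    by metis
  define r where "r = (\<Sum>w\<in>N. R w)"
  have Rr: "R w \<le> r" if "w \<in> N" for w unfolding r_def by (rule member_le_sum) (use that fin in auto)
  define a where "a x = u x *\<^sub>R unK n r x" for x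
  define b where "b x = (- u x) *\<^sub>R unK n r x" for x
  have a0: "0 \<le> a x $ i" if "x \<in> P" for x i
    using that cell[of x] itin_cone_nonneg[of x n r i] by (auto simp: a_def P_def itin_cell_def)
  have b0: "0 \<le> b x $ i" if "x \<in> N" for x i
    using that cell[of x] itin_cone_nonneg[of x n r i]
    by (auto simp: b_def N_def itin_cell_def mult_nonpos_nonneg)
  define t where "t = (\<Sum>x\<in>P. a x)"
  have t: "t = (\<Sum>x\<in>N. b x)"
  proof -
    have "(\<Sum>x\<in>S. u x *\<^sub>R unK n r x) = unK n r (\<Sum>x\<in>S. u x *\<^sub>R x)"
      by (simp add: linear_sum[OF linear_unK] linear_scale[OF linear_unK])
    also have "\<dots> = 0" by (simp add: u linear_0[OF linear_unK])
    finally show ?thesis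
      using split[of "\<lambda>x. u x *\<^sub>R unK n r x"] by (simp add: t_def a_def b_def sum_negf eq_neg_iff_add_eq_0)
  qed
  have at: "a v $ i \<le> t $ i" for i
    unfolding t_def sum_component by (rule member_le_sum) (use v fin a0 in auto)
  have bt: "b w $ i \<le> t $ i" if "w \<in> N" for w i
    unfolding t sum_component by (rule member_le_sum) (use that fin b0 in auto)
  text \<open>Where \<open>t\<close> vanishes both factors vanish, so the junk value \<open>0 / 0 = 0\<close> is the right one.\<close>
  define e where "e w = (\<chi> i. a v $ i * b w $ i / t $ i)" for w
  have e0: "0 \<le> e w $ i" if "w \<in> N" for w i
    using a0[OF v, of i] b0[OF that, of i] bt[OF that, of i] by (simp add: e_def)
  have ea: "e w $ i \<le> a v $ i" if "w \<in> N" for w i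
    using a0[OF v, of i] b0[OF that, of i] bt[OF that, of i]
    by (cases "t $ i = 0") (auto simp: e_def divide_le_eq mult_left_mono)
  have eb: "e w $ i \<le> b w $ i" if "w \<in> N" for w i
    using a0[OF v, of i] b0[OF that, of i] bt[OF that, of i] at[of i]
    by (cases "t $ i = 0") (auto simp: e_def divide_le_eq mult_right_mono mult.commute)
  have esum: "(\<Sum>w\<in>N. e w) = a v"
  proof (rule vec_eq_iff[THEN iffD2], rule allI)
    fix i
    have "(\<Sum>w\<in>N. e w) $ i = a v $ i * t $ i / t $ i"
      by (simp add: e_def t sum_distrib_left sum_divide_distrib)
    then show "(\<Sum>w\<in>N. e w) $ i = a v $ i" using at[of i] a0[OF v, of i] by (cases "t $ i = 0") auto
  qed
  define c where "c w = inv (unK n r) (e w)" for w :: "(real, 'k) vec"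
  have c: "unK n r (c w) = e w" for w unfolding c_def by (rule surj_f_inv_f[OF surj_unK])
  have lt: "(\<Sum>i\<in>UNIV. c w $ i) < \<epsilon>" if w: "w \<in> N" for w
  proof (rule R[OF w Rr[OF w]])
    show "c w \<in> cone_upto n r" using e0[OF w] by (simp add: cone_upto_def c)
    show "u v *\<^sub>R v - c w \<in> cone_upto n r" using ea[OF w]
      by (simp add: cone_upto_def linear_diff[OF linear_unK] linear_scale[OF linear_unK] c a_def)
    show "(- u w) *\<^sub>R w - c w \<in> cone_upto n r" using eb[OF w]
      by (simp add: cone_upto_def linear_diff[OF linear_unK] linear_scale[OF linear_unK] linear_neg[OF linear_unK] c b_def)
  qed
  have "(\<Sum>w\<in>N. c w) = u v *\<^sub>R v"
  proof -
    have "unK n r (\<Sum>w\<in>N. c w) = unK n r (u v *\<^sub>R v)"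
      by (simp add: linear_sum[OF linear_unK] linear_scale[OF linear_unK] c esum a_def)
    then show ?thesis using inj_unK by (metis injD)
  qed
  then have "u v = (\<Sum>i\<in>UNIV. (\<Sum>w\<in>N. c w) $ i)"
    using cell[of v] v by (simp add: P_def itin_cell_def flip: sum_distrib_left)
  also have "\<dots> = (\<Sum>w\<in>N. \<Sum>i\<in>UNIV. c w $ i)" unfolding sum_component by (rule sum.swap)
  also have "\<dots> \<le> (\<Sum>w\<in>N. \<epsilon>)" using lt by (intro sum_mono) (simp add: less_imp_le)
  also have "\<dots> < (real (card N) + 1) * \<epsilon>" using \<epsilon> by simp
  finally show False by (simp add: \<epsilon>_def add_nonneg_pos split: if_splits)
qed

text \<open>Each step lowers the total mass by exactly the first coordinate, and a decreasing
  nonnegative sequence has differences tending to 0.\<close>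

lemma unK_first_tendsto_0:
  assumes "(\<beta> :: (real, 'k) vec) \<in> itin_cone n"
  shows "(\<lambda>r. unK n r \<beta> $ first_letter) \<longlonglongrightarrow> 0"
proof -
  let ?s = "\<lambda>r. \<Sum>i\<in>UNIV. unK n r \<beta> $ i"
  have "decseq ?s"
    unfolding decseq_Suc_iff sum_unK_Suc using itin_cone_nonneg[OF assms] by simp
  moreover have "0 \<le> ?s r" for r by (intro sum_nonneg itin_cone_nonneg[OF assms])
  ultimately obtain l where l: "?s \<longlonglongrightarrow> l" using decseq_convergent[of ?s 0] by metis
  then have "(\<lambda>r. ?s r - ?s (Suc r)) \<longlonglongrightarrow> l - l" by (intro tendsto_diff LIMSEQ_Suc)
  moreover have "?s r - ?s (Suc r) = unK n r \<beta> $ first_letter" for r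
    unfolding sum_unK_Suc by simp
  ultimately show ?thesis by simp
qed

text \<open>Coordinates other than the last move down by one place per step until they reach the
  first, so they inherit its limit.\<close>

lemma unK_tendsto_0:
  assumes "(\<beta> :: (real, 'k) vec) \<in> itin_cone n" and "i \<noteq> last_letter"
  shows "(\<lambda>r. unK n r \<beta> $ i) \<longlonglongrightarrow> 0"
  using assms(2)
proof (induction i rule: letter_induct)
  case first_letter
  show ?case by (rule unK_first_tendsto_0[OF assms(1)])
next
  case (next_letter i)
  then have "unK n (Suc r) \<beta> $ i = unK n r \<beta> $ next_letter i" for r
    by (simp add: unKn_next[OF fl])
  then show ?case using LIMSEQ_Suc[OF next_letter(2)[OF next_letter(1)]] by simp
qed

text \<open>The coordinates of \<^term>\<open>unK n r\<close> are integral linear forms; one that converges to zero pointwise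
  would vanish eventually, contradicting surjectivity.\<close>

lemma span_itin_cone: "span (itin_cone n :: (real, 'k) vec set) \<noteq> UNIV"
proof
  assume span: "span (itin_cone n :: (real, 'k) vec set) = UNIV"
  have tend: "(\<lambda>r. unK n r \<beta> $ first_letter) \<longlonglongrightarrow> 0" for \<beta> :: "(real, 'k) vec"
  proof -
    have "\<beta> \<in> span (itin_cone n)" using span by simp
    then show ?thesis
    proof (induction rule: span_induct_alt)
      case base
      then show ?case by (simp add: linear_0[OF linear_unK])
    next
      case (step c x y)
      have "(\<lambda>r. c * unK n r x $ first_letter + unK n r y $ first_letter) \<longlonglongrightarrow> c * 0 + 0"
        by (intro tendsto_intros unK_first_tendsto_0 step)
      then show ?case by (simp add: linear_add[OF linear_unK] linear_scale[OF linear_unK])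
    qed
  qed
  have int: "unK n r (axis j 1 :: (real, 'k) vec) $ i \<in> \<int>" for r i j
    by (induction r arbitrary: i) (auto simp: axis_def unKn_def)
  have "\<forall>\<^sub>F r in sequentially. unK n r (axis j 1 :: (real, 'k) vec) $ first_letter = 0" for j
  proof -
    have "\<forall>\<^sub>F r in sequentially. \<bar>unK n r (axis j 1 :: (real, 'k) vec) $ first_letter\<bar> < 1"
      using tendstoD[OF tend[of "axis j 1"], of 1] by simp
    then show ?thesis by eventually_elim (use int Ints_nonzero_abs_less1 in blast)
  qed
  then have "\<forall>\<^sub>F r in sequentially. \<forall>j. unK n r (axis j 1 :: (real, 'k) vec) $ first_letter = 0"
    by (rule eventually_all_finite)
  then obtain r where r: "\<And>j. unK n r (axis j 1 :: (real, 'k) vec) $ first_letter = 0"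
    by (auto simp: eventually_sequentially)
  have "unK n r \<beta> $ first_letter = 0" for \<beta> :: "(real, 'k) vec"
  proof -
    have "\<beta> = (\<Sum>j\<in>UNIV. \<beta> $ j *\<^sub>R axis j 1)" by (simp add: basis_expansion scalar_mult_eq_scaleR[symmetric])
    then have "unK n r \<beta> = (\<Sum>j\<in>UNIV. \<beta> $ j *\<^sub>R unK n r (axis j 1))"
      by (metis (no_types, lifting) linear_sum[OF linear_unK] linear_scale[OF linear_unK] sum.cong)
    then show ?thesis by (simp add: r)
  qed
  moreover obtain \<beta> :: "(real, 'k) vec" where "unK n r \<beta> = axis first_letter 1" using surj_unK by (metis surjD)
  ultimately show False by (metis axis_nth zero_neq_one)
qed

text \<open>The extreme points lie in the hyperplane of mass 1, which misses 0, so their affine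
  independence is linear independence. Their number is then at most the dimension of the cone, which
  is less than k.\<close>

lemma itin_cell_simplex:
  assumes "(itin_cell n :: (real, 'k) vec set) \<noteq> {}"
  shows "\<exists>d::nat. d \<le> CARD('k) - 2 \<and> int d simplex (itin_cell n :: (real, 'k) vec set)"
proof -
  define E where "E = {v :: (real, 'k) vec. v extreme_point_of itin_cell n}"
  have hull: "itin_cell n = convex hull E"
    unfolding E_def by (rule Krein_Milman_Minkowski[OF compact_itin_cell convex_itin_cell])
  have indep: "\<not> affine_dependent E" unfolding E_def by (rule affine_independent_extreme_points)
  then have fin: "finite E" by (rule aff_independent_finite)
  have "E \<noteq> {}" using hull assms by auto
  then have card: "card E > 0" using fin by (simp add: card_gt_0_iff)
  have sub: "E \<subseteq> itin_cell n" by (auto simp: E_def extreme_point_of_def)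
  have "affine {\<beta> :: (real, 'k) vec. (\<Sum>i\<in>UNIV. \<beta> $ i) = 1}"
    by (auto simp: affine_def sum.distrib simp flip: sum_distrib_left)
  then have "affine hull E \<subseteq> {\<beta> :: (real, 'k) vec. (\<Sum>i\<in>UNIV. \<beta> $ i) = 1}"
    by (rule hull_minimal[rotated]) (use sub in \<open>auto simp: itin_cell_def\<close>)
  then have "(\<Sum>i\<in>UNIV. (0 :: (real, 'k) vec) $ i) = 1" if "0 \<in> affine hull E" using that by blast
  then have 0: "0 \<notin> affine hull E" by auto
  then have "\<not> affine_dependent (insert 0 E)" using indep by (rule affine_independent_insert[rotated])
  moreover have "0 \<notin> E" using 0 hull_inc[of 0 E affine] by metis
  moreover have "(\<lambda>x. - 0 + x) ` E = E" by simp
  ultimately have "independent E" using affine_dependent_iff_dependent[of 0 E] by metis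
  then have "card E = dim E" by (simp add: dim_eq_card_independent)
  also have "\<dots> \<le> dim (itin_cone n :: (real, 'k) vec set)"
    by (rule dim_subset) (use sub in \<open>auto simp: itin_cell_def\<close>)
  also have "\<dots> < DIM((real, 'k) vec)"
    using span_itin_cone[of n] dim_eq_full[of "itin_cone n :: (real, 'k) vec set"]
      dim_subset_UNIV[of "itin_cone n :: (real, 'k) vec set"] by linarith
  finally have "card E \<le> CARD('k) - 1" by simp
  then have "card E - 1 \<le> CARD('k) - 2" by simp
  moreover have "int (card E - 1) simplex (itin_cell n :: (real, 'k) vec set)"
    unfolding simplex_def
  proof (intro exI conjI)
    show "\<not> affine_dependent E" by (rule indep)
    show "int (card E) = int (card E - 1) + 1" using card by simp
    show "itin_cell n = convex hull E" by (rule hull)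
  qed
  ultimately show ?thesis by blast
qed

end

section \<open>The fibres, and substitutions on sequences\<close>

context
  assumes fl: "first_letter \<noteq> (last_letter :: 'k::{finite,linorder})"
begin

lemma J_bounds:
  assumes "(\<alpha> :: (real, 'k) vec) \<in> \<Delta>"
  shows "real (J \<alpha>) * \<alpha> $ last_letter \<le> \<alpha> $ first_letter"
    and "\<alpha> $ first_letter < (real (J \<alpha>) + 1) * \<alpha> $ last_letter"
proof -
  have pos: "\<alpha> $ last_letter > 0" "\<alpha> $ first_letter \<ge> 0" using assms by (auto simp: \<Delta>_def)
  then have "real (J \<alpha>) = of_int \<lfloor>\<alpha> $ first_letter / \<alpha> $ last_letter\<rfloor>" by (simp add: J_def)
  then have "real (J \<alpha>) \<le> \<alpha> $ first_letter / \<alpha> $ last_letter"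
    "\<alpha> $ first_letter / \<alpha> $ last_letter < real (J \<alpha>) + 1" by linarith+
  then show "real (J \<alpha>) * \<alpha> $ last_letter \<le> \<alpha> $ first_letter"
    "\<alpha> $ first_letter < (real (J \<alpha>) + 1) * \<alpha> $ last_letter" using pos by (simp_all add: field_simps)
qed

lemma J_eqI:
  assumes "(\<alpha> :: (real, 'k) vec) $ last_letter > 0"
    and "real n * \<alpha> $ last_letter \<le> \<alpha> $ first_letter"
    and "\<alpha> $ first_letter < (real n + 1) * \<alpha> $ last_letter"
  shows "J \<alpha> = n"
proof -
  have "\<lfloor>\<alpha> $ first_letter / \<alpha> $ last_letter\<rfloor> = int n"
    using assms by (intro floor_unique) (simp_all add: field_simps)
  then show ?thesis by (simp add: J_def)
qed

text \<open>The floor in \<open>J\<close> is the choice of digit that keeps both new coordinates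
  nonnegative, the last one strictly positive.\<close>

lemma unKn_J_nonneg: "(\<alpha> :: (real, 'k) vec) \<in> \<Delta> \<Longrightarrow> 0 \<le> unKn (J \<alpha>) \<alpha> $ i"
  using J_bounds[of \<alpha>] by (auto simp: unKn_def \<Delta>_def)

lemma unKn_J_last_pos: "(\<alpha> :: (real, 'k) vec) \<in> \<Delta> \<Longrightarrow> 0 < unKn (J \<alpha>) \<alpha> $ last_letter"
  using J_bounds[of \<alpha>] by (auto simp: unKn_def)

lemma first_less_1: 
  assumes "(\<alpha> :: (real, 'k) vec) \<in> \<Delta>" shows "\<alpha> $ first_letter < 1"
proof -
  have "0 < unKn (J \<alpha>) \<alpha> $ last_letter" by (rule unKn_J_last_pos[OF assms])
  also have "\<dots> \<le> (\<Sum>i\<in>UNIV. unKn (J \<alpha>) \<alpha> $ i)"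
    by (rule member_le_sum) (auto simp: unKn_J_nonneg[OF assms])
  also have "\<dots> = 1 - \<alpha> $ first_letter" unfolding sum_unKn[OF fl] using assms by (simp add: \<Delta>_def)
  finally show ?thesis by simp
qed

lemma K_in_Delta: 
  assumes "(\<alpha> :: (real, 'k) vec) \<in> \<Delta>" shows "K \<alpha> \<in> \<Delta>"
proof -
  have "(\<Sum>i\<in>UNIV. unKn (J \<alpha>) \<alpha> $ i) = 1 - \<alpha> $ first_letter"
    unfolding sum_unKn[OF fl] using assms by (simp add: \<Delta>_def)
  then show ?thesis
    using first_less_1[OF assms] unKn_J_nonneg[OF assms] unKn_J_last_pos[OF assms]
    unfolding K_def Kn_eq by (simp add: \<Delta>_def flip: sum_divide_distrib)
qed

lemma K_pow_in_Delta: "(\<alpha> :: (real, 'k) vec) \<in> \<Delta> \<Longrightarrow> (K ^^ r) \<alpha> \<in> \<Delta>"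
  by (induction r) (auto simp: K_in_Delta)

lemma K_pow_eq_unK:
  assumes "(\<alpha> :: (real, 'k) vec) \<in> \<Delta>" shows "\<exists>c>0. (K ^^ r) \<alpha> = c *\<^sub>R unK (\<Phi> \<alpha>) r \<alpha>"
proof (induction r)
  case (Suc r)
  then obtain c where c: "c > 0" "(K ^^ r) \<alpha> = c *\<^sub>R unK (\<Phi> \<alpha>) r \<alpha>" by auto
  define b where "b = 1 / (1 - (K ^^ r) \<alpha> $ first_letter)"
  have "(K ^^ Suc r) \<alpha> = b *\<^sub>R unKn (\<Phi> \<alpha> r) ((K ^^ r) \<alpha>)"
    by (simp add: K_def Kn_eq \<Phi>_def b_def)
  also have "\<dots> = (b * c) *\<^sub>R unK (\<Phi> \<alpha>) (Suc r) \<alpha>"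
    by (simp add: c linear_scale[OF linear_unKn[OF fl]])
  finally show ?case using c first_less_1[OF K_pow_in_Delta[OF assms, of r]]
    by (intro exI[of _ "b * c"]) (simp add: b_def)
qed (auto intro!: exI[of _ 1])

lemma Delta_in_itin_cell:
  assumes "(\<alpha> :: (real, 'k) vec) \<in> \<Delta>" shows "\<alpha> \<in> itin_cell (\<Phi> \<alpha>)"
proof -
  have "0 \<le> unK (\<Phi> \<alpha>) r \<alpha> $ i" for r i
  proof -
    obtain c where c: "c > 0" "(K ^^ r) \<alpha> = c *\<^sub>R unK (\<Phi> \<alpha>) r \<alpha>" using K_pow_eq_unK[OF assms] by blast
    have "0 \<le> (K ^^ r) \<alpha> $ i" using K_pow_in_Delta[OF assms, of r] by (simp add: \<Delta>_def)
    then show ?thesis using c by (simp add: zero_le_mult_iff)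
  qed
  then show ?thesis using assms by (simp add: itin_cell_def itin_cone_def cone_upto_def \<Delta>_def)
qed

text \<open>A vanishing last coordinate is a sum of two nonnegative coordinates of the next step, so
  it vanishes forever; then so do the first coordinates, and every other coordinate reaches the
  first place later.\<close>

lemma itin_cone_last_pos:
  assumes \<beta>: "(\<beta> :: (real, 'k) vec) \<in> itin_cone n" and "\<beta> \<noteq> 0"
  shows "0 < \<beta> $ last_letter"
proof (rule ccontr)
  assume "\<not> 0 < \<beta> $ last_letter"
  then have l0: "\<beta> $ last_letter = 0" using itin_cone_nonneg[OF fl \<beta>, of 0 last_letter] by simp
  have step: "unK n (Suc r) \<beta> $ last_letter = 0 \<and> unK n (Suc r) \<beta> $ prev_letter last_letter = 0"
    if "unK n r \<beta> $ last_letter = 0" for r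
    using that last_eq_unKn[OF fl, of "unK n r \<beta>" "n r"] itin_cone_nonneg[OF fl \<beta>, of "Suc r" last_letter]
      itin_cone_nonneg[OF fl \<beta>, of "Suc r" "prev_letter last_letter"] by auto
  have last: "unK n r \<beta> $ last_letter = 0" for r
    by (induction r) (use l0 step in auto)
  then have first: "unK n r \<beta> $ first_letter = 0" for r
    using first_eq_unKn[OF fl, of "unK n r \<beta>" "n r"] step[of r] by auto
  have "\<forall>r. unK n r \<beta> $ i = 0" for i
  proof (induction i rule: letter_induct)
    case (next_letter i)
    then have "unK n r \<beta> $ next_letter i = unK n (Suc r) \<beta> $ i" if "next_letter i \<noteq> last_letter" for r
      using that by (simp add: unKn_next[OF fl])
    then show ?case using next_letter last by metis
  qed (use first in auto)
  then have "unK n 0 \<beta> $ i = 0" for i by blast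
  then have "\<beta> = 0" by (simp add: vec_eq_iff)
  then show False using \<open>\<beta> \<noteq> 0\<close> by simp
qed

lemma itin_cell_step:
  assumes \<beta>: "(\<beta> :: (real, 'k) vec) \<in> itin_cell n"
  shows "\<beta> \<in> \<Delta>" "J \<beta> = n 0" "K \<beta> \<in> itin_cell (\<lambda>j. n (Suc j))"
proof -
  have c: "\<beta> \<in> itin_cone n" and s: "(\<Sum>i\<in>UNIV. \<beta> $ i) = 1" using \<beta> by (auto simp: itin_cell_def)
  have "\<beta> \<noteq> 0" using s by auto
  then have l: "0 < \<beta> $ last_letter" by (rule itin_cone_last_pos[OF c])
  show "\<beta> \<in> \<Delta>" using s l itin_cone_nonneg[OF fl c, of 0] by (simp add: \<Delta>_def)
  \<comment> \<open>Positivity of the last coordinate one step later is the strict inequality that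
    the floor requires.\<close>
  have c': "unKn (n 0) \<beta> \<in> itin_cone (\<lambda>j. n (Suc j))" by (rule unKn_itin_cone[OF fl c])
  moreover have "unKn (n 0) \<beta> \<noteq> 0" 
    using \<open>\<beta> \<noteq> 0\<close> inj_unKn[OF fl, of "n 0"] linear_0[OF linear_unKn[OF fl, of "n 0"]] by (metis injD)
  ultimately have l': "0 < unKn (n 0) \<beta> $ last_letter" by (rule itin_cone_last_pos)
  have "0 \<le> unKn (n 0) \<beta> $ prev_letter last_letter" using itin_cone_nonneg[OF fl c', of 0] by simp
  then show J: "J \<beta> = n 0"
    using l l' unKn_last[OF fl, of "n 0" \<beta>] unKn_prev_last[OF fl, of "n 0" \<beta>] by (intro J_eqI) auto
  have "(\<Sum>i\<in>UNIV. K \<beta> $ i) = 1" using K_in_Delta[OF \<open>\<beta> \<in> \<Delta>\<close>] by (simp add: \<Delta>_def)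
  moreover have "K \<beta> \<in> itin_cone (\<lambda>j. n (Suc j))"
    unfolding K_def Kn_eq J using first_less_1[OF \<open>\<beta> \<in> \<Delta>\<close>]
    by (intro itin_cone_scaleR fl c') simp
  ultimately show "K \<beta> \<in> itin_cell (\<lambda>j. n (Suc j))" by (simp add: itin_cell_def)
qed

lemma fibre_eq_itin_cell:
  assumes "(\<alpha> :: (real, 'k) vec) \<in> \<Delta>" shows "\<Phi>_fibre \<alpha> = itin_cell (\<Phi> \<alpha>)"
proof
  show "\<Phi>_fibre \<alpha> \<subseteq> itin_cell (\<Phi> \<alpha>)" using Delta_in_itin_cell by (fastforce simp: \<Phi>_fibre_def)
  show "itin_cell (\<Phi> \<alpha>) \<subseteq> \<Phi>_fibre \<alpha>"
  proof
    fix \<beta> :: "(real, 'k) vec" assume \<beta>: "\<beta> \<in> itin_cell (\<Phi> \<alpha>)"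
    have "(K ^^ r) \<beta> \<in> itin_cell (\<lambda>j. \<Phi> \<alpha> (r + j))" for r
    proof (induction r)
      case (Suc r)
      then show ?case using itin_cell_step(3)[OF Suc] by simp
    qed (use \<beta> in simp)
    then have "\<Phi> \<beta> r = \<Phi> \<alpha> r" for r
      using itin_cell_step(2) by (fastforce simp: \<Phi>_def[of \<beta>])
    then show "\<beta> \<in> \<Phi>_fibre \<alpha>" using itin_cell_step(1)[OF \<beta>] by (auto simp: \<Phi>_fibre_def)
  qed
qed

end

section \<open>The lexicographic order and infima\<close>

lemma lex_le_iff: "lex_le v w \<longleftrightarrow> (\<forall>m. (\<forall>j<m. v j = w j) \<longrightarrow> v m \<le> w m)"
proof
  assume "lex_le v w"
  then show "\<forall>m. (\<forall>j<m. v j = w j) \<longrightarrow> v m \<le> w m"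
    unfolding lex_le_def less_fun_def by (metis less_le not_less_iff_gr_or_eq linorder_neqE_nat order_refl)
next
  assume *: "\<forall>m. (\<forall>j<m. v j = w j) \<longrightarrow> v m \<le> w m"
  show "lex_le v w"
  proof (cases "v = w")
    case False
    then have "\<exists>m. v m \<noteq> w m" by auto
    define m where "m = (LEAST m. v m \<noteq> w m)"
    have m: "v m \<noteq> w m" unfolding m_def by (rule LeastI_ex) fact
    have l: "\<forall>j<m. v j = w j" unfolding m_def using not_less_Least by blast
    then have "v m < w m" using * m by (simp add: less_le)
    then show ?thesis using l unfolding lex_le_def less_fun_def by blast
  qed (simp add: lex_le_def)
qed

lemma lex_le_refl [simp]: "lex_le v v"
  by (simp add: lex_le_def)

lemma lex_leD: "lex_le v w \<Longrightarrow> (\<And>j. j < m \<Longrightarrow> v j = w j) \<Longrightarrow> v m \<le> w m"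
  by (simp add: lex_le_iff)

lemma lex_le_cases:
  assumes "lex_le v w"
  obtains "v = w" | m where "\<And>j. j < m \<Longrightarrow> v j = w j" "v m < w m"
  using assms unfolding lex_le_def less_fun_def by blast

lemma lex_le_strictI: "(\<And>j. j < m \<Longrightarrow> v j = w j) \<Longrightarrow> v m < w m \<Longrightarrow> lex_le v w"
  unfolding lex_le_def less_fun_def by blast

lemma lex_le_antisym:
  assumes "lex_le v w" "lex_le w v" shows "v = w"
proof
  fix m show "v m = w m"
    by (induction m rule: less_induct) (use assms in \<open>metis lex_leD order.antisym\<close>)
qed

lemma lex_le_trans: 
  assumes "lex_le u v" "lex_le v w" shows "lex_le u w"
  unfolding lex_le_iff
proof (intro allI impI)
  fix m assume eq: "\<forall>j<m. u j = w j"
  have "u j = v j \<and> v j = w j" if "j < m" for j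
    using that
  proof (induction j rule: less_induct)
    case (less j)
    then have "u j \<le> v j" "v j \<le> w j" using assms by (auto intro!: lex_leD[of _ _ j])
    then show ?case using eq less by auto
  qed
  then have "u m \<le> v m" "v m \<le> w m" using assms by (auto intro!: lex_leD[of _ _ m])
  then show "u m \<le> w m" by order
qed

lemma shift_pow: "(shift ^^ r) w = (\<lambda>j. w (r + j))"
  by (induction r arbitrary: w) (auto simp: shift_def fun_eq_iff funpow_swap1)

lemma maximal_seqs_iff: "w \<in> maximal_seqs \<longleftrightarrow> (\<forall>r. lex_le (\<lambda>j. w (r + j)) w)"
  by (simp add: maximal_seqs_def shift_pow)

text \<open>The candidate need not belong to \<open>M\<close>: a lower bound all of whose prefixes
  occur in \<open>M\<close> is the greatest one.\<close>

lemma lex_inf_eqI: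
  assumes "\<And>w. w \<in> M \<Longrightarrow> lex_le S w" and "\<And>m. \<exists>w\<in>M. \<forall>j<m. w j = S j"
  shows "lex_inf M = S"
  unfolding lex_inf_def
proof (rule the_equality)
  have *: "lex_le v S" if "\<forall>w\<in>M. lex_le v w" for v
    unfolding lex_le_iff
  proof (intro allI impI)
    fix m assume "\<forall>j<m. v j = S j"
    moreover obtain w where w: "w \<in> M" "\<forall>j<Suc m. w j = S j" using assms(2) by blast
    ultimately have "v m \<le> w m" using that by (intro lex_leD[of v w]) auto
    then show "v m \<le> S m" using w by simp
  qed
  show "(\<forall>w\<in>M. lex_le S w) \<and> (\<forall>v. (\<forall>w\<in>M. lex_le v w) \<longrightarrow> lex_le v S)" using * assms(1) by blast
  show "u = S" if "(\<forall>w\<in>M. lex_le u w) \<and> (\<forall>v. (\<forall>w\<in>M. lex_le v w) \<longrightarrow> lex_le v u)" for u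
    using that * assms(1) lex_le_antisym by blast
qed

section \<open>Substitutions on infinite sequences\<close>

definition has_prefix :: "'a list \<Rightarrow> (nat \<Rightarrow> 'a) \<Rightarrow> bool"
  where "has_prefix p w \<longleftrightarrow> (\<forall>j<length p. w j = p ! j)"

definition blocks :: "('a \<Rightarrow> 'b list) \<Rightarrow> (nat \<Rightarrow> 'a) \<Rightarrow> nat \<Rightarrow> 'b list"
  where "blocks f w t = concat (map (\<lambda>j. f (w j)) [0..<t])"

text \<open>If no block is empty, \<open>Suc m\<close> blocks reach beyond position
  \<open>m\<close>; without that condition the value is arbitrary.\<close>

definition subst_seq :: "('a \<Rightarrow> 'b list) \<Rightarrow> (nat \<Rightarrow> 'a) \<Rightarrow> nat \<Rightarrow> 'b"
  where "subst_seq f w m = blocks f w (Suc m) ! m"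

lemma blocks_Suc: "blocks f w (Suc t) = blocks f w t @ f (w t)"
  by (simp add: blocks_def)

lemma blocks_0 [simp]: "blocks f w 0 = []"
  by (simp add: blocks_def)

lemma blocks_add: "blocks f w (t + s) = blocks f w t @ blocks f (\<lambda>j. w (t + j)) s"
  by (induction s) (simp_all add: blocks_Suc)

lemma blocks_cong: "(\<And>j. j < t \<Longrightarrow> v j = w j) \<Longrightarrow> blocks f v t = blocks f w t"
  unfolding blocks_def by (intro arg_cong[of _ _ concat] map_cong) auto

context
  fixes f :: "'a \<Rightarrow> 'b list"
  assumes ne: "\<And>a. f a \<noteq> []"
begin

lemma length_blocks_ge: "t \<le> length (blocks f w t)"
proof (induction t)
  case (Suc t)
  have "1 \<le> length (f (w t))" using ne[of "w t"] by (simp add: Suc_le_eq)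
  then show ?case using Suc by (simp add: blocks_Suc)
qed simp

lemma subst_seq_nth:
  assumes "m < length (blocks f w t)" shows "subst_seq f w m = blocks f w t ! m"
proof -
  have m: "m < length (blocks f w (Suc m))" using length_blocks_ge[of "Suc m" w] by simp
  show ?thesis
  proof (cases "t \<le> Suc m")
    case True
    then obtain s where "Suc m = t + s" by (metis le_add_diff_inverse)
    then show ?thesis using assms by (simp add: subst_seq_def blocks_add nth_append)
  next
    case False
    then obtain s where "t = Suc m + s" by (metis le_add_diff_inverse nle_le)
    then have "blocks f w t = blocks f w (Suc m) @ blocks f (\<lambda>j. w (Suc m + j)) s" by (simp only: blocks_add)
    then show ?thesis using m by (simp add: subst_seq_def nth_append)
  qed
qed

lemma subst_seq_add:
  "subst_seq f w (length (blocks f w t) + m) = subst_seq f (\<lambda>j. w (t + j)) m"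
proof -
  have "m < length (blocks f (\<lambda>j. w (t + j)) (Suc m))"
    using length_blocks_ge[of "Suc m" "\<lambda>j. w (t + j)"] by simp
  then show ?thesis
    by (subst subst_seq_nth[of _ w "t + Suc m"]) (auto simp only: blocks_add length_append nth_append subst_seq_def
      add_less_cancel_left not_add_less1 if_False diff_add_inverse)
qed

lemma subst_seq_hd_block: "d < length (f (w 0)) \<Longrightarrow> subst_seq f w d = f (w 0) ! d"
  using subst_seq_nth[of d w 1] by (simp add: blocks_Suc)

lemma subst_seq_0: "subst_seq f w 0 = hd (f (w 0))"
  using subst_seq_hd_block[of 0 w] ne[of "w 0"] by (simp add: hd_conv_nth)

lemma subst_seq_block:
  "d < length (f (w t)) \<Longrightarrow> subst_seq f w (length (blocks f w t) + d) = f (w t) ! d"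
  unfolding subst_seq_add using subst_seq_hd_block[of d "\<lambda>j. w (t + j)"] by simp

lemma blocks_locate:
  obtains t d where "m = length (blocks f w t) + d" "d < length (f (w t))" "t \<le> m"
proof -
  define P where "P t \<longleftrightarrow> m < length (blocks f w (Suc t))" for t
  have ex: "P m" using length_blocks_ge[of "Suc m" w] by (simp add: P_def)
  define t where "t = (LEAST t. P t)"
  have t: "P t" unfolding t_def by (rule LeastI[of P, OF ex])
  have le: "length (blocks f w t) \<le> m"
  proof (cases t)
    case (Suc s)
    then have "\<not> P s" using not_less_Least[of s P] by (simp add: t_def)
    then show ?thesis using Suc by (simp add: P_def)
  qed simp
  show thesis
  proof (rule that)
    show "m = length (blocks f w t) + (m - length (blocks f w t))" using le by simp
    show "m - length (blocks f w t) < length (f (w t))" using t le by (simp add: P_def blocks_Suc)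
    show "t \<le> m" using le length_blocks_ge[of t w] by simp
  qed
qed

lemma has_prefix_subst_seq: 
  assumes "has_prefix p w" shows "has_prefix (concat (map f p)) (subst_seq f w)"
proof -
  have "map (\<lambda>j. f (w j)) [0..<length p] = map f p"
    using assms by (intro nth_equalityI) (auto simp: has_prefix_def)
  then have "concat (map f p) = blocks f w (length p)" by (simp add: blocks_def)
  then show ?thesis using subst_seq_nth by (metis has_prefix_def)
qed

lemma map_subst_seq:
  assumes "d \<le> length (f (w t))"
  shows "map (subst_seq f w) [0..<length (blocks f w t) + d] = blocks f w t @ take d (f (w t))"
proof (rule nth_equalityI)
  fix i assume "i < length (map (subst_seq f w) [0..<length (blocks f w t) + d])"
  then have "i < length (blocks f w t) + d" by simp
  then show "map (subst_seq f w) [0..<length (blocks f w t) + d] ! i = (blocks f w t @ take d (f (w t))) ! i"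
    using assms subst_seq_nth[of i w "Suc t"] by (simp add: blocks_Suc nth_append)
qed (use assms in simp)

end

lemma subst_letter_ne [simp]: "subst_letter n a \<noteq> []"
  by (simp add: subst_letter_def)

lemma hd_subst_letter: "hd (subst_letter n a) = (if a = last_letter then last_letter else next_letter a)"
  by (simp add: subst_letter_def)

lemma length_subst_letter_le: "length (subst_letter n a) \<le> n + 2"
  by (simp add: subst_letter_def)

lemma subst_letter_nth_Suc: "Suc d < length (subst_letter n a) \<Longrightarrow> subst_letter n a ! Suc d = first_letter"
  by (auto simp: subst_letter_def split: if_splits)
     (metis Suc_less_eq nth_replicate replicate_Suc length_replicate)

context
  assumes fl: "first_letter \<noteq> (last_letter :: 'k::{finite,linorder})"
begin

lemma hd_subst_letter_gt: "first_letter < hd (subst_letter n (a :: 'k))"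
  using fl first_letter_less next_letter_neq_first by (auto simp: hd_subst_letter)

text \<open>Blocks differ in their first letters except for k - 1 against k. There both start with k
  and n ones; then the first has another one, while the second is followed by a new block, and no
  block starts with a one.\<close>

lemma subst_seq_less:
  fixes v w :: "nat \<Rightarrow> 'k"
  assumes "v 0 < w 0"
  shows "\<exists>m. (\<forall>j<m. subst_seq (subst_letter n) v j = subst_seq (subst_letter n) w j)
     \<and> subst_seq (subst_letter n) v m < subst_seq (subst_letter n) w m"
proof (cases "next_letter (v 0) = last_letter \<and> w 0 = last_letter")
  case False
  have "v 0 \<noteq> last_letter" using assms not_last_letter_less by metis
  moreover have "next_letter (v 0) < last_letter" if "w 0 = last_letter"
    using False that less_last_letter by auto
  moreover have "next_letter (v 0) < next_letter (w 0)" if "w 0 \<noteq> last_letter"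
    using next_letter_le[OF assms] next_letter_gt[OF that] by order
  ultimately show ?thesis
    by (intro exI[of _ 0]) (auto simp: subst_seq_0 hd_subst_letter)
next
  case True
  have v: "subst_letter n (v 0) = last_letter # replicate (Suc n) first_letter"
    using True assms by (auto simp: subst_letter_def)
  have w: "subst_letter n (w 0) = last_letter # replicate n first_letter"
    using True by (simp add: subst_letter_def)
  show ?thesis
  proof (intro exI[of _ "Suc n"] conjI allI impI)
    fix j assume "j < Suc n"
    then show "subst_seq (subst_letter n) v j = subst_seq (subst_letter n) w j"
      using subst_seq_hd_block[of "subst_letter n" j v] subst_seq_hd_block[of "subst_letter n" j w]
      by (simp add: v w nth_Cons' del: replicate_Suc)
  next
    have "subst_seq (subst_letter n) v (Suc n) = first_letter"
      using subst_seq_hd_block[of "subst_letter n" "Suc n" v] by (simp add: v del: replicate_Suc)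
    moreover have "subst_seq (subst_letter n) w (Suc n) = hd (subst_letter n (w 1))"
      using subst_seq_add[of "subst_letter n" w 1 0] by (simp add: blocks_Suc w subst_seq_0)
    ultimately show "subst_seq (subst_letter n) v (Suc n) < subst_seq (subst_letter n) w (Suc n)"
      using hd_subst_letter_gt by simp
  qed
qed

lemma subst_seq_mono:
  assumes "lex_le v (w :: nat \<Rightarrow> 'k)"
  shows "lex_le (subst_seq (subst_letter n) v) (subst_seq (subst_letter n) w)"
  using assms
proof (cases rule: lex_le_cases)
  case (2 i)
  let ?S = "subst_seq (subst_letter n)"
  let ?B = "blocks (subst_letter n) v i"
  have B: "blocks (subst_letter n) w i = ?B" by (rule blocks_cong) (use 2 in auto)
  obtain m where m: "\<And>j. j < m \<Longrightarrow> ?S (\<lambda>j. v (i + j)) j = ?S (\<lambda>j. w (i + j)) j"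
    "?S (\<lambda>j. v (i + j)) m < ?S (\<lambda>j. w (i + j)) m"
    using subst_seq_less[of "\<lambda>j. v (i + j)" "\<lambda>j. w (i + j)" n] 2 by auto
  have less: "?S v (length ?B + m) < ?S w (length ?B + m)"
    using m(2) subst_seq_add[of "subst_letter n" v i m] subst_seq_add[of "subst_letter n" w i m] by (simp add: B)
  have "?S v j = ?S w j" if j: "j < length ?B + m" for j
  proof (cases "j < length ?B")
    case True
    then show ?thesis using subst_seq_nth[of "subst_letter n" j v i] subst_seq_nth[of "subst_letter n" j w i]
      by (simp add: B)
  next
    case False
    then obtain l where l: "j = length ?B + l" by (metis le_add_diff_inverse not_less)
    then show ?thesis using j m(1)[of l] subst_seq_add[of "subst_letter n" v i l]
        subst_seq_add[of "subst_letter n" w i l] by (simp add: B)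
  qed
  then show ?thesis using less by (rule lex_le_strictI)
qed simp

text \<open>A shift starting at a block boundary is the image of a shift of \<open>w\<close>, and
  monotonicity applies; a shift starting inside a block begins with a one, while the whole sequence
  begins with k.\<close>

lemma subst_seq_maximal:
  assumes w: "(w :: nat \<Rightarrow> 'k) \<in> maximal_seqs" and w0: "w 0 = last_letter"
  shows "subst_seq (subst_letter n) w \<in> maximal_seqs" "subst_seq (subst_letter n) w 0 = last_letter"
proof -
  let ?S = "subst_seq (subst_letter n)"
  show 0: "?S w 0 = last_letter" by (simp add: subst_seq_0 hd_subst_letter w0)
  show "?S w \<in> maximal_seqs"
    unfolding maximal_seqs_iff
  proof
    fix m
    obtain t d where td: "m = length (blocks (subst_letter n) w t) + d" "d < length (subst_letter n (w t))"
      using blocks_locate[of "subst_letter n" m w] subst_letter_ne by metis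
    show "lex_le (\<lambda>j. ?S w (m + j)) (?S w)"
    proof (cases d)
      case 0
      have "(\<lambda>j. ?S w (m + j)) = ?S (\<lambda>j. w (t + j))"
        using subst_seq_add[of "subst_letter n" w t] by (simp add: td 0)
      then show ?thesis using w subst_seq_mono[of "\<lambda>j. w (t + j)" w n] by (simp add: maximal_seqs_iff)
    next
      case (Suc e)
      then have "?S w m = first_letter"
        using subst_seq_block[of "subst_letter n" d w t] td subst_letter_nth_Suc[of e n "w t"] by simp
      then have "?S w (m + 0) < ?S w 0" using 0 first_letter_less[OF fl[symmetric]] by simp
      then show ?thesis by (intro lex_le_strictI[of 0]) auto
    qed
  qed
qed

end

primrec subst_seq_iter :: "(nat \<Rightarrow> nat) \<Rightarrow> nat \<Rightarrow> (nat \<Rightarrow> 'k::{finite,linorder}) \<Rightarrow> nat \<Rightarrow> 'k"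
  where "subst_seq_iter n 0 w = w"
  | "subst_seq_iter n (Suc r) w = subst_seq_iter n r (subst_seq (subst_letter (n r)) w)"

text \<open>The definition peels off the innermost substitution; induction along \<open>K\<close>
  needs the outermost one.\<close>

lemma subst_seq_iter_Suc2:
  "subst_seq_iter n (Suc r) w = subst_seq (subst_letter (n 0)) (subst_seq_iter (\<lambda>j. n (Suc j)) r w)"
  by (induction r arbitrary: w) auto

lemma concat_subst_iter_Suc:
  "concat (map (subst_iter n (Suc r)) p) = concat (map (subst_iter n r) (concat (map (subst_letter (n r)) p)))"
  by (induction p) auto

lemma has_prefix_subst_seq_iter:
  "has_prefix p w \<Longrightarrow> has_prefix (concat (map (subst_iter n r) p)) (subst_seq_iter n r w)"
proof (induction r arbitrary: p w)
  case 0
  then show ?case by simp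
next
  case (Suc r)
  show ?case unfolding concat_subst_iter_Suc subst_seq_iter.simps
    by (intro Suc.IH has_prefix_subst_seq Suc.prems) simp
qed

section \<open>Frequencies\<close>

definition bsum :: "('k \<Rightarrow> real) \<Rightarrow> (nat \<Rightarrow> 'k) \<Rightarrow> nat \<Rightarrow> real"
  where "bsum \<phi> x m = (\<Sum>j<m. \<phi> (x j))"

text \<open>Says f(m) = o(m), without division and in a form stable under a change of index of at
  most linear growth.\<close>

definition sublinear :: "(nat \<Rightarrow> real) \<Rightarrow> bool"
  where "sublinear f \<longleftrightarrow> (\<forall>\<epsilon>>0. \<exists>C. \<forall>m. \<bar>f m\<bar> \<le> \<epsilon> * real m + C)"

lemma sublinearD:
  assumes "sublinear f" "\<epsilon> > 0" obtains C where "0 \<le> C" "\<And>m. \<bar>f m\<bar> \<le> \<epsilon> * real m + C"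
proof -
  obtain C where C: "\<And>m. \<bar>f m\<bar> \<le> \<epsilon> * real m + C" using assms unfolding sublinear_def by blast
  show thesis by (rule that[of "\<bar>C\<bar>"]) (use C in \<open>auto intro: order_trans[OF C]\<close>)
qed

lemma sublinear_iff: "sublinear f \<longleftrightarrow> (\<lambda>m. f m / real m) \<longlonglongrightarrow> 0"
proof
  assume f: "sublinear f"
  show "(\<lambda>m. f m / real m) \<longlonglongrightarrow> 0"
  proof (rule LIMSEQ_I)
    fix r :: real assume r: "0 < r"
    then obtain C where C: "0 \<le> C" "\<And>m. \<bar>f m\<bar> \<le> r / 2 * real m + C" using sublinearD[OF f, of "r/2"] by auto
    obtain N :: nat where N: "2 * C / r < real N" using reals_Archimedean2 by blast
    show "\<exists>no. \<forall>n\<ge>no. norm (f n / real n - 0) < r"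
    proof (intro exI[of _ "Suc N"] allI impI)
      fix m assume "Suc N \<le> m"
      then have m: "real N < real m" by simp
      have "2 * C < real N * r" using N r by (simp add: divide_less_eq)
      also have "\<dots> < real m * r" using m r by simp
      finally have "2 * C < r * real m" by (simp add: mult.commute)
      then have "\<bar>f m\<bar> < r * real m" using C(2)[of m] by (simp add: field_simps)
      then show "norm (f m / real m - 0) < r" using m by (simp add: divide_less_eq)
    qed
  qed
next
  assume lim: "(\<lambda>m. f m / real m) \<longlonglongrightarrow> 0"
  show "sublinear f" unfolding sublinear_def
  proof (intro allI impI)
    fix \<epsilon> :: real assume \<epsilon>: "0 < \<epsilon>"
    obtain N where N: "\<And>m. m \<ge> N \<Longrightarrow> \<bar>f m / real m\<bar> < \<epsilon>" using LIMSEQ_D[OF lim \<epsilon>] by auto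
    define C where "C = (\<Sum>m\<le>N. \<bar>f m\<bar>)"
    have "\<bar>f m\<bar> \<le> \<epsilon> * real m + C" for m
    proof (cases "m \<le> N")
      case True
      then have "\<bar>f m\<bar> \<le> C" unfolding C_def by (intro member_le_sum) auto
      then show ?thesis using \<epsilon> by (simp add: add_increasing)
    next
      case False
      then have "\<bar>f m\<bar> < \<epsilon> * real m" using N[of m] by (simp add: divide_less_eq)
      moreover have "0 \<le> C" unfolding C_def by (simp add: sum_nonneg)
      ultimately show ?thesis by simp
    qed
    then show "\<exists>C. \<forall>m. \<bar>f m\<bar> \<le> \<epsilon> * real m + C" by blast
  qed
qed

lemma bsum_Suc: "bsum \<phi> x (Suc m) = bsum \<phi> x m + \<phi> (x m)"
  by (simp add: bsum_def)

lemma bsum_0 [simp]: "bsum \<phi> x 0 = 0"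
  by (simp add: bsum_def)

lemma bsum_add: "bsum \<phi> x (m + n) = bsum \<phi> x m + bsum \<phi> (\<lambda>j. x (m + j)) n"
  by (induction n) (simp_all add: bsum_Suc)

lemma bsum_eq_wsum: "bsum \<phi> x m = wsum \<phi> (map x [0..<m])"
  by (induction m) (simp_all add: bsum_Suc)

lemma bsum_minus_const: "bsum (\<lambda>l. \<phi> l - c) x m = bsum \<phi> x m - real m * c"
  by (induction m) (simp_all add: bsum_Suc algebra_simps)

lemma bsum_indicator: "bsum (\<lambda>l. of_bool (l = i)) x m = real (count_list (map x [0..<m]) i)"
  by (induction m) (auto simp: bsum_Suc)

lemma bsum_expand:
  fixes x :: "nat \<Rightarrow> 'k::finite"
  shows "bsum \<phi> x m = (\<Sum>i\<in>UNIV. \<phi> i * bsum (\<lambda>l. of_bool (l = i)) x m)"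
proof (induction m)
  case (Suc m)
  have "(\<Sum>i\<in>UNIV. \<phi> i * of_bool (x m = i)) = \<phi> (x m)"
    by (simp add: of_bool_def if_distrib cong: if_cong)
  then show ?case by (simp add: bsum_Suc Suc distrib_left sum.distrib)
qed simp

lemma sum_centred_indicator:
  fixes \<beta> :: "real ^ 'k::finite"
  assumes "(\<Sum>l\<in>UNIV. \<beta> $ l) = 1"
  shows "(\<Sum>l\<in>UNIV. \<beta> $ l * (of_bool (l = i) - \<beta> $ i)) = 0"
proof -
  have "(\<Sum>l\<in>UNIV. \<beta> $ l * of_bool (l = i)) = (\<Sum>l\<in>UNIV. if l = i then \<beta> $ l else 0)"
    by (intro sum.cong) auto
  then show ?thesis
    using assms by (simp add: right_diff_distrib sum_subtractf flip: sum_distrib_right)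
qed

text \<open>Weights orthogonal to \<open>\<alpha>\<close> have mean 0 along a sequence of frequency
  \<open>\<alpha>\<close>. Conversely, the centred indicators are such weights and recover the
  frequency of every letter.\<close>

lemma freq_seqs_iff:
  fixes \<alpha> :: "real ^ 'k::finite"
  assumes \<alpha>: "(\<Sum>i\<in>UNIV. \<alpha> $ i) = 1"
  shows "x \<in> freq_seqs \<alpha> \<longleftrightarrow> (\<forall>\<phi>. (\<Sum>i\<in>UNIV. \<alpha> $ i * \<phi> i) = 0 \<longrightarrow> sublinear (bsum \<phi> x))"
proof -
  let ?c = "\<lambda>i. bsum (\<lambda>l. of_bool (l = i)) x"
  have freq: "x \<in> freq_seqs \<alpha> \<longleftrightarrow> (\<forall>i. (\<lambda>m. ?c i m / real m) \<longlonglongrightarrow> \<alpha> $ i)"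
  proof -
    have "x \<in> freq_seqs \<alpha> \<longleftrightarrow> (\<forall>i. (\<lambda>m. digit_freq (map x [0..<m]) $ i) \<longlonglongrightarrow> \<alpha> $ i)"
      unfolding freq_seqs_def using tendsto_vec_nth vec_tendstoI by fast
    then show ?thesis by (simp add: digit_freq_def bsum_indicator)
  qed
  show ?thesis
  proof
    assume x: "x \<in> freq_seqs \<alpha>"
    show "\<forall>\<phi>. (\<Sum>i\<in>UNIV. \<alpha> $ i * \<phi> i) = 0 \<longrightarrow> sublinear (bsum \<phi> x)"
    proof (intro allI impI)
      fix \<phi> :: "'k \<Rightarrow> real" assume \<phi>: "(\<Sum>i\<in>UNIV. \<alpha> $ i * \<phi> i) = 0"
      have "(\<lambda>m. \<Sum>i\<in>UNIV. \<phi> i * (?c i m / real m)) \<longlonglongrightarrow> (\<Sum>i\<in>UNIV. \<phi> i * \<alpha> $ i)"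
        by (intro tendsto_intros) (use x freq in auto)
      then show "sublinear (bsum \<phi> x)"
        unfolding sublinear_iff bsum_expand[of \<phi>] using \<phi> by (simp add: sum_divide_distrib mult.commute)
    qed
  next
    assume *: "\<forall>\<phi>. (\<Sum>i\<in>UNIV. \<alpha> $ i * \<phi> i) = 0 \<longrightarrow> sublinear (bsum \<phi> x)"
    have "(\<lambda>m. ?c i m / real m) \<longlonglongrightarrow> \<alpha> $ i" for i
    proof -
      have "(\<Sum>l\<in>UNIV. \<alpha> $ l * (of_bool (l = i) - \<alpha> $ i)) = 0"
        by (rule sum_centred_indicator[OF \<alpha>])
      then have "sublinear (bsum (\<lambda>l. of_bool (l = i) - \<alpha> $ i) x)" using *[rule_format, of "\<lambda>l. of_bool (l = i) - \<alpha> $ i"] by blast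
      then have "(\<lambda>m. (?c i m - real m * \<alpha> $ i) / real m) \<longlonglongrightarrow> 0"
        unfolding sublinear_iff bsum_minus_const .
      moreover have "\<forall>\<^sub>F m in sequentially. (?c i m - real m * \<alpha> $ i) / real m = ?c i m / real m - \<alpha> $ i"
        using eventually_gt_at_top[of 0] by eventually_elim (simp add: field_simps)
      ultimately have "(\<lambda>m. ?c i m / real m - \<alpha> $ i) \<longlonglongrightarrow> 0" by (rule Lim_transform_eventually)
      then show ?thesis by (rule LIM_zero_cancel)
    qed
    then show "x \<in> freq_seqs \<alpha>" using freq by blast
  qed
qed

lemma freq_seqsD:
  assumes "x \<in> freq_seqs (\<alpha> :: real ^ 'k::finite)" "(\<Sum>i\<in>UNIV. \<alpha> $ i) = 1" "(\<Sum>i\<in>UNIV. \<alpha> $ i * \<phi> i) = 0"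
  shows "sublinear (bsum \<phi> x)"
  using assms freq_seqs_iff[of \<alpha> x] by blast

lemma sublinear_bounded: "(\<And>m. \<bar>f m\<bar> \<le> C) \<Longrightarrow> sublinear f"
  unfolding sublinear_def by (intro allI impI exI[of _ C]) (smt (verit) mult_nonneg_nonneg of_nat_0_le_iff)

lemma abs_wsum_le:
  fixes \<phi> :: "'k::finite \<Rightarrow> real"
  shows "\<bar>wsum \<phi> W\<bar> \<le> (\<Sum>i\<in>UNIV. \<bar>\<phi> i\<bar>) * real (length W)"
proof (induction W)
  case (Cons a W)
  have "\<bar>\<phi> a\<bar> \<le> (\<Sum>i\<in>UNIV. \<bar>\<phi> i\<bar>)" by (rule member_le_sum) auto
  then show ?case using Cons by (simp add: algebra_simps)
qed simp

subsection \<open>Existence of maximal sequences with given frequencies\<close>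

text \<open>Always appending a letter of largest deficit keeps all deficits bounded.\<close>

definition argmax :: "('k::finite \<Rightarrow> real) \<Rightarrow> 'k"
  where "argmax g = (SOME i. \<forall>j. g j \<le> g i)"

lemma argmax: "g j \<le> g (argmax g)"
proof -
  have "Max (range g) \<in> range g" by (rule Max_in) auto
  then obtain i where "g i = Max (range g)" by (metis imageE)
  then have "\<forall>j. g j \<le> g i" by simp
  then have "\<forall>j. g j \<le> g (argmax g)" unfolding argmax_def by (rule someI[of "\<lambda>i. \<forall>j. g j \<le> g i"])
  then show ?thesis by blast
qed

primrec deficit :: "real ^ 'k::finite \<Rightarrow> nat \<Rightarrow> 'k \<Rightarrow> real"
  where "deficit \<alpha> 0 = (\<lambda>i. 0)"
  | "deficit \<alpha> (Suc m) = (\<lambda>i. deficit \<alpha> m i + \<alpha> $ i - of_bool (argmax (\<lambda>j. deficit \<alpha> m j + \<alpha> $ j) = i))"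

definition greedy_seq :: "real ^ 'k::finite \<Rightarrow> nat \<Rightarrow> 'k"
  where "greedy_seq \<alpha> m = argmax (\<lambda>j. deficit \<alpha> m j + \<alpha> $ j)"

lemma deficit_eq: "deficit \<alpha> m i = real m * \<alpha> $ i - bsum (\<lambda>l. of_bool (l = i)) (greedy_seq \<alpha>) m"
  by (induction m) (simp_all add: bsum_Suc greedy_seq_def algebra_simps)

lemma sum_deficit:
  assumes "(\<Sum>i\<in>UNIV. (\<alpha> :: real ^ 'k::finite) $ i) = 1"
  shows "(\<Sum>i\<in>UNIV. deficit \<alpha> m i) = 0"
proof (induction m)
  case (Suc m)
  then show ?case using assms
    by (simp add: sum.distrib sum_subtractf of_bool_def)
qed simp

text \<open>Before the subtraction the values sum to 1, so the largest is nonnegative and remains at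
  least -1 after losing 1.\<close>

lemma deficit_ge:
  assumes "(\<Sum>i\<in>UNIV. (\<alpha> :: real ^ 'k::finite) $ i) = 1" "\<And>i. 0 \<le> \<alpha> $ i"
  shows "- 1 \<le> deficit \<alpha> m i"
proof (induction m arbitrary: i)
  case (Suc m)
  let ?g = "\<lambda>j. deficit \<alpha> m j + \<alpha> $ j"
  have "0 \<le> ?g (argmax ?g)"
  proof (rule ccontr)
    assume "\<not> 0 \<le> ?g (argmax ?g)"
    then have "?g j \<le> 0" for j using argmax[of ?g j] by linarith
    then have "(\<Sum>j\<in>UNIV. ?g j) \<le> 0" by (intro sum_nonpos) auto
    then show False using sum_deficit[OF assms(1), of m] assms(1) by (simp add: sum.distrib)
  qed
  then show ?case using Suc[of i] assms(2)[of i] by auto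
qed simp

text \<open>The deficits sum to 0, so lower bounds on the others bound each one from above.\<close>

lemma abs_deficit_le:
  assumes "(\<Sum>i\<in>UNIV. (\<alpha> :: real ^ 'k::finite) $ i) = 1" "\<And>i. 0 \<le> \<alpha> $ i"
  shows "\<bar>deficit \<alpha> m i\<bar> \<le> CARD('k)"
proof -
  have "0 = deficit \<alpha> m i + (\<Sum>j\<in>UNIV - {i}. deficit \<alpha> m j)"
    using sum_deficit[OF assms(1), of m] by (simp add: sum.remove[of UNIV i])
  moreover have "(\<Sum>j\<in>UNIV - {i}. - 1) \<le> (\<Sum>j\<in>UNIV - {i}. deficit \<alpha> m j)"
    by (intro sum_mono deficit_ge assms)
  ultimately have "deficit \<alpha> m i \<le> real (card (UNIV - {i}))" by simp
  also have "\<dots> \<le> CARD('k)" by (simp add: card_mono)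
  finally have "deficit \<alpha> m i \<le> CARD('k)" .
  moreover have "1 \<le> CARD('k)" by (simp add: Suc_leI)
  then have "- real CARD('k) \<le> deficit \<alpha> m i" using deficit_ge[OF assms, of m i] by linarith
  ultimately show ?thesis by linarith
qed

lemma abs_bsum_greedy_le:
  assumes "(\<Sum>i\<in>UNIV. (\<alpha> :: real ^ 'k::finite) $ i) = 1" "\<And>i. 0 \<le> \<alpha> $ i"
    and \<phi>: "(\<Sum>i\<in>UNIV. \<alpha> $ i * \<phi> i) = 0"
  shows "\<bar>bsum \<phi> (greedy_seq \<alpha>) m\<bar> \<le> (\<Sum>i\<in>UNIV. \<bar>\<phi> i\<bar> * CARD('k))"
proof -
  have "bsum \<phi> (greedy_seq \<alpha>) m = (\<Sum>i\<in>UNIV. \<phi> i * (real m * \<alpha> $ i - deficit \<alpha> m i))"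
    by (subst bsum_expand) (simp add: deficit_eq)
  also have "\<dots> = real m * (\<Sum>i\<in>UNIV. \<alpha> $ i * \<phi> i) - (\<Sum>i\<in>UNIV. \<phi> i * deficit \<alpha> m i)"
    by (simp add: sum_subtractf sum_distrib_left algebra_simps)
  finally have "\<bar>bsum \<phi> (greedy_seq \<alpha>) m\<bar> = \<bar>\<Sum>i\<in>UNIV. \<phi> i * deficit \<alpha> m i\<bar>" using \<phi> by simp
  also have "\<dots> \<le> (\<Sum>i\<in>UNIV. \<bar>\<phi> i * deficit \<alpha> m i\<bar>)" by (rule sum_abs)
  also have "\<dots> \<le> (\<Sum>i\<in>UNIV. \<bar>\<phi> i\<bar> * CARD('k))"
    unfolding abs_mult by (intro sum_mono mult_left_mono abs_deficit_le assms) auto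
  finally show ?thesis .
qed

lemma greedy_seq_runs:
  assumes "(\<Sum>i\<in>UNIV. (\<alpha> :: real ^ 'k::finite) $ i) = 1" "\<And>i. 0 \<le> \<alpha> $ i" and "\<alpha> $ a < 1"
  shows "\<exists>N. \<forall>s. \<exists>j<N. greedy_seq \<alpha> (s + j) \<noteq> a"
proof -
  \<comment> \<open>During a run of \<open>a\<close> its deficit falls by
    \<open>1 - \<alpha> $ a\<close> per letter, but it stays within an interval of length
    \<open>2 * CARD('k)\<close>.\<close>
  obtain N :: nat where "2 * real CARD('k) / (1 - \<alpha> $ a) < real N" using reals_Archimedean2 by blast
  then have N: "2 * real CARD('k) < real N * (1 - \<alpha> $ a)" using assms(3) by (simp add: divide_less_eq)
  have "\<exists>j<N. greedy_seq \<alpha> (s + j) \<noteq> a" for s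
  proof (rule ccontr)
    assume "\<not> ?thesis"
    then have run: "greedy_seq \<alpha> (s + j) = a" if "j < N" for j using that by blast
    have "deficit \<alpha> (s + j) a = deficit \<alpha> s a - real j * (1 - \<alpha> $ a)" if "j \<le> N" for j
      using that
    proof (induction j)
      case (Suc j)
      then have "deficit \<alpha> (s + Suc j) a = deficit \<alpha> (s + j) a + \<alpha> $ a - 1"
        using run[of j] by (simp add: greedy_seq_def)
      then show ?case using Suc by (simp add: algebra_simps)
    qed simp
    from this[of N] show False
      using abs_deficit_le[OF assms(1,2), of s a] abs_deficit_le[OF assms(1,2), of "s + N" a] N by simp
  qed
  then show ?thesis by blast
qed

text \<open>The prepended run of k is longer than any in \<open>x\<close>, so every proper shift
  starts with a shorter run.\<close>

lemma maximal_long_run: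
  fixes x :: "nat \<Rightarrow> 'k::{finite,linorder}"
  assumes runs: "\<And>s. \<exists>j<N. x (s + j) \<noteq> last_letter"
  shows "(\<lambda>j. if j < N then last_letter else x (j - N)) \<in> maximal_seqs" (is "?w \<in> _")
  unfolding maximal_seqs_iff
proof
  fix r
  obtain j0 where "x j0 \<noteq> last_letter" using runs[of 0] by auto
  then have ex: "?w (N + j0) \<noteq> last_letter" by simp
  \<comment> \<open>The initial run may be longer than \<open>N\<close>, since \<open>x\<close> may
    itself begin with k.\<close>
  define L where "L = (LEAST j. ?w j \<noteq> last_letter)"
  have L: "?w L \<noteq> last_letter" unfolding L_def by (rule LeastI[of "\<lambda>j. ?w j \<noteq> last_letter", OF ex])
  have before: "?w j = last_letter" if "j < L" for j
    using not_less_Least[of j "\<lambda>j. ?w j \<noteq> last_letter"] that unfolding L_def by blast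
  have "N \<le> L" using L by (meson not_le)
  show "lex_le (\<lambda>j. ?w (r + j)) ?w"
  proof (cases "r = 0")
    case True
    then show ?thesis by (simp only: add_0 lex_le_refl)
  next
    case False
    have "\<exists>d<L. ?w (r + d) \<noteq> last_letter"
    proof (cases "r \<le> L")
      case True
      then show ?thesis using L False by (intro exI[of _ "L - r"]) auto
    next
      case False
      obtain j where "j < N" "x (r - N + j) \<noteq> last_letter" using runs by blast
      then show ?thesis using False \<open>N \<le> L\<close> by (intro exI[of _ j]) auto
    qed
    then obtain d where d: "d < L" "?w (r + d) \<noteq> last_letter" by blast
    define e where "e = (LEAST d. ?w (r + d) \<noteq> last_letter)"
    have e: "?w (r + e) \<noteq> last_letter"
      unfolding e_def by (rule LeastI[of "\<lambda>d. ?w (r + d) \<noteq> last_letter", OF d(2)])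
    have "e \<le> d" unfolding e_def by (rule Least_le[of "\<lambda>d. ?w (r + d) \<noteq> last_letter", OF d(2)])
    have e_before: "?w (r + j) = last_letter" if "j < e" for j
      using not_less_Least[of j "\<lambda>d. ?w (r + d) \<noteq> last_letter"] that unfolding e_def by blast
    show ?thesis
    proof (rule lex_le_strictI[of e])
      show "?w (r + j) = ?w j" if "j < e" for j
        using e_before[OF that] before[of j] that \<open>e \<le> d\<close> d(1) by simp
      have "?w (r + e) < last_letter" by (rule less_last_letter[OF e])
      then show "?w (r + e) < ?w e" using before[of e] \<open>e \<le> d\<close> d(1) by simp
    qed
  qed
qed

lemma Delta_last_eq_1:
  assumes "(\<alpha> :: real ^ 'k::{finite,linorder}) \<in> \<Delta>" "1 \<le> \<alpha> $ last_letter" "i \<noteq> last_letter"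
  shows "\<alpha> $ i = 0"
proof -
  have "(\<Sum>i\<in>UNIV. \<alpha> $ i) = \<alpha> $ last_letter + (\<Sum>i\<in>UNIV - {last_letter}. \<alpha> $ i)"
    by (simp add: sum.remove[of UNIV last_letter])
  then have "(\<Sum>i\<in>UNIV - {last_letter}. \<alpha> $ i) \<le> 0" using assms by (simp add: \<Delta>_def)
  moreover have "\<alpha> $ i \<le> (\<Sum>i\<in>UNIV - {last_letter}. \<alpha> $ i)"
    using assms by (intro member_le_sum) (auto simp: \<Delta>_def)
  moreover have "0 \<le> \<alpha> $ i" using assms by (simp add: \<Delta>_def)
  ultimately show ?thesis by linarith
qed

text \<open>A finite prefix does not affect frequencies, so the greedy sequence can be made maximal.
  If k has frequency 1 its runs need not be bounded, and the constant sequence serves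
  instead.\<close>

lemma maximal_freq_seqs_nonempty:
  assumes \<alpha>: "(\<alpha> :: real ^ 'k::{finite,linorder}) \<in> \<Delta>"
  shows "maximal_freq_seqs \<alpha> \<noteq> {}"
proof -
  have sum: "(\<Sum>i\<in>UNIV. \<alpha> $ i) = 1" and nn: "\<And>i. 0 \<le> \<alpha> $ i" using \<alpha> by (auto simp: \<Delta>_def)
  show ?thesis
  proof (cases "\<alpha> $ last_letter < 1")
    case True
    obtain N where N: "\<And>s. \<exists>j<N. greedy_seq \<alpha> (s + j) \<noteq> last_letter"
      using greedy_seq_runs[OF sum nn True] by blast
    define w where "w = (\<lambda>j. if j < N then last_letter else greedy_seq \<alpha> (j - N))"
    have "w \<in> maximal_seqs" unfolding w_def by (rule maximal_long_run[OF N])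
    moreover have "w \<in> freq_seqs \<alpha>" unfolding freq_seqs_iff[OF sum]
    proof (intro allI impI)
      fix \<phi> :: "'k \<Rightarrow> real" assume \<phi>: "(\<Sum>i\<in>UNIV. \<alpha> $ i * \<phi> i) = 0"
      have eq: "bsum \<phi> w m = bsum \<phi> (greedy_seq \<alpha>) (m - N) + real (min m N) * \<phi> last_letter" for m
      proof (induction m)
        case (Suc m)
        then show ?case by (cases "m < N") (auto simp: bsum_Suc w_def Suc_diff_le algebra_simps min_def)
      qed simp
      show "sublinear (bsum \<phi> w)"
      proof (rule sublinear_bounded)
        fix m
        have "\<bar>real (min m N) * \<phi> last_letter\<bar> \<le> real N * \<bar>\<phi> last_letter\<bar>"
          by (simp add: abs_mult mult_right_mono)
        then show "\<bar>bsum \<phi> w m\<bar> \<le> (\<Sum>i\<in>UNIV. \<bar>\<phi> i\<bar> * CARD('k)) + real N * \<bar>\<phi> last_letter\<bar>"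
          unfolding eq using abs_bsum_greedy_le[OF sum nn \<phi>, of "m - N"] by linarith
      qed
    qed
    ultimately show ?thesis by (auto simp: maximal_freq_seqs_def)
  next
    case False
    let ?w = "\<lambda>_ :: nat. last_letter :: 'k"
    have "?w \<in> maximal_seqs" by (simp add: maximal_seqs_iff)
    moreover have "?w \<in> freq_seqs \<alpha>" unfolding freq_seqs_iff[OF sum]
    proof (intro allI impI)
      fix \<phi> :: "'k \<Rightarrow> real" assume "(\<Sum>i\<in>UNIV. \<alpha> $ i * \<phi> i) = 0"
      moreover have "(\<Sum>i\<in>UNIV. \<alpha> $ i * \<phi> i) = (\<Sum>i\<in>{last_letter}. \<alpha> $ i * \<phi> i)"
        using Delta_last_eq_1[OF \<alpha>] False by (intro sum.mono_neutral_right) auto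
      ultimately have "\<phi> last_letter = 0" using False by auto
      then show "sublinear (bsum \<phi> ?w)" by (intro sublinear_bounded[of _ 0]) (simp add: bsum_def)
    qed
    ultimately show ?thesis by (auto simp: maximal_freq_seqs_def)
  qed
qed

section \<open>Runs of k forced by the frequency\<close>

lemma maximal_0:
  assumes "w \<in> maximal_seqs" "w s = last_letter" shows "w 0 = last_letter"
  using assms lex_leD[of "\<lambda>j. w (s + j)" w 0] by (simp add: maximal_seqs_iff) (metis add_0_right le_last_letter order.antisym)

definition forces_run :: "real ^ 'k::{finite,linorder} \<Rightarrow> nat \<Rightarrow> bool"
  where "forces_run \<beta> N \<longleftrightarrow> (\<forall>u\<in>freq_seqs \<beta>. \<exists>s. \<forall>j<N. u (s + j) = last_letter)"

lemma forces_run_1: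
  assumes \<beta>: "(\<beta> :: real ^ 'k::{finite,linorder}) \<in> \<Delta>" shows "forces_run \<beta> 1"
  unfolding forces_run_def
proof (intro ballI, rule ccontr)
  fix u assume u: "u \<in> freq_seqs \<beta>" and "\<not> (\<exists>s. \<forall>j<1. u (s + j) = last_letter)"
  then have un: "u s \<noteq> last_letter" for s by (metis add_0_right less_one)
  have sum: "(\<Sum>i\<in>UNIV. \<beta> $ i) = 1" and pos: "0 < \<beta> $ last_letter" using \<beta> by (auto simp: \<Delta>_def)
  have "(\<Sum>l\<in>UNIV. \<beta> $ l * (of_bool (l = last_letter) - \<beta> $ last_letter)) = 0"
    by (rule sum_centred_indicator[OF sum])
  then have "sublinear (bsum (\<lambda>l. of_bool (l = last_letter) - \<beta> $ last_letter) u)"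
    by (rule freq_seqsD[OF u sum])
  moreover have "bsum (\<lambda>l. of_bool (l = last_letter) - \<beta> $ last_letter) u m = - (real m * \<beta> $ last_letter)" for m
    unfolding bsum_minus_const by (simp add: bsum_def un)
  ultimately obtain C where C: "\<And>m. \<bar>- (real m * \<beta> $ last_letter)\<bar> \<le> \<beta> $ last_letter / 2 * real m + C"
    using sublinearD[of _ "\<beta> $ last_letter / 2"] pos by (metis half_gt_zero)
  obtain m :: nat where "2 * C / \<beta> $ last_letter < real m" using reals_Archimedean2 by blast
  then show False using C[of m] pos by (simp add: field_simps)
qed

text \<open>Without a run of length \<open>N\<close>, every window of that length contains another
  letter, and the others would have frequency at least 1/N in the mean. Half of this is the
  tolerance used below.\<close>

lemma forces_run_axis: "forces_run (axis last_letter 1 :: real ^ 'k::{finite,linorder}) N"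
  unfolding forces_run_def
proof (intro ballI, rule ccontr)
  let ?\<beta> = "axis last_letter 1 :: (real, 'k) vec"
  let ?\<phi> = "\<lambda>l :: 'k. of_bool (l \<noteq> last_letter) :: real"
  fix u assume u: "u \<in> freq_seqs ?\<beta>" and "\<not> (\<exists>s. \<forall>j<N. u (s + j) = last_letter)"
  then have un: "\<exists>j<N. u (s + j) \<noteq> last_letter" for s by blast
  then have N: "N > 0" by (metis gr0I not_less_zero)
  have sum: "(\<Sum>i\<in>UNIV. ?\<beta> $ i) = 1" by (simp add: axis_def)
  have "(\<Sum>i\<in>UNIV. ?\<beta> $ i * ?\<phi> i) = 0" by (intro sum.neutral) (auto simp: axis_def)
  then have "sublinear (bsum ?\<phi> u)" by (rule freq_seqsD[OF u sum])
  then obtain C where C: "\<And>m. \<bar>bsum ?\<phi> u m\<bar> \<le> 1 / (2 * real N) * real m + C"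
    using sublinearD[of _ "1 / (2 * real N)"] N by (metis divide_pos_pos of_nat_0_less_iff zero_less_mult_iff zero_less_numeral zero_less_one)
  have "real t \<le> bsum ?\<phi> u (N * t)" for t
  proof (induction t)
    case (Suc t)
    obtain j where j: "j < N" "u (N * t + j) \<noteq> last_letter" using un by blast
    have "?\<phi> (u (N * t + j)) \<le> bsum ?\<phi> (\<lambda>j. u (N * t + j)) N"
      unfolding bsum_def by (rule member_le_sum[of j]) (use j in auto)
    then show ?case using Suc j bsum_add[of ?\<phi> u "N * t" N] by (simp add: add.commute)
  qed simp
  moreover have "1 / (2 * real N) * real (N * t) = real t / 2" for t using N by simp
  ultimately have le: "real t \<le> real t / 2 + C" for t
    using C[of "N * t"] by (metis abs_ge_self order_trans)
  obtain t :: nat where "2 * C < real t" using reals_Archimedean2 by blast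
  then show False using le[of t] by linarith
qed

context
  assumes fl: "first_letter \<noteq> (last_letter :: 'k::{finite,linorder})"
begin

text \<open>The weight of an image block is a weight \<open>\<psi>\<close> on letters, orthogonal to
  \<open>K \<alpha>\<close> by duality. Sums of \<open>\<phi>\<close> over the image are sums of
  \<open>\<psi>\<close> over \<open>w\<close>, up to one incomplete block of bounded length.\<close>

lemma subst_seq_freq:
  assumes \<alpha>: "(\<alpha> :: (real, 'k) vec) \<in> \<Delta>" and w: "w \<in> freq_seqs (K \<alpha>)"
  shows "subst_seq (subst_letter (J \<alpha>)) w \<in> freq_seqs \<alpha>"
proof -
  have sum: "(\<Sum>i\<in>UNIV. \<alpha> $ i) = 1" "(\<Sum>i\<in>UNIV. K \<alpha> $ i) = 1"
    using \<alpha> K_in_Delta[OF fl \<alpha>] by (auto simp: \<Delta>_def)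
  let ?f = "subst_letter (J \<alpha>) :: 'k \<Rightarrow> 'k list"
  show ?thesis unfolding freq_seqs_iff[OF sum(1)]
  proof (intro allI impI)
    fix \<phi> :: "'k \<Rightarrow> real" assume \<phi>: "(\<Sum>i\<in>UNIV. \<alpha> $ i * \<phi> i) = 0"
    define \<psi> where "\<psi> i = wsum \<phi> (?f i)" for i
    have "(\<Sum>i\<in>UNIV. K \<alpha> $ i * \<psi> i) = (1 / (1 - \<alpha> $ first_letter)) * (\<Sum>i\<in>UNIV. unKn (J \<alpha>) \<alpha> $ i * \<psi> i)"
      by (simp add: K_def Kn_eq sum_distrib_left mult.assoc sum_divide_distrib)
    also have "\<dots> = 0" unfolding \<psi>_def unKn_duality[OF fl] \<phi> by simp
    finally have sub: "sublinear (bsum \<psi> w)" by (rule freq_seqsD[OF w sum(2)])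
    show "sublinear (bsum \<phi> (subst_seq ?f w))" unfolding sublinear_def
    proof (intro allI impI)
      fix \<epsilon> :: real assume \<epsilon>: "\<epsilon> > 0"
      obtain C where C: "\<And>m. \<bar>bsum \<psi> w m\<bar> \<le> \<epsilon> * real m + C" using sublinearD[OF sub \<epsilon>] by blast
      define B where "B = (\<Sum>i\<in>UNIV. \<bar>\<phi> i\<bar>)"
      have B: "0 \<le> B" unfolding B_def by (simp add: sum_nonneg)
      have "\<bar>bsum \<phi> (subst_seq ?f w) m\<bar> \<le> \<epsilon> * real m + (C + B * real (J \<alpha> + 2))" for m
      proof -
        obtain t d where td: "m = length (blocks ?f w t) + d" "d < length (?f (w t))" "t \<le> m"
          using blocks_locate[of ?f m w] subst_letter_ne by metis
        have "wsum \<phi> (blocks ?f w t) = bsum \<psi> w t"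
          by (induction t) (simp_all add: blocks_Suc bsum_Suc \<psi>_def)
        then have eq: "bsum \<phi> (subst_seq ?f w) m = bsum \<psi> w t + wsum \<phi> (take d (?f (w t)))"
          unfolding bsum_eq_wsum[of \<phi>] td(1) using td(2) by (subst map_subst_seq) auto
        have "\<bar>wsum \<phi> (take d (?f (w t)))\<bar> \<le> B * real (length (take d (?f (w t))))"
          unfolding B_def by (rule abs_wsum_le)
        also have "\<dots> \<le> B * real (J \<alpha> + 2)"
          using length_subst_letter_le[of "J \<alpha>" "w t"] td(2) B by (intro mult_left_mono) auto
        finally have "\<bar>wsum \<phi> (take d (?f (w t)))\<bar> \<le> B * real (J \<alpha> + 2)" .
        moreover have "\<epsilon> * real t \<le> \<epsilon> * real m" using td(3) \<epsilon> by simp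
        ultimately show ?thesis unfolding eq using C[of t] by linarith
      qed
      then show "\<exists>C. \<forall>m. \<bar>bsum \<phi> (subst_seq ?f w) m\<bar> \<le> \<epsilon> * real m + C" by blast
    qed
  qed
qed

end

section \<open>Matching letters \<open>k\<close> with ones\<close>

text \<open>Places opened by letters k minus ones met. For frequency \<alpha> and n =
  \<open>J \<alpha>\<close> the drift is (n + 1) \<alpha>_k - \<alpha>_1 > 0, the last coordinate of
  \<open>unKn n \<alpha>\<close>.\<close>

definition walk :: "nat \<Rightarrow> (nat \<Rightarrow> 'k::{finite,linorder}) \<Rightarrow> nat \<Rightarrow> int"
  where "walk n v m = (\<Sum>j<m. if v j = last_letter then int n + 1 else if v j = first_letter then - 1 else 0)"

text \<open>By \<open>run\<close> every k carries the n ones common to both images that start with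
  k; where this fails the comparison is immediate, see \<open>shift_ge_subst_seq\<close>. By
  \<open>bdd\<close> the walk attains its minimum over any future.\<close>

locale excess_walk =
  fixes v :: "nat \<Rightarrow> 'k::{finite,linorder}" and n :: nat and C :: int
  assumes fl: "first_letter \<noteq> (last_letter :: 'k)"
    and run: "v j = last_letter \<Longrightarrow> 1 \<le> d \<Longrightarrow> d \<le> n \<Longrightarrow> v (j + d) = first_letter"
    and bdd: "- C \<le> walk n v m"
begin

abbreviation H where "H \<equiv> walk n v"

text \<open>The future minimum of the walk, taken over all s >= r.\<close>

definition h :: "nat \<Rightarrow> int"
  where "h r = H (SOME s. r \<le> s \<and> (\<forall>s'\<ge>r. H s \<le> H s'))"

text \<open>Each letter \<open>k\<close> opens \<open>n + 1\<close> places for ones; it is unmatched if not all of these are filled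
  by ones when they are assigned last-in-first-out.\<close>

definition unmatched :: "nat \<Rightarrow> bool"
  where "unmatched j \<longleftrightarrow> v j = last_letter \<and> H j < h (Suc j)"

definition npos :: "nat \<Rightarrow> nat"
  where "npos p = (\<Sum>j<p. if v j = first_letter then 0 else 1)"

definition pos :: "nat \<Rightarrow> nat"
  where "pos t = (SOME p. npos p = t \<and> v p \<noteq> first_letter)"

text \<open>A preimage of the rearranged sequence: an unmatched k is read as the image of k, a
  matched one as the image of k - 1, and any other letter i > 1 as the image of i - 1. All ones are
  absorbed.\<close>

definition reduced :: "nat \<Rightarrow> 'k"
  where "reduced t = (if unmatched (pos t) then last_letter else prev_letter (v (pos t)))"

lemma h_attained: "\<exists>s\<ge>r. h r = H s" and h_le: "r \<le> s \<Longrightarrow> h r \<le> H s"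
proof -
  obtain s0 where s0: "r \<le> s0" "\<And>y. r \<le> y \<Longrightarrow> nat (H s0 + C) \<le> nat (H y + C)"
    using ex_has_least_nat[of "\<lambda>s. r \<le> s" r "\<lambda>s. nat (H s + C)"] by auto
  have "H s0 \<le> H y" if "r \<le> y" for y using s0(2)[OF that] bdd[of s0] bdd[of y] by linarith
  then have "\<exists>s. r \<le> s \<and> (\<forall>s'\<ge>r. H s \<le> H s')" using s0(1) by blast
  then have *: "r \<le> (SOME s. r \<le> s \<and> (\<forall>s'\<ge>r. H s \<le> H s')) \<and>
      (\<forall>s'\<ge>r. H (SOME s. r \<le> s \<and> (\<forall>s'\<ge>r. H s \<le> H s')) \<le> H s')" by (rule someI_ex)
  then show "\<exists>s\<ge>r. h r = H s" unfolding h_def by blast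
  show "r \<le> s \<Longrightarrow> h r \<le> H s" using * unfolding h_def by blast
qed

lemma h_mono: "r \<le> s \<Longrightarrow> h r \<le> h s"
  using h_attained[of s] h_le[of r] by auto

lemma H_Suc: "H (Suc j) = H j + (if v j = last_letter then int n + 1 else if v j = first_letter then - 1 else 0)"
  by (simp add: walk_def)

lemma H_first_run: "(\<And>j. j < d \<Longrightarrow> v (p + j) = first_letter) \<Longrightarrow> H (p + d) = H p - int d"
  by (induction d) (use fl in \<open>auto simp: H_Suc\<close>)

lemma H_block: "v j = last_letter \<Longrightarrow> H (j + Suc n) = H j + 1"
  using H_first_run[of n "Suc j"] run[of j "Suc _"] H_Suc[of j] by simp

text \<open>After k and its n ones the walk stands at \<open>H j + 1\<close>, so the future minimum,
  which exceeds \<open>H j\<close>, can only be this value.\<close>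

lemma h_unmatched:
  assumes "unmatched j" shows "h j = H j" "h (Suc j) = H j + 1"
proof -
  have v: "v j = last_letter" and lt: "H j < h (Suc j)" using assms by (auto simp: unmatched_def)
  have "h (Suc j) \<le> H (j + Suc n)" by (rule h_le) simp
  then show "h (Suc j) = H j + 1" using lt H_block[OF v] by linarith
  obtain s where s: "j \<le> s" "h j = H s" using h_attained by blast
  have "h j \<le> H j" by (rule h_le) simp
  moreover have "h (Suc j) \<le> H s" if "s \<noteq> j" by (rule h_le) (use s that in simp)
  ultimately show "h j = H j" using s lt by fastforce
qed

text \<open>Hence \<open>h p - h 0\<close> counts the unmatched letters before \<open>p\<close>:
  past any other position the walk comes down to its current level or below, so dropping that
  position leaves the minimum unchanged.\<close>

lemma h_Suc: "h (Suc j) = h j + (if unmatched j then 1 else 0)"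
proof (cases "unmatched j")
  case True
  then show ?thesis using h_unmatched by simp
next
  case False
  have *: "h (Suc j) \<le> H j"
  proof (cases "v j = last_letter")
    case True
    then show ?thesis using False by (simp add: unmatched_def)
  next
    case False
    then have "H (Suc j) \<le> H j" by (simp add: H_Suc)
    then show ?thesis using h_le[of "Suc j" "Suc j"] by simp
  qed
  obtain s where s: "j \<le> s" "h j = H s" using h_attained by blast
  have "h (Suc j) \<le> H s"
    by (cases "s = j") (use * s h_le[of "Suc j" s] in auto)
  then show ?thesis using h_mono[of j "Suc j"] s False by simp
qed

lemma npos_Suc: "npos (Suc p) = npos p + (if v p = first_letter then 0 else 1)"
  by (simp add: npos_def)

lemma npos_0 [simp]: "npos 0 = 0"
  by (simp add: npos_def)

lemma npos_mono: "p \<le> q \<Longrightarrow> npos p \<le> npos q"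
  by (rule lift_Suc_mono_le[of npos]) (auto simp: npos_Suc)

lemma npos_first_run: "(\<And>j. j < d \<Longrightarrow> v (p + j) = first_letter) \<Longrightarrow> npos (p + d) = npos p"
  by (induction d) (auto simp: npos_Suc)

lemma npos_inj: "npos p = npos q \<Longrightarrow> v p \<noteq> first_letter \<Longrightarrow> v q \<noteq> first_letter \<Longrightarrow> p = q"
  using npos_mono[of "Suc p" q] npos_mono[of "Suc q" p]
  by (cases p q rule: linorder_cases) (auto simp: npos_Suc)

lemma ex_neq_first: "\<exists>j. v (p + j) \<noteq> first_letter"
proof (rule ccontr)
  assume "\<not> ?thesis"
  then have "H (p + nat (H p + C + 1)) = H p - int (nat (H p + C + 1))" by (intro H_first_run) auto
  then show False using bdd[of p] bdd[of "p + nat (H p + C + 1)"] by simp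
qed

lemma npos_unbounded: "\<exists>p. t \<le> npos p"
proof (induction t)
  case (Suc t)
  then obtain p where p: "t \<le> npos p" by blast
  obtain j where j: "v (p + j) \<noteq> first_letter" using ex_neq_first by blast
  then show ?case using p npos_mono[of p "p + j"] npos_Suc[of "p + j"] by (intro exI[of _ "Suc (p + j)"]) auto
qed simp

lemma pos: "npos (pos t) = t" "v (pos t) \<noteq> first_letter"
proof -
  define q where "q = (LEAST q. t < npos q)"
  have "\<exists>q. t < npos q" using npos_unbounded[of "Suc t"] by (simp only: Suc_le_eq)
  then have q: "t < npos q" unfolding q_def by (rule LeastI_ex)
  then obtain p where p: "q = Suc p" by (cases q) auto
  then have "\<not> t < npos p" using not_less_Least[of p "\<lambda>q. t < npos q"] by (simp add: q_def)
  then have "npos p = t \<and> v p \<noteq> first_letter" using q by (simp add: p npos_Suc split: if_splits)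
  then have "npos (pos t) = t \<and> v (pos t) \<noteq> first_letter" unfolding pos_def by (rule someI)
  then show "npos (pos t) = t" "v (pos t) \<noteq> first_letter" by auto
qed

lemma pos_npos: "v p \<noteq> first_letter \<Longrightarrow> pos (npos p) = p"
  by (rule npos_inj) (simp_all add: pos)

text \<open>The first sum treats every k as matched; the second term corrects this for the unmatched
  ones, which \<open>h\<close> counts.\<close>

lemma bsum_reduced:
  "bsum \<psi> reduced (npos p) = bsum (\<lambda>l. if l = first_letter then 0 else \<psi> (prev_letter l)) v p +
     (\<psi> last_letter - \<psi> (prev_letter last_letter)) * real_of_int (h p - h 0)"
proof (induction p)
  case (Suc p)
  show ?case
  proof (cases "v p = first_letter")
    case True
    then have "\<not> unmatched p" using fl by (simp add: unmatched_def)
    then show ?thesis using True Suc by (simp add: npos_Suc bsum_Suc h_Suc)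
  next
    case False
    then have "reduced (npos p) = (if unmatched p then last_letter else prev_letter (v p))"
      by (simp add: reduced_def pos_npos)
    moreover have "v p = last_letter" if "unmatched p" using that by (simp add: unmatched_def)
    ultimately show ?thesis using False Suc
      by (auto simp: npos_Suc bsum_Suc h_Suc algebra_simps)
  qed
qed simp

lemma reduced_eq_last: "reduced t = last_letter \<longleftrightarrow> unmatched (pos t)"
  using prev_letter_neq_last pos(2) by (auto simp: reduced_def)

lemma subst_reduced_le:
  assumes "unmatched (pos t0)"
  shows "lex_le (subst_seq (subst_letter n) (\<lambda>j. reduced (t0 + j))) (\<lambda>j. v (pos t0 + j))"
proof -
  let ?f = "subst_letter n :: 'k \<Rightarrow> 'k list"
  define u where "u = (\<lambda>j. reduced (t0 + j))"
  define y where "y = subst_seq ?f u"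
  define z where "z = (\<lambda>j. v (pos t0 + j))"
  define len where "len t = length (blocks ?f u t)" for t
  have y: "y (len t + d) = ?f (u t) ! d" if "d < length (?f (u t))" for t d
    unfolding y_def len_def using that by (intro subst_seq_block) auto
  have "lex_le y z"
  proof (cases "\<exists>m. y m < z m \<and> (\<forall>j<m. y j = z j)")
    case True
    then show ?thesis by (auto intro: lex_le_strictI)
  next
    case False
    \<comment> \<open>The middle part of the invariant says that no one from this position on fills
      a place opened earlier.\<close>
    have "(\<forall>m<len t. y m = z m) \<and> H (pos t0 + len t) = h (pos t0 + len t) \<and> npos (pos t0 + len t) = t0 + t" for t
    proof (induction t)
      case 0
      then show ?case using h_unmatched[OF assms] pos by (simp add: len_def)
    next
      case (Suc t)
      define p where "p = pos t0 + len t"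
      have eq: "\<And>m. m < len t \<Longrightarrow> y m = z m" and Hh: "H p = h p" and np: "npos p = t0 + t"
        using Suc by (auto simp: p_def)
      have len: "len (Suc t) = len t + length (?f (u t))" by (simp add: len_def blocks_Suc)
      have z: "z (len t + d) = v (p + d)" for d by (simp add: z_def p_def add.assoc)
      have step: ?case if "\<And>d. d < length (?f (u t)) \<Longrightarrow> ?f (u t) ! d = v (p + d)"
        and "H (p + length (?f (u t))) = h (p + length (?f (u t)))" and "npos (p + length (?f (u t))) = Suc (npos p)"
      proof -
        have "y m = z m" if "m < len (Suc t)" for m
        proof (cases "m < len t")
          case False
          then obtain d where "m = len t + d" by (metis le_add_diff_inverse not_less)
          then show ?thesis using y[of d t] z[of d] that len \<open>\<And>d. d < length (?f (u t)) \<Longrightarrow> ?f (u t) ! d = v (p + d)\<close>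
            by simp
        qed (use eq in simp)
        then show ?thesis using that np by (simp add: len p_def add.assoc)
      qed
      have vp: "v p \<noteq> first_letter"
      proof
        assume "v p = first_letter"
        then have "H (Suc p) = H p - 1" using fl by (simp add: H_Suc)
        then show False using h_le[of p "Suc p"] Hh by simp
      qed
      then have pos_p: "pos (t0 + t) = p" using pos_npos np by metis
      show ?case
      proof (cases "v p = last_letter")
        case False
        then have "u t = prev_letter (v p)" by (simp add: u_def reduced_def pos_p unmatched_def)
        then have w: "?f (u t) = [v p]"
          using vp False by (simp add: subst_letter_def prev_letter_neq_last next_prev_letter)
        show ?thesis
        proof (rule step)
          have "H (Suc p) = H p" using vp False by (simp add: H_Suc)
          moreover have "\<not> unmatched p" using False by (simp add: unmatched_def)
          then have "h (Suc p) = h p" by (simp add: h_Suc)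
          ultimately show "H (p + length (?f (u t))) = h (p + length (?f (u t)))" using Hh by (simp add: w)
        qed (use vp in \<open>simp_all add: w npos_Suc\<close>)
      next
        case last: True
        have first: "v (Suc p + d) = first_letter" if "d < n" for d using run[OF last, of "Suc d"] that by simp
        have np_n: "npos (Suc p + n) = Suc (npos p)"
          using npos_first_run[of n "Suc p"] first vp by (simp add: npos_Suc)
        show ?thesis
        proof (cases "unmatched p")
          case True
          then have "u t = last_letter" by (simp add: u_def reduced_def pos_p)
          then have w: "?f (u t) = last_letter # replicate n first_letter" by (simp add: subst_letter_def)
          show ?thesis
          proof (rule step)
            show "?f (u t) ! d = v (p + d)" if "d < length (?f (u t))" for d
              using that last first[of "d - 1"] by (cases d) (auto simp: w)
            have "H p + 1 \<le> h (p + Suc n)" using h_mono[of "Suc p" "p + Suc n"] h_unmatched[OF True] by simp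
            then show "H (p + length (?f (u t))) = h (p + length (?f (u t)))"
              using H_block[OF last] h_le[of "p + Suc n" "p + Suc n"] by (simp add: w)
            show "npos (p + length (?f (u t))) = Suc (npos p)" using np_n by (simp add: w)
          qed
        next
          case False
          then have "u t = prev_letter last_letter" by (simp add: u_def reduced_def pos_p last)
          then have w: "?f (u t) = last_letter # replicate (Suc n) first_letter"
            using fl by (simp add: subst_letter_def prev_letter_neq_last next_prev_letter)
          have before: "?f (u t) ! d = v (p + d)" if "d < Suc n" for d
            using that last first[of "d - 1"] by (cases d) (auto simp: w nth_Cons' simp del: replicate_Suc)
          \<comment> \<open>Any other letter here would be the first difference and in favour of
            \<open>v\<close>, which the present case excludes.\<close>
          have extra: "v (p + Suc n) = first_letter"
          proof (rule ccontr)
            assume "v (p + Suc n) \<noteq> first_letter"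
            then have "first_letter < z (len t + Suc n)" unfolding z by (rule first_letter_less)
            moreover have "y (len t + Suc n) = first_letter" using y[of "Suc n" t] by (simp add: w del: replicate_Suc)
            moreover have "y m = z m" if m: "m < len t + Suc n" for m
            proof (cases "m < len t")
              case False
              then obtain d where "m = len t + d" by (metis le_add_diff_inverse not_less)
              then show ?thesis using y[of d t] z[of d] before[of d] m by (simp add: w del: replicate_Suc)
            qed (use eq in simp)
            ultimately have "y (len t + Suc n) < z (len t + Suc n) \<and> (\<forall>j<len t + Suc n. y j = z j)" by simp
            then show False using \<open>\<not> (\<exists>m. y m < z m \<and> (\<forall>j<m. y j = z j))\<close> by blast
          qed
          show ?thesis
          proof (rule step)
            show "?f (u t) ! d = v (p + d)" if "d < length (?f (u t))" for d
            proof (cases "d = Suc n")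
              case True
              then show ?thesis using extra by (simp add: w del: replicate_Suc)
            next
              case False
              then show ?thesis using before[of d] that by (simp add: w del: replicate_Suc)
            qed
            have "H (p + Suc (Suc n)) = H p" using H_block[OF last] H_Suc[of "p + Suc n"] extra fl by simp
            then show "H (p + length (?f (u t))) = h (p + length (?f (u t)))"
              using h_mono[of p "p + Suc (Suc n)"] h_le[of "p + Suc (Suc n)" "p + Suc (Suc n)"] Hh
              by (simp add: w)
            show "npos (p + length (?f (u t))) = Suc (npos p)"
              using np_n extra npos_Suc[of "Suc p + n"] by (simp add: w)
          qed
        qed
      qed
    qed
    moreover have "m < len (Suc m)" for m
      using length_blocks_ge[of ?f "Suc m" u] by (simp add: len_def)
    ultimately have "y = z" by blast
    then show ?thesis by simp
  qed
  then show ?thesis by (simp add: y_def z_def u_def)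
qed

end

context
  assumes fl: "first_letter \<noteq> (last_letter :: 'k::{finite,linorder})"
begin

text \<open>The number of unmatched letters is not a sum of letter weights, but it differs from the
  walk, which is one, by o(m): a walk of positive linear drift stays close to its future
  minimum.\<close>

lemma reduced_freq:
  assumes \<alpha>: "(\<alpha> :: (real, 'k) vec) \<in> \<Delta>" and v: "v \<in> freq_seqs \<alpha>"
    and ew: "excess_walk v (J \<alpha>) C"
    and H: "sublinear (\<lambda>m. real_of_int (walk (J \<alpha>) v m) - real m * ((real (J \<alpha>) + 1) * \<alpha> $ last_letter - \<alpha> $ first_letter))"
  shows "excess_walk.reduced v (J \<alpha>) \<in> freq_seqs (K \<alpha>)"
proof -
  interpret excess_walk v "J \<alpha>" C by (rule ew)
  define c where "c = (real (J \<alpha>) + 1) * \<alpha> $ last_letter - \<alpha> $ first_letter"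
  have c: "0 < c" unfolding c_def using J_bounds[OF fl \<alpha>] by simp
  have sum: "(\<Sum>i\<in>UNIV. \<alpha> $ i) = 1" "(\<Sum>i\<in>UNIV. K \<alpha> $ i) = 1"
    using \<alpha> K_in_Delta[OF fl \<alpha>] by (auto simp: \<Delta>_def)
  have hH: "sublinear (\<lambda>p. real_of_int (h p - H p))" unfolding sublinear_def
  proof (intro allI impI)
    fix \<epsilon> :: real assume \<epsilon>: "0 < \<epsilon>"
    \<comment> \<open>With \<open>e \<le> c\<close> the lower bound \<open>(c - e) * s - B\<close>
      is nondecreasing in \<open>s\<close>, so over the future of \<open>p\<close> it is least at
      \<open>p\<close>.\<close>
    define e where "e = min (\<epsilon> / 2) c"
    have e: "0 < e" "e \<le> c" "2 * e \<le> \<epsilon>" using \<epsilon> c by (auto simp: e_def)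
    obtain B where B: "\<And>m. \<bar>real_of_int (H m) - real m * c\<bar> \<le> e * real m + B"
      using sublinearD[OF H[folded c_def] e(1)] by blast
    have "\<bar>real_of_int (h p - H p)\<bar> \<le> \<epsilon> * real p + 2 * B" for p
    proof -
      obtain s where s: "p \<le> s" "h p = H s" using h_attained by blast
      have "(c - e) * real p \<le> (c - e) * real s" using s(1) e by (intro mult_left_mono) auto
      then have "real p * c - e * real p - B \<le> h p" using B[of s] s(2) by (simp add: algebra_simps)
      moreover have "H p \<le> real p * c + e * real p + B" using B[of p] by linarith
      moreover have "h p \<le> H p" by (rule h_le) simp
      moreover have "2 * (e * real p) \<le> \<epsilon> * real p" using mult_right_mono[OF e(3), of "real p"] by simp
      ultimately show ?thesis by linarith
    qed
    then show "\<exists>B. \<forall>p. \<bar>real_of_int (h p - H p)\<bar> \<le> \<epsilon> * real p + B" by blast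
  qed
  \<comment> \<open>Letters other than 1 have positive total frequency, so the position of the t-th
    of them grows at most linearly.\<close>
  obtain a b where ab: "0 < a" "\<And>t. real (pos t) \<le> a * real t + b"
  proof -
    let ?g = "1 - \<alpha> $ first_letter"
    have g: "0 < ?g" using first_less_1[OF fl \<alpha>] by simp
    have "sublinear (bsum (\<lambda>l. of_bool (l = first_letter) - \<alpha> $ first_letter) v)"
      by (rule freq_seqsD[OF v sum(1) sum_centred_indicator[OF sum(1)]])
    then obtain B where B: "\<And>m. \<bar>bsum (\<lambda>l. of_bool (l = first_letter) - \<alpha> $ first_letter) v m\<bar> \<le> ?g / 2 * real m + B"
      using sublinearD[of _ "?g / 2"] g by (metis half_gt_zero)
    have npos: "bsum (\<lambda>l. of_bool (l = first_letter)) v p = real p - real (npos p)" for p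
      by (induction p) (auto simp: bsum_Suc npos_Suc)
    have *: "\<bar>real p * ?g - real (npos p)\<bar> \<le> ?g / 2 * real p + B" for p
      using B[of p] unfolding bsum_minus_const npos by (simp add: algebra_simps)
    have "real (pos t) \<le> (2 / ?g) * real t + 2 * B / ?g" for t
    proof -
      have "?g / 2 * real (pos t) = real (pos t) * ?g / 2" by simp
      then have "real (pos t) * ?g \<le> 2 * real t + 2 * B"
        using *[of "pos t"] unfolding pos by linarith
      then have "real (pos t) \<le> (2 * real t + 2 * B) / ?g" using g by (simp only: pos_le_divide_eq)
      then show ?thesis by (simp add: add_divide_distrib)
    qed
    then show thesis using g by (intro that[of "2 / ?g" "2 * B / ?g"]) auto
  qed
  show ?thesis unfolding freq_seqs_iff[OF sum(2)]
  proof (intro allI impI)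
    fix \<psi> :: "'k \<Rightarrow> real" assume \<psi>: "(\<Sum>i\<in>UNIV. K \<alpha> $ i * \<psi> i) = 0"
    define D where "D = \<psi> last_letter - \<psi> (prev_letter last_letter)"
    define g where "g l = (if l = first_letter then 0 else \<psi> (prev_letter l))" for l
    define \<eta> where "\<eta> l = (if l = last_letter then real (J \<alpha>) + 1 else if l = first_letter then - 1 else 0)" for l :: 'k
    \<comment> \<open>The weight obtained from \<open>bsum_reduced\<close> on replacing the count of
      unmatched letters by the walk, whose steps are \<open>\<eta>\<close>.\<close>
    define \<phi> where "\<phi> l = g l + D * \<eta> l" for l
    have \<eta>: "bsum \<eta> v m = H m" for m
      by (induction m) (simp_all add: bsum_Suc H_Suc, simp_all add: \<eta>_def walk_def)
    have p12: "\<phi> first_letter = - D" "\<phi> last_letter = \<psi> (prev_letter last_letter) + D * (real (J \<alpha>) + 1)"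
      using fl by (auto simp: \<phi>_def g_def \<eta>_def)
    have "(\<Sum>i\<in>UNIV. K \<alpha> $ i * \<psi> i) = (1 / (1 - \<alpha> $ first_letter)) * (\<Sum>i\<in>UNIV. unKn (J \<alpha>) \<alpha> $ i * \<psi> i)"
      by (simp add: K_def Kn_eq sum_distrib_left mult.assoc sum_divide_distrib)
    then have "(\<Sum>i\<in>UNIV. unKn (J \<alpha>) \<alpha> $ i * \<psi> i) = 0" using \<psi> first_less_1[OF fl \<alpha>] by simp
    moreover have "(\<Sum>i\<in>UNIV - {last_letter, prev_letter last_letter}. unKn (J \<alpha>) \<alpha> $ i * \<psi> i)
      = (\<Sum>i\<in>UNIV - {last_letter, prev_letter last_letter}. \<alpha> $ next_letter i * \<psi> (prev_letter (next_letter i)))"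
      by (intro sum.cong) (auto simp: next_letter_eq_last unKn_next[OF fl] prev_next_letter)
    moreover have "(\<Sum>i\<in>UNIV - {last_letter, prev_letter last_letter}. \<alpha> $ next_letter i * \<psi> (prev_letter (next_letter i)))
      = (\<Sum>i\<in>UNIV - {first_letter, last_letter}. \<alpha> $ i * \<psi> (prev_letter i))"
      by (rule sum_next_letter[OF fl, of "\<lambda>i. \<alpha> $ i * \<psi> (prev_letter i)"])
    moreover have "(\<Sum>i\<in>UNIV - {first_letter, last_letter}. \<alpha> $ i * \<phi> i)
      = (\<Sum>i\<in>UNIV - {first_letter, last_letter}. \<alpha> $ i * \<psi> (prev_letter i))"
      by (intro sum.cong) (auto simp: \<phi>_def g_def \<eta>_def)
    ultimately have "(\<Sum>i\<in>UNIV. \<alpha> $ i * \<phi> i) = 0"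
      unfolding sum_split_last_prev[OF fl, of "\<lambda>i. unKn (J \<alpha>) \<alpha> $ i * \<psi> i"]
        sum_split_first_last[OF fl, of "\<lambda>i. \<alpha> $ i * \<phi> i"] unKn_last[OF fl] unKn_prev_last[OF fl] p12
      by (simp add: D_def algebra_simps)
    then have sub: "sublinear (bsum \<phi> v)" by (rule freq_seqsD[OF v sum(1)])
    have eq: "bsum \<psi> reduced t = bsum \<phi> v (pos t) + D * real_of_int (h (pos t) - H (pos t)) - D * h 0" for t
    proof -
      have "bsum \<phi> v m = bsum g v m + D * bsum \<eta> v m" for m
        by (induction m) (simp_all add: bsum_Suc \<phi>_def algebra_simps)
      then show ?thesis
        using bsum_reduced[of \<psi> "pos t"] unfolding pos \<eta> D_def[symmetric] g_def[symmetric]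
        by (simp add: algebra_simps)
    qed
    show "sublinear (bsum \<psi> reduced)" unfolding sublinear_def
    proof (intro allI impI)
      fix \<epsilon> :: real assume \<epsilon>: "0 < \<epsilon>"
      define e where "e = \<epsilon> / (a * (1 + \<bar>D\<bar>))"
      have e: "0 < e" using \<epsilon> ab(1) by (simp add: e_def)
      obtain B1 where B1: "\<And>m. \<bar>bsum \<phi> v m\<bar> \<le> e * real m + B1" using sublinearD[OF sub e] by blast
      obtain B2 where B2: "\<And>m. \<bar>real_of_int (h m - H m)\<bar> \<le> e * real m + B2" using sublinearD[OF hH e] by blast
      have "\<bar>bsum \<psi> reduced t\<bar> \<le> \<epsilon> * real t + (e * (1 + \<bar>D\<bar>) * b + B1 + \<bar>D\<bar> * B2 + \<bar>D * h 0\<bar>)" for t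
      proof -
        have "\<bar>D * real_of_int (h (pos t) - H (pos t))\<bar> \<le> \<bar>D\<bar> * (e * real (pos t) + B2)"
          unfolding abs_mult by (intro mult_left_mono B2) auto
        then have "\<bar>bsum \<psi> reduced t\<bar> \<le> e * (1 + \<bar>D\<bar>) * real (pos t) + B1 + \<bar>D\<bar> * B2 + \<bar>D * h 0\<bar>"
          using B1[of "pos t"] unfolding eq by (simp add: algebra_simps)
        also have "e * (1 + \<bar>D\<bar>) * real (pos t) \<le> e * (1 + \<bar>D\<bar>) * (a * real t + b)"
          using e by (intro mult_left_mono ab) auto
        also have "\<dots> = \<epsilon> * real t + e * (1 + \<bar>D\<bar>) * b"
        proof -
          have "e * (1 + \<bar>D\<bar>) * a = \<epsilon> * (a * (1 + \<bar>D\<bar>)) / (a * (1 + \<bar>D\<bar>))" by (simp add: e_def)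
          also have "\<dots> = \<epsilon>" using ab(1) by (intro nonzero_mult_div_cancel_right) auto
          finally have "e * (1 + \<bar>D\<bar>) * (a * real t) = \<epsilon> * real t" by (metis mult.assoc)
          then show ?thesis by (simp add: distrib_left)
        qed
        finally show ?thesis by simp
      qed
      then show "\<exists>B. \<forall>t. \<bar>bsum \<psi> reduced t\<bar> \<le> \<epsilon> * real t + B" by blast
    qed
  qed
qed

text \<open>If some k in \<open>v\<close> is not followed by \<open>J \<alpha>\<close> ones, the
  shift to it is already larger. Otherwise \<open>v\<close> is reduced, the hypothesis gives a shift
  of \<open>reduced\<close>, and monotonicity of the substitution carries the bound back to
  \<open>v\<close>.\<close>

lemma shift_ge_subst_seq:
  assumes \<alpha>: "(\<alpha> :: (real, 'k) vec) \<in> \<Delta>" and v: "v \<in> freq_seqs \<alpha>"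
    and X0: "X 0 = last_letter"
    and X: "\<And>u. u \<in> freq_seqs (K \<alpha>) \<Longrightarrow> \<exists>s. lex_le X (\<lambda>j. u (s + j))"
  shows "\<exists>s. lex_le (subst_seq (subst_letter (J \<alpha>)) X) (\<lambda>j. v (s + j))"
proof (cases "\<forall>j d. v j = last_letter \<longrightarrow> 1 \<le> d \<longrightarrow> d \<le> J \<alpha> \<longrightarrow> v (j + d) = first_letter")
  case False
  then obtain j d0 where j: "v j = last_letter" "1 \<le> d0 \<and> d0 \<le> J \<alpha> \<and> v (j + d0) \<noteq> first_letter" by blast
  define d where "d = (LEAST d. 1 \<le> d \<and> d \<le> J \<alpha> \<and> v (j + d) \<noteq> first_letter)"
  have d: "1 \<le> d \<and> d \<le> J \<alpha> \<and> v (j + d) \<noteq> first_letter" unfolding d_def by (rule LeastI, rule j(2))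
  have before: "v (j + e) = first_letter" if "1 \<le> e" "e < d" for e
    using not_less_Least[OF that(2)[unfolded d_def]] that d by auto
  have S: "subst_seq (subst_letter (J \<alpha>)) X e = (if e = 0 then last_letter else first_letter)" if "e \<le> J \<alpha>" for e
    using subst_seq_hd_block[of "subst_letter (J \<alpha>)" e X] that by (simp add: X0 subst_letter_def nth_Cons')
  have "lex_le (subst_seq (subst_letter (J \<alpha>)) X) (\<lambda>e. v (j + e))"
  proof (rule lex_le_strictI[of d])
    show "subst_seq (subst_letter (J \<alpha>)) X e = v (j + e)" if "e < d" for e
      using that d S[of e] before[of e] j(1) by auto
    show "subst_seq (subst_letter (J \<alpha>)) X d < v (j + d)"
      using d S[of d] first_letter_less[of "v (j + d)"] by simp
  qed
  then show ?thesis by blast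
next
  case True
  have sum: "(\<Sum>i\<in>UNIV. \<alpha> $ i) = 1" using \<alpha> by (auto simp: \<Delta>_def)
  define c where "c = (real (J \<alpha>) + 1) * \<alpha> $ last_letter - \<alpha> $ first_letter"
  have c: "0 < c" unfolding c_def using J_bounds[OF fl \<alpha>] by simp
  define \<eta> where "\<eta> l = (if l = last_letter then real (J \<alpha>) + 1 else if l = first_letter then - 1 else 0)" for l :: 'k
  have \<eta>: "bsum \<eta> v m = walk (J \<alpha>) v m" for m
    by (induction m) (simp_all add: bsum_Suc walk_def, simp_all add: \<eta>_def)
  have "(\<Sum>i\<in>UNIV. \<alpha> $ i * \<eta> i) = c"
    unfolding sum_split_first_last[OF fl, of "\<lambda>i. \<alpha> $ i * \<eta> i"] using fl by (simp add: \<eta>_def c_def)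
  then have "(\<Sum>i\<in>UNIV. \<alpha> $ i * (\<eta> i - c)) = 0"
    using sum by (simp add: right_diff_distrib sum_subtractf flip: sum_distrib_right)
  then have "sublinear (bsum (\<lambda>l. \<eta> l - c) v)" by (rule freq_seqsD[OF v sum])
  then have H: "sublinear (\<lambda>m. real_of_int (walk (J \<alpha>) v m) - real m * c)"
    by (simp add: bsum_minus_const[abs_def] \<eta>)
  \<comment> \<open>Taking the drift \<open>c\<close> itself as tolerance leaves the lower bound
    \<open>- B\<close> for the walk.\<close>
  obtain B where B: "\<And>m. \<bar>real_of_int (walk (J \<alpha>) v m) - real m * c\<bar> \<le> c * real m + B"
    using sublinearD[OF H c] by blast
  have "- \<lceil>B\<rceil> \<le> walk (J \<alpha>) v m" for m
  proof -
    have "- B \<le> walk (J \<alpha>) v m" using B[of m] by (simp add: mult.commute)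
    then show ?thesis by linarith
  qed
  then have ew: "excess_walk v (J \<alpha>) \<lceil>B\<rceil>" using fl True by unfold_locales auto
  interpret excess_walk v "J \<alpha>" "\<lceil>B\<rceil>" by (rule ew)
  obtain t where t: "lex_le X (\<lambda>j. reduced (t + j))"
    using X[OF reduced_freq[OF \<alpha> v ew H[unfolded c_def]]] by blast
  \<comment> \<open>As \<open>X\<close> begins with k, the shift found begins with an unmatched k,
    as \<open>subst_reduced_le\<close> requires.\<close>
  then have "last_letter \<le> reduced t" using lex_leD[of X _ 0] X0 by fastforce
  then have "unmatched (pos t)" using reduced_eq_last le_last_letter order.antisym by metis
  then have "lex_le (subst_seq (subst_letter (J \<alpha>)) (\<lambda>j. reduced (t + j))) (\<lambda>j. v (pos t + j))"
    by (rule subst_reduced_le)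
  then show ?thesis using lex_le_trans[OF subst_seq_mono[OF fl t]] by blast
qed

end

section \<open>The infimax sequence\<close>

lemma concat_subst_iter_add: "\<exists>q. concat (map (subst_iter n (r + d)) p) = concat (map (subst_iter n r) q)"
proof (induction d arbitrary: p)
  case (Suc d)
  then show ?case using concat_subst_iter_Suc[of n "r + d" p] by (metis add_Suc_right)
qed auto

lemma subst_iter_ne [simp]: "subst_iter n r a \<noteq> []"
proof (induction r arbitrary: a)
  case (Suc r)
  have "subst_letter (n r) a \<noteq> []" by simp
  then obtain b W where "subst_letter (n r) a = b # W" by (cases "subst_letter (n r) a") auto
  then show ?case using Suc by simp
qed simp

text \<open>Complete blocks are paid for by \<open>\<epsilon>\<close> times their length; only the
  last, incomplete one costs \<open>C\<close>.\<close>

lemma abs_wsum_take_concat_le: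
  assumes "\<And>a. \<bar>wsum \<phi> (f a)\<bar> \<le> \<epsilon> * real (length (f a))"
    and "\<And>a d. \<bar>wsum \<phi> (take d (f a))\<bar> \<le> C" and "0 \<le> \<epsilon>"
    and "m \<le> length (concat (map f q))"
  shows "\<bar>wsum \<phi> (take m (concat (map f q)))\<bar> \<le> \<epsilon> * real m + C"
  using assms(4)
proof (induction q arbitrary: m)
  case Nil
  then show ?case using assms(2)[of 0] by simp
next
  case (Cons a q)
  show ?case
  proof (cases "m \<le> length (f a)")
    case True
    have "0 \<le> \<epsilon> * real m" using assms(3) by simp
    then show ?thesis using True assms(2)[of m a] by simp
  next
    case False
    then have "m - length (f a) \<le> length (concat (map f q))" using Cons.prems by simp
    from Cons.IH[OF this]
    have "\<bar>wsum \<phi> (take (m - length (f a)) (concat (map f q)))\<bar> \<le> \<epsilon> * real (m - length (f a)) + C" .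
    moreover have "\<epsilon> * real (m - length (f a)) = \<epsilon> * real m - \<epsilon> * real (length (f a))"
      using False by (simp add: of_nat_diff right_diff_distrib)
    ultimately show ?thesis using False assms(1)[of a] by simp
  qed
qed

definition run_word :: "real ^ 'k::{finite,linorder} \<Rightarrow> nat \<Rightarrow> nat \<Rightarrow> 'k list"
  where "run_word \<alpha> r N = concat (map (subst_iter (\<Phi> \<alpha>) r) (replicate N last_letter))"

context
  assumes fl: "first_letter \<noteq> (last_letter :: 'k::{finite,linorder})"
begin

lemma Phi_K: "\<Phi> (K \<alpha>) = (\<lambda>j. \<Phi> (\<alpha> :: (real, 'k) vec) (Suc j))"
  by (simp add: \<Phi>_def funpow_swap1)

lemma Phi_0: "\<Phi> (\<alpha> :: (real, 'k) vec) 0 = J \<alpha>"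
  by (simp add: \<Phi>_def)

lemma Phi_K_pow: "\<Phi> ((K ^^ r) \<alpha>) = (\<lambda>j. \<Phi> (\<alpha> :: (real, 'k) vec) (r + j))"
  by (simp add: \<Phi>_def fun_eq_iff funpow_add add.commute[of r])

lemma subst_seq_iter_0: "(w :: nat \<Rightarrow> 'k) 0 = last_letter \<Longrightarrow> subst_seq_iter n r w 0 = last_letter"
  by (induction r arbitrary: w) (simp_all add: subst_seq_0 hd_subst_letter)

lemma shift_ge_subst_seq_iter:
  assumes "(\<alpha> :: (real, 'k) vec) \<in> \<Delta>" "X 0 = last_letter"
    and "\<And>u. u \<in> freq_seqs ((K ^^ r) \<alpha>) \<Longrightarrow> \<exists>s. lex_le X (\<lambda>j. u (s + j))"
    and "v \<in> freq_seqs \<alpha>"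
  shows "\<exists>s. lex_le (subst_seq_iter (\<Phi> \<alpha>) r X) (\<lambda>j. v (s + j))"
  using assms(1,3,4)
proof (induction r arbitrary: \<alpha> v)
  case (Suc r)
  have "\<exists>s. lex_le (subst_seq_iter (\<Phi> (K \<alpha>)) r X) (\<lambda>j. u (s + j))" if "u \<in> freq_seqs (K \<alpha>)" for u
    by (rule Suc.IH[OF K_in_Delta[OF fl Suc.prems(1)] _ that]) (use Suc.prems(2) in \<open>simp add: funpow_swap1\<close>)
  from shift_ge_subst_seq[OF fl Suc.prems(1) Suc.prems(3) subst_seq_iter_0[of X, OF assms(2)] this]
  show ?case unfolding subst_seq_iter_Suc2 Phi_K Phi_0 by blast
qed simp

lemma maximal_freq_seqs_0:
  assumes "(\<beta> :: (real, 'k) vec) \<in> \<Delta>" "w \<in> maximal_freq_seqs \<beta>" shows "w 0 = last_letter"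
  using assms forces_run_1[OF assms(1)] maximal_0 unfolding forces_run_def maximal_freq_seqs_def
  by (metis IntD1 IntD2 add_0_right less_one)

lemma subst_seq_iter_maximal_freq:
  assumes \<alpha>: "(\<alpha> :: (real, 'k) vec) \<in> \<Delta>" and "w \<in> maximal_freq_seqs ((K ^^ r) \<alpha>)"
  shows "subst_seq_iter (\<Phi> \<alpha>) r w \<in> maximal_freq_seqs \<alpha>"
  using assms(2)
proof (induction r arbitrary: w)
  case (Suc r)
  let ?\<beta> = "(K ^^ r) \<alpha>"
  have \<beta>: "?\<beta> \<in> \<Delta>" "K ?\<beta> \<in> \<Delta>" using K_pow_in_Delta[OF fl \<alpha>, of r] K_in_Delta[OF fl] by auto
  have w: "w \<in> maximal_seqs" "w \<in> freq_seqs (K ?\<beta>)" "w \<in> maximal_freq_seqs (K ?\<beta>)"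
    using Suc.prems by (auto simp: maximal_freq_seqs_def)
  have "subst_seq (subst_letter (J ?\<beta>)) w \<in> maximal_freq_seqs ?\<beta>"
    using subst_seq_maximal(1)[OF fl w(1) maximal_freq_seqs_0[OF \<beta>(2) w(3)]] subst_seq_freq[OF fl \<beta>(1) w(2)]
    by (simp add: maximal_freq_seqs_def)
  then show ?case using Suc.IH by (simp add: \<Phi>_def)
qed simp

text \<open>A maximal sequence containing k^N begins with it, because no sequence with another
  prefix of this length is as large.\<close>

lemma run_word_attained:
  assumes \<alpha>: "(\<alpha> :: (real, 'k) vec) \<in> \<Delta>" and run: "forces_run ((K ^^ r) \<alpha>) N"
  shows "\<exists>w\<in>maximal_freq_seqs \<alpha>. has_prefix (run_word \<alpha> r N) w"
proof -
  obtain w where w: "w \<in> maximal_freq_seqs ((K ^^ r) \<alpha>)"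
    using maximal_freq_seqs_nonempty[OF K_pow_in_Delta[OF fl \<alpha>, of r]] by blast
  then obtain s where s: "\<And>j. j < N \<Longrightarrow> w (s + j) = last_letter"
    using run by (auto simp: forces_run_def maximal_freq_seqs_def)
  have le: "lex_le (\<lambda>j. w (s + j)) w" using w by (simp add: maximal_freq_seqs_def maximal_seqs_iff)
  have "w j = last_letter" if "j < N" for j
    using that
  proof (induction j rule: less_induct)
    case (less j)
    then have "w (s + j) \<le> w j" using s by (intro lex_leD[OF le]) auto
    then show ?case using s[OF less.prems] le_last_letter[of "w j"] by auto
  qed
  then have "has_prefix (replicate N last_letter) w" by (simp add: has_prefix_def)
  then show ?thesis
    unfolding run_word_def
    using has_prefix_subst_seq_iter subst_seq_iter_maximal_freq[OF \<alpha> w] by blast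
qed

lemma run_word_lower_bound:
  assumes \<alpha>: "(\<alpha> :: (real, 'k) vec) \<in> \<Delta>" and run: "forces_run ((K ^^ r) \<alpha>) N" and N: "0 < N"
    and w: "w \<in> maximal_freq_seqs \<alpha>"
  shows "\<exists>x. has_prefix (run_word \<alpha> r N) x \<and> lex_le x w"
proof -
  \<comment> \<open>The least sequence with prefix k^N, hence below the shift of \<open>u\<close> to
    any such run.\<close>
  define X :: "nat \<Rightarrow> 'k" where "X = (\<lambda>j. if j < N then last_letter else first_letter)"
  have "\<exists>s. lex_le X (\<lambda>j. u (s + j))" if u: "u \<in> freq_seqs ((K ^^ r) \<alpha>)" for u
  proof -
    obtain s where "\<And>j. j < N \<Longrightarrow> u (s + j) = last_letter" using run u by (auto simp: forces_run_def)
    then have "lex_le X (\<lambda>j. u (s + j))" unfolding lex_le_iff X_def by auto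
    then show ?thesis by blast
  qed
  moreover have "X 0 = last_letter" using N by (simp add: X_def)
  moreover have "w \<in> freq_seqs \<alpha>" using w by (simp add: maximal_freq_seqs_def)
  ultimately obtain s where "lex_le (subst_seq_iter (\<Phi> \<alpha>) r X) (\<lambda>j. w (s + j))"
    using shift_ge_subst_seq_iter[OF \<alpha>] by blast
  moreover have "lex_le (\<lambda>j. w (s + j)) w" using w by (simp add: maximal_freq_seqs_def maximal_seqs_iff)
  ultimately have "lex_le (subst_seq_iter (\<Phi> \<alpha>) r X) w" by (rule lex_le_trans)
  moreover have "has_prefix (run_word \<alpha> r N) (subst_seq_iter (\<Phi> \<alpha>) r X)"
    unfolding run_word_def by (rule has_prefix_subst_seq_iter) (simp add: has_prefix_def X_def)
  ultimately show ?thesis by blast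
qed

text \<open>With digits 0 the total mass and the last coordinate both fall by the first coordinate,
  so the mass of the other coordinates is conserved; it also tends to 0.\<close>

lemma itinerary_0_eq_axis:
  assumes \<beta>: "(\<beta> :: (real, 'k) vec) \<in> \<Delta>" and "\<Phi> \<beta> = (\<lambda>_. 0)"
  shows "\<beta> = axis last_letter 1"
proof -
  let ?n = "\<lambda>_ :: nat. 0 :: nat"
  have cone: "\<beta> \<in> itin_cone ?n" using Delta_in_itin_cell[OF fl \<beta>] assms(2) by (simp add: itin_cell_def)
  define p where "p r = (\<Sum>i\<in>UNIV - {last_letter}. unK ?n r \<beta> $ i)" for r
  have p: "p r = (\<Sum>i\<in>UNIV. unK ?n r \<beta> $ i) - unK ?n r \<beta> $ last_letter" for r
    unfolding p_def by (simp add: sum.remove[of UNIV last_letter])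
  have "p (Suc r) = p r" for r
    unfolding p sum_unK_Suc[OF fl] by (simp add: unKn_last[OF fl])
  then have const: "p r = p 0" for r by (induction r) auto
  have "p \<longlonglongrightarrow> (\<Sum>i\<in>UNIV - {last_letter :: 'k}. 0)"
    unfolding p_def by (intro tendsto_sum unK_tendsto_0[OF fl cone]) auto
  moreover have "p = (\<lambda>_. p 0)" using const by blast
  ultimately have "(\<lambda>_ :: nat. p 0) \<longlonglongrightarrow> 0" by (metis sum.neutral_const)
  then have "p 0 = 0" by (simp add: LIMSEQ_const_iff)
  then have "\<forall>i\<in>UNIV - {last_letter}. \<beta> $ i = 0"
    using \<beta> unfolding p_def by (subst (asm) sum_nonneg_eq_0_iff) (auto simp: \<Delta>_def)
  moreover from this have "\<beta> $ last_letter = 1"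
    using \<beta> by (simp add: \<Delta>_def sum.remove[of UNIV last_letter])
  ultimately show ?thesis by (auto simp: vec_eq_iff axis_def)
qed

text \<open>Each nonzero digit lengthens the image of k, so infinitely many of them allow
  \<open>N = 1\<close>. Otherwise the iterate is eventually the vertex, which forces runs of every
  length.\<close>

lemma run_word_long:
  assumes \<alpha>: "(\<alpha> :: (real, 'k) vec) \<in> \<Delta>"
  shows "\<exists>R. \<forall>r\<ge>R. \<exists>N>0. forces_run ((K ^^ r) \<alpha>) N \<and> m \<le> length (run_word \<alpha> r N)"
proof (cases "\<exists>R. \<forall>r\<ge>R. \<Phi> \<alpha> r = 0")
  case True
  then obtain R where R: "\<And>r. R \<le> r \<Longrightarrow> \<Phi> \<alpha> r = 0" by blast
  show ?thesis
  proof (rule exI[of _ R], intro allI impI)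
    fix r assume r: "R \<le> r"
    have "\<Phi> ((K ^^ r) \<alpha>) = (\<lambda>_. 0)" using R r by (simp add: Phi_K_pow)
    then have axis: "(K ^^ r) \<alpha> = axis last_letter 1" by (rule itinerary_0_eq_axis[OF K_pow_in_Delta[OF fl \<alpha>]])
    have "N \<le> length (run_word \<alpha> r N)" for N
    proof (induction N)
      case (Suc N)
      have "length (run_word \<alpha> r (Suc N)) =
          length (subst_iter (\<Phi> \<alpha>) r (last_letter :: 'k)) + length (run_word \<alpha> r N)"
        by (simp add: run_word_def)
      moreover have "0 < length (subst_iter (\<Phi> \<alpha>) r (last_letter :: 'k))" by simp
      ultimately show ?case using Suc by linarith
    qed simp
    then have "m \<le> length (run_word \<alpha> r (Suc m))" by (rule Suc_leD)
    then show "\<exists>N>0. forces_run ((K ^^ r) \<alpha>) N \<and> m \<le> length (run_word \<alpha> r N)"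
      by (intro exI[of _ "Suc m"]) (simp add: axis forces_run_axis)
  qed
next
  case False
  define l where "l r = length (subst_iter (\<Phi> \<alpha>) r (last_letter :: 'k))" for r
  have l_Suc: "l r + \<Phi> \<alpha> r \<le> l (Suc r)" for r
  proof -
    have "N \<le> length (concat (map (subst_iter (\<Phi> \<alpha>) r) (replicate N (first_letter :: 'k))))" for N
    proof (induction N)
      case (Suc N)
      have "length (concat (map (subst_iter (\<Phi> \<alpha>) r) (replicate (Suc N) (first_letter :: 'k)))) =
          length (subst_iter (\<Phi> \<alpha>) r (first_letter :: 'k)) +
          length (concat (map (subst_iter (\<Phi> \<alpha>) r) (replicate N (first_letter :: 'k))))"
        by simp
      moreover have "0 < length (subst_iter (\<Phi> \<alpha>) r (first_letter :: 'k))" by simp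
      ultimately show ?case using Suc by linarith
    qed simp
    then show ?thesis by (simp add: l_def subst_letter_def)
  qed
  have l_mono: "l r \<le> l s" if "r \<le> s" for r s
    using that by (rule lift_Suc_mono_le[rotated]) (use l_Suc in \<open>metis add_leE\<close>)
  have "\<exists>R. m \<le> l R"
  proof (induction m)
    case (Suc m)
    then obtain R where R: "m \<le> l R" by blast
    obtain r where r: "R \<le> r" "\<Phi> \<alpha> r \<noteq> 0" using False by blast
    then have "Suc m \<le> l (Suc r)" using R l_mono[OF r(1)] l_Suc[of r] by linarith
    then show ?case by blast
  qed auto
  then obtain R where R: "m \<le> l R" by blast
  show ?thesis
  proof (rule exI[of _ R], intro allI impI exI[of _ 1] conjI)
    fix r assume "R \<le> r"
    then show "m \<le> length (run_word \<alpha> r 1)" using R l_mono[of R r] by (simp add: run_word_def l_def)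
    show "forces_run ((K ^^ r) \<alpha>) 1" by (rule forces_run_1[OF K_pow_in_Delta[OF fl \<alpha>]])
  qed simp
qed

text \<open>Each word is a prefix of some member of \<open>maximal_freq_seqs \<alpha>\<close> and
  begins a lower bound for the member starting with the other, so at a first difference both
  inequalities would hold.\<close>

lemma run_words_agree:
  assumes \<alpha>: "(\<alpha> :: (real, 'k) vec) \<in> \<Delta>"
    and "forces_run ((K ^^ r) \<alpha>) N" "0 < N" "forces_run ((K ^^ r') \<alpha>) N'" "0 < N'"
    and "j < length (run_word \<alpha> r N)" "j < length (run_word \<alpha> r' N')"
  shows "run_word \<alpha> r N ! j = run_word \<alpha> r' N' ! j"
proof -
  let ?p = "run_word \<alpha> r N" and ?p' = "run_word \<alpha> r' N'"
  obtain w where w: "w \<in> maximal_freq_seqs \<alpha>" "has_prefix ?p w"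
    using run_word_attained[OF \<alpha> assms(2)] by blast
  obtain w' where w': "w' \<in> maximal_freq_seqs \<alpha>" "has_prefix ?p' w'"
    using run_word_attained[OF \<alpha> assms(4)] by blast
  obtain x where x: "has_prefix ?p x" "lex_le x w'"
    using run_word_lower_bound[OF \<alpha> assms(2,3) w'(1)] by blast
  obtain x' where x': "has_prefix ?p' x'" "lex_le x' w"
    using run_word_lower_bound[OF \<alpha> assms(4,5) w(1)] by blast
  show ?thesis using assms(6,7)
  proof (induction j rule: less_induct)
    case (less j)
    have eq: "?p ! i = ?p' ! i" if "i < j" for i using less that by auto
    have "x j \<le> w' j" using x w' eq less.prems by (intro lex_leD[OF x(2)]) (auto simp: has_prefix_def)
    moreover have "x' j \<le> w j" using x' w eq less.prems by (intro lex_leD[OF x'(2)]) (auto simp: has_prefix_def)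
    ultimately show ?case using less.prems x(1) x'(1) w(2) w'(2) by (simp add: has_prefix_def)
  qed
qed

lemma infimax_props:
  assumes \<alpha>: "(\<alpha> :: (real, 'k) vec) \<in> \<Delta>"
  shows "forces_run ((K ^^ r) \<alpha>) N \<Longrightarrow> 0 < N \<Longrightarrow> has_prefix (run_word \<alpha> r N) (infimax \<alpha>)"
    and "\<exists>w\<in>maximal_freq_seqs \<alpha>. \<forall>j<m. w j = infimax \<alpha> j"
proof -
  have ex: "\<forall>m. \<exists>p. \<exists>r N. 0 < N \<and> forces_run ((K ^^ r) \<alpha>) N \<and> m < length p \<and> p = run_word \<alpha> r N"
  proof
    fix m
    obtain R where "\<forall>r\<ge>R. \<exists>N>0. forces_run ((K ^^ r) \<alpha>) N \<and> Suc m \<le> length (run_word \<alpha> r N)"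
      using run_word_long[OF \<alpha>] by blast
    then obtain N where "0 < N" "forces_run ((K ^^ R) \<alpha>) N" "m < length (run_word \<alpha> R N)"
      by (auto simp: Suc_le_eq)
    then show "\<exists>p. \<exists>r N. 0 < N \<and> forces_run ((K ^^ r) \<alpha>) N \<and> m < length p \<and> p = run_word \<alpha> r N" by blast
  qed
  obtain p where p: "\<And>m. \<exists>r N. 0 < N \<and> forces_run ((K ^^ r) \<alpha>) N \<and> m < length (p m) \<and> p m = run_word \<alpha> r N"
    using choice[OF ex] by blast
  define S where "S m = p m ! m" for m
  have pre: "has_prefix (run_word \<alpha> r N) S" if "forces_run ((K ^^ r) \<alpha>) N" "0 < N" for r N
    unfolding has_prefix_def S_def using p run_words_agree[OF \<alpha> _ _ that] by metis
  have att: "\<exists>w\<in>maximal_freq_seqs \<alpha>. \<forall>j<m. w j = S j" for m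
  proof -
    obtain r N where rN: "0 < N" "forces_run ((K ^^ r) \<alpha>) N" "m < length (run_word \<alpha> r N)" using p by metis
    obtain w where "w \<in> maximal_freq_seqs \<alpha>" "has_prefix (run_word \<alpha> r N) w"
      using run_word_attained[OF \<alpha> rN(2)] by blast
    then show ?thesis using pre[OF rN(2,1)] rN(3) by (intro bexI[of _ w]) (auto simp: has_prefix_def)
  qed
  have low: "lex_le S w" if w: "w \<in> maximal_freq_seqs \<alpha>" for w
    unfolding lex_le_iff
  proof (intro allI impI)
    fix m assume eq: "\<forall>j<m. S j = w j"
    obtain r N where rN: "0 < N" "forces_run ((K ^^ r) \<alpha>) N" "m < length (run_word \<alpha> r N)" using p by metis
    obtain x where x: "has_prefix (run_word \<alpha> r N) x" "lex_le x w"
      using run_word_lower_bound[OF \<alpha> rN(2,1) w] by blast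
    have "x j = S j" if "j \<le> m" for j using x(1) pre[OF rN(2,1)] rN(3) that by (simp add: has_prefix_def)
    then show "S m \<le> w m" using lex_leD[OF x(2), of m] eq by simp
  qed
  have "infimax \<alpha> = S" unfolding infimax_def by (rule lex_inf_eqI[OF low att])
  then show "forces_run ((K ^^ r) \<alpha>) N \<Longrightarrow> 0 < N \<Longrightarrow> has_prefix (run_word \<alpha> r N) (infimax \<alpha>)"
    "\<exists>w\<in>maximal_freq_seqs \<alpha>. \<forall>j<m. w j = infimax \<alpha> j" using pre att by auto
qed

lemma infimax_maximal:
  assumes \<alpha>: "(\<alpha> :: (real, 'k) vec) \<in> \<Delta>" shows "infimax \<alpha> \<in> maximal_seqs"
  unfolding maximal_seqs_iff lex_le_iff
proof (intro allI impI)
  fix r m assume eq: "\<forall>j<m. infimax \<alpha> (r + j) = infimax \<alpha> j"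
  obtain w where w: "w \<in> maximal_freq_seqs \<alpha>" "\<And>j. j < Suc (r + m) \<Longrightarrow> w j = infimax \<alpha> j"
    using infimax_props(2)[OF \<alpha>, of "Suc (r + m)"] by blast
  have "lex_le (\<lambda>j. w (r + j)) w" using w(1) by (simp add: maximal_freq_seqs_def maximal_seqs_iff)
  then have "w (r + m) \<le> w m" by (rule lex_leD) (use eq w(2) in auto)
  then show "infimax \<alpha> (r + m) \<le> infimax \<alpha> m" using w(2) by simp
qed

text \<open>By duality \<open>subst_iter n r l\<close> has frequencies in the cell cut off by \<^term>\<open>cone_upto n r\<close>, and these
  cells shrink to the fibre.\<close>

lemma subst_iter_uniform_freq:
  assumes cell: "itin_cell n = {\<alpha> :: (real, 'k) vec}" and \<phi>: "(\<Sum>i\<in>UNIV. \<alpha> $ i * \<phi> i) = 0" and \<epsilon>: "0 < \<epsilon>"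
  shows "\<exists>r. \<forall>l. \<bar>wsum \<phi> (subst_iter n r l)\<bar> \<le> \<epsilon> * real (length (subst_iter n r l))"
proof -
  define F where "F r = cone_upto n r \<inter> {\<beta> :: (real, 'k) vec. (\<Sum>i\<in>UNIV. \<beta> $ i) \<le> 1} \<inter>
    ({\<beta>. (\<Sum>i\<in>UNIV. \<beta> $ i) = 1} \<inter> {\<beta>. \<epsilon> \<le> \<bar>\<Sum>i\<in>UNIV. \<beta> $ i * \<phi> i\<bar>})" for r
  have "compact (F r)" for r
    unfolding F_def by (intro compact_Int_closed[OF compact_cone_upto[OF fl]] closed_Int closed_Collect_le
        closed_Collect_eq continuous_intros)
  moreover have "F s \<subseteq> F r" if "r \<le> s" for r s
    using cone_upto_antimono[OF fl that, of n] by (auto simp: F_def)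
  moreover have "\<Inter>(range F) = {}"
  proof -
    have "False" if "\<And>r. \<beta> \<in> F r" for \<beta>
    proof -
      have "\<beta> \<in> itin_cell n" using that by (auto simp: F_def itin_cell_def itin_cone_def)
      then show False using that[of 0] cell \<phi> \<epsilon> by (simp add: F_def)
    qed
    then show ?thesis by blast
  qed
  ultimately obtain r where r: "F r = {}" using compact_nest[of F] by metis
  have "\<bar>wsum \<phi> (subst_iter n r l)\<bar> \<le> \<epsilon> * real (length (subst_iter n r l))" for l
  proof -
    let ?L = "real (length (subst_iter n r l))"
    have L: "0 < ?L" by simp
    obtain \<beta> :: "(real, 'k) vec" where \<beta>: "unK n r \<beta> = axis l (1 / ?L)" using surj_unK[OF fl] by (metis surjD)
    have dual: "(\<Sum>i\<in>UNIV. \<beta> $ i * \<psi> i) = wsum \<psi> (subst_iter n r l) / ?L" for \<psi>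
    proof -
      have "(\<Sum>i\<in>UNIV. axis l (1 / ?L) $ i * wsum \<psi> (subst_iter n r i))
        = (\<Sum>i\<in>UNIV. if i = l then 1 / ?L * wsum \<psi> (subst_iter n r i) else 0)"
        by (intro sum.cong) (auto simp: axis_def)
      then show ?thesis using unK_duality[OF fl, of n r \<beta> \<psi>] unfolding \<beta> by simp
    qed
    have "\<beta> \<in> cone_upto n r" by (simp add: cone_upto_def \<beta> axis_def)
    moreover have "(\<Sum>i\<in>UNIV. \<beta> $ i) = 1" using dual[of "\<lambda>_. 1"] L by (simp add: wsum_one)
    moreover have "\<beta> \<notin> F r" using r by blast
    ultimately have "\<bar>wsum \<phi> (subst_iter n r l) / ?L\<bar> < \<epsilon>" unfolding dual[symmetric] by (simp add: F_def)
    then show ?thesis using L by (simp add: divide_less_eq)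
  qed
  then show ?thesis by blast
qed

lemma infimax_freq:
  assumes \<alpha>: "(\<alpha> :: (real, 'k) vec) \<in> \<Delta>" and cell: "itin_cell (\<Phi> \<alpha>) = {\<alpha>}"
  shows "infimax \<alpha> \<in> freq_seqs \<alpha>"
proof -
  have sum: "(\<Sum>i\<in>UNIV. \<alpha> $ i) = 1" using \<alpha> by (simp add: \<Delta>_def)
  show ?thesis unfolding freq_seqs_iff[OF sum] sublinear_def
  proof (intro allI impI)
    fix \<phi> :: "'k \<Rightarrow> real" and \<epsilon> :: real
    assume \<phi>: "(\<Sum>i\<in>UNIV. \<alpha> $ i * \<phi> i) = 0" and \<epsilon>: "0 < \<epsilon>"
    obtain r where r: "\<And>l. \<bar>wsum \<phi> (subst_iter (\<Phi> \<alpha>) r l)\<bar> \<le> \<epsilon> * real (length (subst_iter (\<Phi> \<alpha>) r l))"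
      using subst_iter_uniform_freq[OF cell \<phi> \<epsilon>] by blast
    define L where "L = Max (range (\<lambda>l. length (subst_iter (\<Phi> \<alpha>) r (l :: 'k))))"
    define C where "C = (\<Sum>i\<in>UNIV. \<bar>\<phi> i\<bar>) * real L"
    have C: "\<bar>wsum \<phi> (take d (subst_iter (\<Phi> \<alpha>) r l))\<bar> \<le> C" for d l
    proof -
      have "length (take d (subst_iter (\<Phi> \<alpha>) r l)) \<le> length (subst_iter (\<Phi> \<alpha>) r l)" by simp
      also have "\<dots> \<le> L" unfolding L_def by (rule Max_ge) auto
      finally have "(\<Sum>i\<in>UNIV. \<bar>\<phi> i\<bar>) * real (length (take d (subst_iter (\<Phi> \<alpha>) r l))) \<le> C"
        unfolding C_def by (intro mult_left_mono) (auto simp: sum_nonneg)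
      then show ?thesis using abs_wsum_le order_trans by blast
    qed
    have "\<bar>bsum \<phi> (infimax \<alpha>) m\<bar> \<le> \<epsilon> * real m + C" for m
    proof -
      obtain R where R: "\<forall>r\<ge>R. \<exists>N>0. forces_run ((K ^^ r) \<alpha>) N \<and> m \<le> length (run_word \<alpha> r N)"
        using run_word_long[OF \<alpha>] by blast
      then obtain N where N: "0 < N" "forces_run ((K ^^ (r + R)) \<alpha>) N" "m \<le> length (run_word \<alpha> (r + R) N)"
        by (metis le_add2)
      obtain q where q: "run_word \<alpha> (r + R) N = concat (map (subst_iter (\<Phi> \<alpha>) r) q)"
        unfolding run_word_def using concat_subst_iter_add by blast
      have "map (infimax \<alpha>) [0..<m] = take m (run_word \<alpha> (r + R) N)"
        using infimax_props(1)[OF \<alpha> N(2,1)] N(3) by (intro nth_equalityI) (auto simp: has_prefix_def)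
      then show ?thesis
        unfolding bsum_eq_wsum q using abs_wsum_take_concat_le[OF r C, where m = m and q = q] \<epsilon> N(3) q by simp
    qed
    then show "\<exists>C. \<forall>m. \<bar>bsum \<phi> (infimax \<alpha>) m\<bar> \<le> \<epsilon> * real m + C" by blast
  qed
qed

lemma wsum_subst_iter_bound:
  assumes \<alpha>: "(\<alpha> :: (real, 'k) vec) \<in> \<Delta>" and freq: "infimax \<alpha> \<in> freq_seqs \<alpha>"
    and \<phi>: "(\<Sum>i\<in>UNIV. \<alpha> $ i * \<phi> i) = 0" and \<epsilon>: "0 < \<epsilon>"
  shows "\<exists>R C. 0 \<le> C \<and> (\<forall>r\<ge>R. \<forall>l. \<bar>wsum \<phi> (subst_iter (\<Phi> \<alpha>) r l)\<bar>
    \<le> \<epsilon> * real (length (subst_iter (\<Phi> \<alpha>) r l)) + (if l = last_letter then 0 else C))"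
proof -
  let ?W = "subst_iter (\<Phi> \<alpha>) :: nat \<Rightarrow> 'k \<Rightarrow> 'k list"
  have sum: "(\<Sum>i\<in>UNIV. \<alpha> $ i) = 1" using \<alpha> by (simp add: \<Delta>_def)
  obtain B where B: "0 \<le> B" "\<And>m. \<bar>bsum \<phi> (infimax \<alpha>) m\<bar> \<le> \<epsilon> / 2 * real m + B"
    using sublinearD[OF freq_seqsD[OF freq sum \<phi>], of "\<epsilon> / 2"] \<epsilon> by auto
  obtain m0 :: nat where "2 * B / \<epsilon> < real m0" using reals_Archimedean2 by blast
  then have m0: "B < \<epsilon> / 2 * real m0" using \<epsilon> by (simp add: field_simps)
  obtain R where R: "\<And>r. R \<le> r \<Longrightarrow> \<exists>N>0. forces_run ((K ^^ r) \<alpha>) N \<and> m0 \<le> length (run_word \<alpha> r N)"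
    using run_word_long[OF \<alpha>] by blast
  have last: "\<bar>wsum \<phi> (?W r last_letter)\<bar> \<le> \<epsilon> * real (length (?W r last_letter))" if "R \<le> r" for r
  proof -
    obtain N where N: "0 < N" "forces_run ((K ^^ r) \<alpha>) N" "m0 \<le> length (run_word \<alpha> r N)"
      using R[OF \<open>R \<le> r\<close>] by blast
    let ?p = "run_word \<alpha> r N"
    have "map (infimax \<alpha>) [0..<length ?p] = ?p"
      using infimax_props(1)[OF \<alpha> N(2,1)] by (intro nth_equalityI) (auto simp: has_prefix_def)
    then have "\<bar>wsum \<phi> ?p\<bar> \<le> \<epsilon> / 2 * real (length ?p) + B" using B(2)[of "length ?p"] by (simp add: bsum_eq_wsum)
    moreover have "\<epsilon> / 2 * real m0 \<le> \<epsilon> / 2 * real (length ?p)" using N(3) \<epsilon> by (intro mult_left_mono) auto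
    ultimately have "\<bar>wsum \<phi> ?p\<bar> \<le> \<epsilon> * real (length ?p)" using m0 by linarith
    moreover have "wsum \<phi> ?p = real N * wsum \<phi> (?W r last_letter)"
      unfolding run_word_def wsum_concat by simp
    moreover have "length ?p = N * length (?W r last_letter)"
      by (simp add: run_word_def length_concat sum_list_replicate)
    ultimately have "real N * \<bar>wsum \<phi> (?W r last_letter)\<bar> \<le> real N * (\<epsilon> * real (length (?W r last_letter)))"
      by (simp add: abs_mult mult.left_commute)
    then show ?thesis using N(1) by simp
  qed
  define C where "C = (\<Sum>l\<in>UNIV. \<bar>wsum \<phi> (?W R l)\<bar>)"
  have C: "0 \<le> C" by (simp add: C_def sum_nonneg)
  have "\<bar>wsum \<phi> (?W r l)\<bar> \<le> \<epsilon> * real (length (?W r l)) + (if l = last_letter then 0 else C)" if "R \<le> r" for r l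
    using that
  proof (induction r arbitrary: l rule: dec_induct)
    case base
    have "\<bar>wsum \<phi> (?W R l)\<bar> \<le> C" unfolding C_def by (rule member_le_sum) auto
    moreover have "0 \<le> \<epsilon> * real (length (?W R l))" using \<epsilon> by simp
    ultimately show ?case using last[of R] by auto
  next
    case (step r)
    consider "l = last_letter" | "l \<noteq> last_letter" "next_letter l \<noteq> last_letter"
      | "l \<noteq> last_letter" "next_letter l = last_letter" by blast
    then show ?case
    proof cases
      case 1
      then show ?thesis using last[of "Suc r"] step by simp
    next
      case 2
      then show ?thesis using step(3)[of "next_letter l"] by (simp add: subst_letter_def)
    next
      case 3
      then have W: "?W (Suc r) l = ?W r last_letter @ ?W r first_letter @
          concat (map (?W r) (replicate (\<Phi> \<alpha> r) first_letter))"
        by (simp add: subst_letter_def)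
      have Wl: "?W (Suc r) last_letter = ?W r last_letter @
          concat (map (?W r) (replicate (\<Phi> \<alpha> r) first_letter))"
        by (simp add: subst_letter_def)
      have "wsum \<phi> (?W (Suc r) l) = wsum \<phi> (?W (Suc r) last_letter) + wsum \<phi> (?W r first_letter)"
        and "length (?W (Suc r) l) = length (?W (Suc r) last_letter) + length (?W r first_letter)"
        unfolding W Wl by simp_all
      moreover have "\<bar>wsum \<phi> (?W (Suc r) last_letter)\<bar> \<le> \<epsilon> * real (length (?W (Suc r) last_letter))"
        by (rule last) (use step in simp)
      moreover have "\<bar>wsum \<phi> (?W r first_letter)\<bar> \<le> \<epsilon> * real (length (?W r first_letter)) + C"
        using step(3)[of first_letter] fl by simp
      ultimately show ?thesis using 3(1) by (simp add: distrib_left del: subst_iter.simps)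
    qed
  qed
  then show ?thesis using C by blast
qed

lemma itin_cell_eq_singleton:
  assumes \<alpha>: "(\<alpha> :: (real, 'k) vec) \<in> \<Delta>" and freq: "infimax \<alpha> \<in> freq_seqs \<alpha>"
  shows "itin_cell (\<Phi> \<alpha>) = {\<alpha>}"
proof -
  have sum: "(\<Sum>i\<in>UNIV. \<alpha> $ i) = 1" using \<alpha> by (simp add: \<Delta>_def)
  have "\<beta> = \<alpha>" if \<beta>: "\<beta> \<in> itin_cell (\<Phi> \<alpha>)" for \<beta>
  proof -
    have cone: "\<beta> \<in> itin_cone (\<Phi> \<alpha>)" and sum\<beta>: "(\<Sum>i\<in>UNIV. \<beta> $ i) = 1" using \<beta> by (auto simp: itin_cell_def)
    have zero: "(\<Sum>i\<in>UNIV. \<beta> $ i * \<phi> i) = 0" if \<phi>: "(\<Sum>i\<in>UNIV. \<alpha> $ i * \<phi> i) = 0" for \<phi>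
    proof -
      let ?x = "\<Sum>i\<in>UNIV. \<beta> $ i * \<phi> i"
      have "\<bar>?x\<bar> \<le> 0 + \<epsilon>" if \<epsilon>: "0 < \<epsilon>" for \<epsilon>
      proof -
        obtain R C where R: "\<And>r l. R \<le> r \<Longrightarrow> \<bar>wsum \<phi> (subst_iter (\<Phi> \<alpha>) r l)\<bar>
            \<le> \<epsilon> * real (length (subst_iter (\<Phi> \<alpha>) r l)) + (if l = last_letter then 0 else C)"
          using wsum_subst_iter_bound[OF \<alpha> freq \<phi> \<epsilon>] by blast
        let ?e = "\<lambda>r. \<epsilon> + (\<Sum>i\<in>UNIV - {last_letter}. unK (\<Phi> \<alpha>) r \<beta> $ i * C)"
        have "\<bar>?x\<bar> \<le> ?e r" if "R \<le> r" for r
        proof -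
          have "?x = (\<Sum>i\<in>UNIV. unK (\<Phi> \<alpha>) r \<beta> $ i * wsum \<phi> (subst_iter (\<Phi> \<alpha>) r i))"
            by (rule unK_duality[OF fl, symmetric])
          then have "\<bar>?x\<bar> \<le> (\<Sum>i\<in>UNIV. \<bar>unK (\<Phi> \<alpha>) r \<beta> $ i * wsum \<phi> (subst_iter (\<Phi> \<alpha>) r i)\<bar>)"
            by (metis sum_abs)
          also have "\<dots> \<le> (\<Sum>i\<in>UNIV. unK (\<Phi> \<alpha>) r \<beta> $ i *
              (\<epsilon> * real (length (subst_iter (\<Phi> \<alpha>) r i)) + (if i = last_letter then 0 else C)))"
            unfolding abs_mult
            by (intro sum_mono mult_mono R that) (use itin_cone_nonneg[OF fl cone] in auto)
          also have "\<dots> = \<epsilon> * (\<Sum>i\<in>UNIV. unK (\<Phi> \<alpha>) r \<beta> $ i * wsum (\<lambda>_. 1) (subst_iter (\<Phi> \<alpha>) r i)) +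
              (\<Sum>i\<in>UNIV. unK (\<Phi> \<alpha>) r \<beta> $ i * (if i = last_letter then 0 else C))"
            by (simp add: wsum_one distrib_left sum.distrib sum_distrib_left mult.left_commute)
          also have "(\<Sum>i\<in>UNIV. unK (\<Phi> \<alpha>) r \<beta> $ i * wsum (\<lambda>_. 1) (subst_iter (\<Phi> \<alpha>) r i)) = 1"
            unfolding unK_duality[OF fl] using sum\<beta> by simp
          also have "(\<Sum>i\<in>UNIV. unK (\<Phi> \<alpha>) r \<beta> $ i * (if i = last_letter then 0 else C)) =
              (\<Sum>i\<in>UNIV - {last_letter}. unK (\<Phi> \<alpha>) r \<beta> $ i * C)"
            by (intro sum.mono_neutral_cong_right) auto
          finally show ?thesis by simp
        qed
        moreover have "?e \<longlonglongrightarrow> \<epsilon> + (\<Sum>i\<in>UNIV - {last_letter :: 'k}. 0 * C)"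
          by (intro tendsto_intros unK_tendsto_0[OF fl cone]) auto
        ultimately have "\<bar>?x\<bar> \<le> \<epsilon> + (\<Sum>i\<in>UNIV - {last_letter :: 'k}. 0 * C)"
          by (intro LIMSEQ_le_const) auto
        then show ?thesis by simp
      qed
      then have "\<bar>?x\<bar> \<le> 0" by (rule field_le_epsilon)
      then show ?thesis by simp
    qed
    have "\<beta> $ j = \<alpha> $ j" for j
    proof -
      have "(\<Sum>i\<in>UNIV. \<beta> $ i * (of_bool (i = j) - \<alpha> $ j)) = 0"
        by (rule zero[OF sum_centred_indicator[OF sum]])
      moreover have "(\<Sum>i\<in>UNIV. \<beta> $ i * (of_bool (i = j) - \<beta> $ j)) = 0"
        by (rule sum_centred_indicator[OF sum\<beta>])
      ultimately show ?thesis using sum\<beta>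
        by (simp add: right_diff_distrib sum_subtractf flip: sum_distrib_right)
    qed
    then show ?thesis by (simp add: vec_eq_iff)
  qed
  then show ?thesis using Delta_in_itin_cell[OF fl \<alpha>] by blast
qed

end

theorem theorem24:
  fixes \<alpha> :: "real ^ 'k::{finite,linorder}"
  assumes "CARD('k) \<ge> 2" and "\<alpha> \<in> \<Delta>"
  shows "(\<exists>d::nat. d \<le> CARD('k) - 2 \<and> int d simplex \<Phi>_fibre \<alpha>) \<and>
         (infimax \<alpha> \<in> maximal_freq_seqs \<alpha> \<longleftrightarrow> (\<exists>p. \<Phi>_fibre \<alpha> = {p}))"
proof
  note fl = first_neq_last[OF assms(1)]
  note fibre = fibre_eq_itin_cell[OF fl assms(2)]
  have mem: "\<alpha> \<in> itin_cell (\<Phi> \<alpha>)" by (rule Delta_in_itin_cell[OF fl assms(2)])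
  then show "\<exists>d::nat. d \<le> CARD('k) - 2 \<and> int d simplex \<Phi>_fibre \<alpha>"
    unfolding fibre by (intro itin_cell_simplex[OF fl]) blast
  show "infimax \<alpha> \<in> maximal_freq_seqs \<alpha> \<longleftrightarrow> (\<exists>p. \<Phi>_fibre \<alpha> = {p})"
  proof
    assume "infimax \<alpha> \<in> maximal_freq_seqs \<alpha>"
    then show "\<exists>p. \<Phi>_fibre \<alpha> = {p}"
      unfolding fibre using itin_cell_eq_singleton[OF fl assms(2)] by (auto simp: maximal_freq_seqs_def)
  next
    assume "\<exists>p. \<Phi>_fibre \<alpha> = {p}"
    then have "itin_cell (\<Phi> \<alpha>) = {\<alpha>}" using mem unfolding fibre by auto
    then show "infimax \<alpha> \<in> maximal_freq_seqs \<alpha>"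
      using infimax_freq[OF fl assms(2)] infimax_maximal[OF fl assms(2)] by (simp add: maximal_freq_seqs_def)
  qed
qed

end
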